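(* Let $k,s$ be integers with $1\leq s\leq k-1$. Then \[ \sum_{\substack{n_1,\dots,n_{k-1}\geq 0 \\ m_1,\dots,m_{k-1}\geq 0}} \frac{q^{\sum_{i=1}^{k-1}(n_i^2-n_im_i+m_i^2)+ \sum_{i=s}^{k-1}(n_i+m_i)}}{(q)_{n_1}}\,{2n_{k-1} \brack m_{k-1}} \prod_{i=1}^{k-2} {n_i \brack n_{i+1}} {n_i-n_{i+1}+m_{i+1}+\delta_{i,s-1} \brack m_i} =\frac{(q^{3k+1};q^{3k+1})_{\infty}^2}{(q;q)_{\infty}^2} \sum_{i=1}^s q^{s-i}\,\theta(q^i,q^i,q^{2i};q^{3k+1}). \]
   Context: Identities are between formal power series in $q$. For $n\in\mathbb{Z}$, $(a)_n=(a;q)_n:=(a;q)_\infty/(aq^n;q)_\infty$ with $(a;q)_\infty=\prod_{i\geq0}(1-aq^i)$. $\theta(a;q):=(a;q)_\infty(q/a;q)_\infty$ and $\theta(a_1,\dots,a_j;q):=\theta(a_1;q)\cdots\theta(a_j;q)$. For $n,m\in\mathbb{Z}$, ${n\brack m}=\frac{(q)_n}{(q)_m(q)_{n-m}}$ if $0\leq m\leq n$ and $0$ otherwise. $\delta_{i,j}$ is the Kronecker delta. Empty products are $1$. *)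

theory Defs
  imports "HOL-Analysis.Analysis" "HOL-Computational_Algebra.Formal_Power_Series"
begin

text \<open>
  Everything lives in the ring of formal power series with rational coefficients, with
  \<^term>\<open>fps_X :: rat fps\<close> for the formal variable \<open>q\<close>.  Infinite products and sums are taken in the
  library's metric topology on \<^typ>\<open>rat fps\<close>, which is the \<open>q\<close>-adic one.
\<close>

text \<open>\<open>(a; p)\<^sub>\<infinity>\<close>\<close>

definition qpoch_inf :: "rat fps \<Rightarrow> rat fps \<Rightarrow> rat fps" where
  "qpoch_inf a p = (\<Prod>i. 1 - a * p ^ i)"

lemma qpoch_inf_has_prod:
  fixes a p :: "rat fps"
  assumes p: "fps_nth p 0 = 0"
  shows "(\<lambda>i. 1 - a * p ^ i) has_prod qpoch_inf a p"
proof -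
  let ?f = "\<lambda>i. 1 - a * p ^ i"
  define P where "P n = (\<Prod>i\<le>n. ?f (i + 1))" for n
  have step: "fps_nth (P (Suc n)) j = fps_nth (P n) j" if "j \<le> n" for n j
  proof -
    have "fps_nth (P n * a * p ^ (n + 2)) j = 0"
      unfolding fps_mult_nth[of "P n * a"]
    proof (intro sum.neutral ballI)
      fix i
      have "fps_nth (p ^ (n + 2)) (j - i) = 0"
        using that by (intro startsby_zero_power_prefix[OF p, rule_format]) simp
      then show "fps_nth (P n * a) i * fps_nth (p ^ (n + 2)) (j - i) = 0" by simp
    qed
    moreover have "P (Suc n) = P n - P n * a * p ^ (n + 2)"
      by (simp add: P_def algebra_simps)
    ultimately show ?thesis by simp
  qed
  have stable: "fps_nth (P n) j = fps_nth (P j) j" if "j \<le> n" for n j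
    using that by (induction n rule: dec_induct) (simp_all add: step)
  define L where "L = Abs_fps (\<lambda>j. fps_nth (P j) j)"
  have L: "fps_nth (P n) j = fps_nth L j" if "j \<le> n" for n j
    using stable[OF that] by (simp add: L_def)
  have "fps_nth L 0 = 1"
    by (simp add: L_def P_def p)
  then have "L \<noteq> 0" by auto
  have "\<exists>x. ?f has_prod x"
  proof (cases "a = 1")
    case True
    have "P \<longlonglongrightarrow> L"
      by (rule tendsto_fpsI, unfold eventually_sequentially) (blast intro: L)
    then have "raw_has_prod ?f (Suc 0) L"
      using \<open>L \<noteq> 0\<close> by (simp add: raw_has_prod_def P_def[abs_def])
    then have "?f has_prod 0"
      unfolding has_prod_def using True by (intro disjI2 exI[of _ 0] exI[of _ L]) simp
    then show ?thesis ..
  next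
    case False
    have "(\<Prod>i\<le>Suc n. ?f i) = (1 - a) * P n" for n
      unfolding P_def by (subst prod.atMost_Suc_shift) simp
    moreover have "fps_nth ((1 - a) * P n) j = fps_nth ((1 - a) * L) j" if "j \<le> n" for n j
      unfolding fps_mult_nth using that by (intro sum.cong refl) (simp add: L)
    then have "(\<lambda>n. (1 - a) * P n) \<longlonglongrightarrow> (1 - a) * L"
      by (intro tendsto_fpsI, unfold eventually_sequentially) blast
    ultimately have "(\<lambda>n. \<Prod>i\<le>n. ?f i) \<longlonglongrightarrow> (1 - a) * L"
      by (subst filterlim_sequentially_Suc[symmetric]) simp
    then have "?f has_prod ((1 - a) * L)"
      using False \<open>L \<noteq> 0\<close> by (simp add: has_prod_def raw_has_prod_def)
    then show ?thesis ..
  qed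
  then obtain x where "?f has_prod x" ..
  moreover from this have "qpoch_inf a p = x"
    unfolding qpoch_inf_def by (rule has_prod_unique[symmetric])
  ultimately show ?thesis by simp
qed

text \<open>
  \<open>(a; p)\<^sub>n\<close>, restricted to \<open>n \<ge> 0\<close>: for negative \<open>n\<close> the series \<open>a p\<^sup>n\<close> need not be a power series.
\<close>

definition qpoch :: "rat fps \<Rightarrow> rat fps \<Rightarrow> nat \<Rightarrow> rat fps" where
  "qpoch a p n = qpoch_inf a p / qpoch_inf (a * p ^ n) p"

text \<open>
  \<open>\<theta>(a; p) = (a; p)\<^sub>\<infinity> (p/a; p)\<^sub>\<infinity>\<close>.  The quotient \<open>p / a\<close> is the division of \<^typ>\<open>rat fps\<close>, which
  truncates unless \<open>a\<close> divides \<open>p\<close>; for \<open>a = q\<^sup>i\<close> and \<open>p = q\<^sup>N\<close> it is exact as long as \<open>i \<le> N\<close>.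
\<close>

definition theta :: "rat fps \<Rightarrow> rat fps \<Rightarrow> rat fps" where
  "theta a p = qpoch_inf a p * qpoch_inf (p / a) p"

definition thetas :: "rat fps list \<Rightarrow> rat fps \<Rightarrow> rat fps" where
  "thetas as p = (\<Prod>a\<leftarrow>as. theta a p)"

definition qbinom :: "int \<Rightarrow> int \<Rightarrow> rat fps" where
  "qbinom n m =
    (if 0 \<le> m \<and> m \<le> n
     then qpoch fps_X fps_X (nat n) /
          (qpoch fps_X fps_X (nat m) * qpoch fps_X fps_X (nat (n - m)))
     else 0)"

definition kdelta :: "nat \<Rightarrow> nat \<Rightarrow> int" where
  "kdelta i j = (if i = j then 1 else 0)"

text \<open>
  The quadratic form \<open>x\<^sup>2 - x y + y\<^sup>2\<close> is nonnegative, so the passage to \<^typ>\<open>nat\<close> below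
  does not truncate.
\<close>

definition qexponent :: "nat \<Rightarrow> nat \<Rightarrow> (nat \<Rightarrow> nat) \<Rightarrow> (nat \<Rightarrow> nat) \<Rightarrow> nat" where
  "qexponent k s n m = nat
     ((\<Sum>i = 1..k - 1. int (n i) ^ 2 - int (n i) * int (m i) + int (m i) ^ 2) +
      (\<Sum>i = s..k - 1. int (n i) + int (m i)))"

definition summand :: "nat \<Rightarrow> nat \<Rightarrow> (nat \<Rightarrow> nat) \<Rightarrow> (nat \<Rightarrow> nat) \<Rightarrow> rat fps" where
  "summand k s n m =
     fps_X ^ qexponent k s n m / qpoch fps_X fps_X (n 1) *
     qbinom (2 * int (n (k - 1))) (int (m (k - 1))) *
     (\<Prod>i = 1..k - 2.
        qbinom (int (n i)) (int (n (i + 1))) *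
        qbinom (int (n i) - int (n (i + 1)) + int (m (i + 1)) + kdelta i (s - 1)) (int (m i)))"

text \<open>
  Tuples \<open>(n\<^sub>1, \<dots>, n\<^sub>k\<^sub>-\<^sub>1)\<close> of natural numbers, as functions that are \<^term>\<open>undefined\<close>
  outside \<open>{1..k - 1}\<close>, so that each tuple is represented exactly once.
\<close>

definition tuples :: "nat \<Rightarrow> (nat \<Rightarrow> nat) set" where
  "tuples k = ({1..k - 1} \<rightarrow>\<^sub>E UNIV)"

end

theory Submission
  imports Defs "HOL-Computational_Algebra.Formal_Laurent_Series"
begin

text \<open>
  By the \<open>q\<close>-Chu--Vandermonde summation the sums over \<open>m\<^sub>k\<^sub>-\<^sub>1, \<dots>, m\<^sub>1\<close> can be converted, from
  the inside out, into sums in which \<open>n\<close> and \<open>m\<close> play symmetric roles; the left side thereby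
  becomes a \<open>(k - 1)\<close>-fold iterate of the \<open>A\<^sub>2\<close> Bailey transform applied to
  \<open>1 / ((q)\<^sub>L (q)\<^sub>M (q)\<^sub>L\<^sub>+\<^sub>M\<^sub>+\<^sub>1)\<close>, with linear exponents exactly in the innermost \<open>k - s\<close> steps. For a
  vector \<open>v\<close> of the \<open>A\<^sub>2\<close> root lattice the transform multiplies
  \<open>(q)\<^sub>L\<^sub>+\<^sub>M / \<Prod>\<^sub>i (q)\<^sub>L\<^sub>-\<^sub>v\<^sub>i (q)\<^sub>M\<^sub>+\<^sub>v\<^sub>i\<close> by \<open>q\<close> to the power \<open>v\<cdot>v/2\<close>, so it suffices to expand the initial
  function into such products. That expansion is an alternating sum over the affine Weyl group,
  which is evaluated by cancelling its terms in pairs under reflections. Where the linear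
  exponents end, \<open>v\<close> has to be shifted by \<open>\<rho>\<close>; the shift is available only
  after multiplication by \<open>1 - q\<^sup>L\<^sup>+\<^sup>M\<^sup>+\<^sup>1\<close>, that is, for the sum with parameter \<open>s\<close> minus \<open>q\<close> times the
  sum with parameter \<open>s - 1\<close>, and this telescopes to the sum over \<open>i\<close> on the right. For
  \<open>L = M \<rightarrow> \<infinity>\<close> each lattice sum becomes the specialized \<open>A\<^sub>2\<close> Macdonald identity, which follows by
  multiplying three Jacobi triple products and summing out one index by the pentagonal number
  theorem.
\<close>

subsection \<open>The $q$-Chu--Vandermonde summation and the $A_2$ Bailey lemma\<close>

text \<open>The multisum treats the two kinds of indices differently, so it is not summed directly:
  every identity is proved for two finite levels L and M, where all sums are finite and recursions
  in the levels are available, and only at the end does L = M tend to infinity. The finite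
  identities live over a field because negative powers of q occur and factors 1 - q^n are divided
  out; the field of Laurent series carries them back to power series. The lattice is that of integer
  triples with sum zero; reflections permute coordinates, and rho = (1, 0, -1). The modulus 3k + 1
  arises because the initial function has weight 4 and each of the k - 1 transforms adds |v|^2/2,
  three times the normalized quadratic form up to a constant. After the shift by rho, each of the s
  - 1 remaining transforms also adds the linear form rho.rho - v.rho, which is present once from the
  beginning; s copies of it produce the arguments q^s, q^s, q^(2s).\<close>

locale q_field =
  fixes q :: "'a::field_char_0"
  assumes q_nonzero [simp]: "q \<noteq> 0"
    and q_not_root: "n > 0 \<Longrightarrow> q ^ n \<noteq> 1"
begin

definition qp :: "int \<Rightarrow> 'a" where
  "qp n = (\<Prod>i<nat n. 1 - q ^ Suc i)"

text \<open>The value 0 at negative n makes (1 - q^n)/(q)_n = 1/(q)_(n-1) hold for every integer n,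
  so terms outside the natural range of a sum vanish by themselves. \<open>qp\<close> has no such
  extension: it is 1 at negative n, and its recursion starts only at n = 1.\<close>

definition iq :: "int \<Rightarrow> 'a" where
  "iq n = (if n < 0 then 0 else inverse (qp n))"

definition qbin :: "int \<Rightarrow> int \<Rightarrow> 'a" where
  "qbin n m = (if 0 \<le> n then qp n * iq m * iq (n - m) else 0)"

lemma qpow_comb: "q powi a * q powi b = q powi (a + b)"
  by (simp add: power_int_add)

lemma qpow_comb_left: "q powi a * (q powi b * c) = q powi (a + b) * c"
  by (simp add: power_int_add mult.assoc)

lemma powi_not_root: "n \<noteq> 0 \<Longrightarrow> q powi n \<noteq> 1"
proof -
  have *: "q powi n \<noteq> 1" if "n > 0" for n
    using q_not_root[of "nat n"] that by (simp add: power_int_def)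
  assume "n \<noteq> 0"
  then consider "n > 0" | "- n > 0" by linarith
  then show "q powi n \<noteq> 1"
  proof cases
    case 2
    with *[of "- n"] show ?thesis by (simp add: power_int_minus)
  qed (rule *)
qed

lemma qp_nonzero [simp]: "qp n \<noteq> 0"
  using q_not_root[of "Suc _"] by (simp add: qp_def)

lemma qp_nonpos [simp]: "n \<le> 0 \<Longrightarrow> qp n = 1"
  by (simp add: qp_def)

lemma qp_rec: "n > 0 \<Longrightarrow> qp n = (1 - q powi n) * qp (n - 1)"
proof -
  assume n: "n > 0"
  then obtain k where k: "n = int (Suc k)" by (metis gr0_implies_Suc pos_int_cases)
  have "q powi n = q ^ Suc k" unfolding k by (rule power_int_of_nat)
  moreover have "nat n = Suc k" "nat (n - 1) = k" using k by simp_all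
  ultimately show ?thesis by (simp add: qp_def)
qed

lemma iq_neg [simp]: "n < 0 \<Longrightarrow> iq n = 0"
  by (simp add: iq_def)

lemma iq_0 [simp]: "iq 0 = 1"
  by (simp add: iq_def)

lemma qp_iq: "n \<ge> 0 \<Longrightarrow> qp n * iq n = 1"
  by (simp add: iq_def)

lemma iq_rec: "(1 - q powi n) * iq n = iq (n - 1)"
proof (cases "n > 0")
  case True
  with powi_not_root[of n] show ?thesis
    by (simp add: iq_def qp_rec[OF True])
next
  case False
  then show ?thesis by (cases "n = 0") auto
qed

lemma iq_pred: "iq (n - 1) = (1 - q powi n) * iq n"
  by (simp add: iq_rec)

lemma iq_nonzero: "n \<ge> 0 \<Longrightarrow> iq n \<noteq> 0"
  by (simp add: iq_def)

section \<open>The q-Chu--Vandermonde summation and its limiting case\<close>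

lemma int_sum_shift:
  "(\<Sum>t\<in>{a..b::int}. f t) = (\<Sum>t\<in>{a - c..b - c}. f (t + c))"
  by (rule sum.reindex_bij_witness[of _ "\<lambda>t. t + c" "\<lambda>t. t - c"]) auto

text \<open>With M = m + 1, the splitting 1 - q^M = (1 - q^(M-t)) + q^(M-t) (1 - q^t) cancels a
  factor against 1/(q)_(M-t) or 1/(q)_t: the first part is the summand for m, the second the summand
  for m with t lowered and d raised by 1. Hence d varies in the induction.\<close>

lemma iq_vandermonde_inf_aux:
  "(\<Sum>t\<in>{0..int m}. q powi (t * (t + d)) * iq t * iq (t + d) * iq (int m - t)) = iq (int m) * iq (int m + d)"
proof (induction m arbitrary: d)
  case 0
  then show ?case by simp
next
  case (Suc m)
  let ?M = "int m + 1"
  define F where "F m d t = q powi (t * (t + d)) * iq t * iq (t + d) * iq (m - t)" for m d t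
  have split: "(1 - q powi ?M) * F ?M d t = F (int m) d t + q powi (?M + d) * F (int m) (d + 1) (t - 1)" for t
  proof -
    have 1: "(1 - q powi ?M) = (1 - q powi (?M - t)) + q powi (?M - t) * (1 - q powi t)"
      by (simp add: algebra_simps qpow_comb)
    have "iq (int m - t) = (1 - q powi (?M - t)) * iq (?M - t)"
      using iq_pred[of "?M - t"] by simp
    then have a: "(1 - q powi (?M - t)) * F ?M d t = F (int m) d t"
      unfolding F_def by (simp only: mult_ac)
    have "q powi (?M - t) * (1 - q powi t) * F ?M d t
       = q powi (?M - t) * q powi (t * (t + d)) * ((1 - q powi t) * iq t) * iq (t + d) * iq (?M - t)"
      unfolding F_def by (simp add: mult_ac)
    also have "\<dots> = q powi (?M + d) * F (int m) (d + 1) (t - 1)"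
      unfolding F_def iq_rec qpow_comb mult.assoc qpow_comb_left
      by (simp add: algebra_simps)
    finally show ?thesis unfolding 1 distrib_right a by simp
  qed
  have s1: "(\<Sum>t\<in>{0..?M}. F (int m) d t) = (\<Sum>t\<in>{0..int m}. F (int m) d t)"
    by (rule sum.mono_neutral_right) (auto simp: F_def)
  have "(\<Sum>t\<in>{0..?M}. F (int m) (d + 1) (t - 1)) = (\<Sum>t\<in>{-1..int m}. F (int m) (d + 1) t)"
    by (subst int_sum_shift[of _ 0 _ 1]) simp
  also have "\<dots> = (\<Sum>t\<in>{0..int m}. F (int m) (d + 1) t)"
    by (rule sum.mono_neutral_right) (auto simp: F_def)
  finally have s2: "(\<Sum>t\<in>{0..?M}. F (int m) (d + 1) (t - 1)) = iq (int m) * iq (int m + d + 1)"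
    using Suc[of "d + 1"] by (simp add: F_def add.assoc)
  have "(1 - q powi ?M) * (\<Sum>t\<in>{0..?M}. F ?M d t)
      = iq (int m) * iq (int m + d) + q powi (?M + d) * (iq (int m) * iq (int m + d + 1))"
    unfolding sum_distrib_left split sum.distrib s1 sum_distrib_left[symmetric] s2
    using Suc[of d] by (simp add: F_def)
  also have "\<dots> = iq (int m) * iq (?M + d)"
  proof -
    have "iq (int m + d) = (1 - q powi (?M + d)) * iq (?M + d)"
      by (simp flip: iq_pred)
    show ?thesis unfolding \<open>iq (int m + d) = _\<close> by (simp add: algebra_simps)
  qed
  also have "\<dots> = (1 - q powi ?M) * (iq ?M * iq (?M + d))"
  proof -
    have "iq (int m) = (1 - q powi ?M) * iq ?M"
      by (simp flip: iq_pred)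
    then show ?thesis by (simp only: mult_ac)
  qed
  finally have "(\<Sum>t\<in>{0..?M}. F ?M d t) = iq ?M * iq (?M + d)"
    using powi_not_root[of ?M] by simp
  then show ?case by (simp add: F_def add.commute)
qed

text \<open>The splitting of the limiting case works again; because of 1/(q)_(n-t), its second part
  now also lowers n by 1, which keeps n + d fixed.\<close>

lemma iq_vandermonde_aux:
  "(\<Sum>t\<in>{0..int m}. q powi (t * (t + d)) * iq t * iq (t + d) * iq (int m - t) * iq (n - t))
    = qp (int m + n + d) * iq (int m) * iq n * iq (int m + d) * iq (n + d)"
proof (induction m arbitrary: d n)
  case 0
  show ?case
  proof (cases "n < 0 \<or> d < 0")
    case False
    then have "qp (n + d) * iq (n + d) = 1" by (intro qp_iq) simp
    then show ?thesis by (simp add: mult_ac)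
  qed auto
next
  case (Suc m)
  let ?M = "int m + 1"
  define F where "F m n d t = q powi (t * (t + d)) * iq t * iq (t + d) * iq (m - t) * iq (n - t)" for m n d t
  have split: "(1 - q powi ?M) * F ?M n d t = F (int m) n d t + q powi (?M + d) * F (int m) (n - 1) (d + 1) (t - 1)" for t
  proof -
    have 1: "(1 - q powi ?M) = (1 - q powi (?M - t)) + q powi (?M - t) * (1 - q powi t)"
      by (simp add: algebra_simps qpow_comb)
    have "iq (int m - t) = (1 - q powi (?M - t)) * iq (?M - t)"
      using iq_pred[of "?M - t"] by simp
    then have a: "(1 - q powi (?M - t)) * F ?M n d t = F (int m) n d t"
      unfolding F_def by (simp only: mult_ac)
    have "q powi (?M - t) * (1 - q powi t) * F ?M n d t
       = q powi (?M - t) * q powi (t * (t + d)) * ((1 - q powi t) * iq t) * iq (t + d) * iq (?M - t) * iq (n - t)"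
      unfolding F_def by (simp add: mult_ac)
    also have "\<dots> = q powi (?M + d) * F (int m) (n - 1) (d + 1) (t - 1)"
      unfolding F_def iq_rec qpow_comb mult.assoc qpow_comb_left
      by (simp add: algebra_simps)
    finally show ?thesis unfolding 1 distrib_right a by simp
  qed
  have s1: "(\<Sum>t\<in>{0..?M}. F (int m) n d t) = (\<Sum>t\<in>{0..int m}. F (int m) n d t)"
    by (rule sum.mono_neutral_right) (auto simp: F_def)
  have "(\<Sum>t\<in>{0..?M}. F (int m) (n - 1) (d + 1) (t - 1)) = (\<Sum>t\<in>{-1..int m}. F (int m) (n - 1) (d + 1) t)"
    by (subst int_sum_shift[of _ 0 _ 1]) simp
  also have "\<dots> = (\<Sum>t\<in>{0..int m}. F (int m) (n - 1) (d + 1) t)"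
    by (rule sum.mono_neutral_right) (auto simp: F_def)
  finally have s2: "(\<Sum>t\<in>{0..?M}. F (int m) (n - 1) (d + 1) (t - 1)) =
      qp (int m + n + d) * iq (int m) * iq (n - 1) * iq (?M + d) * iq (n + d)"
    using Suc[where d = "d + 1" and n = "n - 1"] by (simp add: F_def algebra_simps)
  have "(1 - q powi ?M) * (\<Sum>t\<in>{0..?M}. F ?M n d t)
      = qp (int m + n + d) * iq (int m) * iq n * iq (int m + d) * iq (n + d)
        + q powi (?M + d) * (qp (int m + n + d) * iq (int m) * iq (n - 1) * iq (?M + d) * iq (n + d))"
    unfolding sum_distrib_left split sum.distrib s1 sum_distrib_left[symmetric] s2
    using Suc[where d = d and n = n] by (simp add: F_def)
  also have "\<dots> = qp (int m + n + d) * iq (int m) * iq n * iq (?M + d) * iq (n + d)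
      * ((1 - q powi (?M + d)) + q powi (?M + d) * (1 - q powi n))"
  proof -
    have "iq (int m + d) = (1 - q powi (?M + d)) * iq (?M + d)"
      by (simp flip: iq_pred)
    show ?thesis unfolding iq_pred[of n] \<open>iq (int m + d) = _\<close> by (simp add: algebra_simps)
  qed
  also have "(1 - q powi (?M + d)) + q powi (?M + d) * (1 - q powi n) = 1 - q powi (?M + n + d)"
    by (simp add: algebra_simps qpow_comb)
  also have "qp (int m + n + d) * iq (int m) * iq n * iq (?M + d) * iq (n + d) * (1 - q powi (?M + n + d))
     = iq (int m) * (qp (?M + n + d) * iq n * iq (?M + d) * iq (n + d))"
  proof (cases "n < 0 \<or> ?M + d < 0")
    case False
    \<comment> \<open>The recursion for \<open>qp\<close> fails at index 0; there n + d is negative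
      and 1/(q)_(n+d) annihilates both sides.\<close>
    show ?thesis
    proof (cases "?M + n + d = 0")
      case True
      then have "n + d < 0" by simp
      then show ?thesis by simp
    next
      case nonzero: False
      have "?M + n + d - 1 = int m + n + d" by simp
      then have "qp (?M + n + d) = (1 - q powi (?M + n + d)) * qp (int m + n + d)"
        using qp_rec[of "?M + n + d"] False nonzero by (simp only:) simp
      then show ?thesis by (simp only: mult_ac)
    qed
  qed auto
  also have "\<dots> = (1 - q powi ?M) * (qp (?M + n + d) * iq ?M * iq n * iq (?M + d) * iq (n + d))"
  proof -
    have "iq (int m) = (1 - q powi ?M) * iq ?M"
      by (simp flip: iq_pred)
    then show ?thesis by (simp only: mult_ac)
  qed
  finally have "(\<Sum>t\<in>{0..?M}. F ?M n d t) = qp (?M + n + d) * iq ?M * iq n * iq (?M + d) * iq (n + d)"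
    using powi_not_root[of ?M] by simp
  then show ?case by (simp add: F_def algebra_simps)
qed

end

lemma sum_swap3:
  "(\<Sum>r\<in>A. \<Sum>s\<in>B. \<Sum>u\<in>C. h u r s) = (\<Sum>u\<in>C. \<Sum>r\<in>A. \<Sum>s\<in>B. h u r s)"
  by (simp add: sum.swap[of _ C B] sum.swap[of _ C A])

context q_field begin

text \<open>Symmetric form in the two lower ends a and b. Any finite set containing the support may
  serve as A, so that several such sums can share one range and be interchanged.\<close>

lemma iq_vandermonde_inf:
  assumes "finite A" "{a..L} \<subseteq> A"
  shows "(\<Sum>t\<in>A. q powi ((t - a) * (t - b)) * iq (t - a) * iq (t - b) * iq (L - t)) = iq (L - a) * iq (L - b)"
proof -
  define F where "F t = q powi ((t - a) * (t - b)) * iq (t - a) * iq (t - b) * iq (L - t)" for t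
  have "sum F A = sum F {a..L}"
    by (rule sum.mono_neutral_right) (use assms in \<open>auto simp: F_def\<close>)
  also have "\<dots> = iq (L - a) * iq (L - b)"
  proof (cases "a \<le> L")
    case True
    then have m: "int (nat (L - a)) = L - a" by simp
    show ?thesis
      using iq_vandermonde_inf_aux[of "a - b" "nat (L - a)"]
      unfolding m by (subst int_sum_shift[of _ _ _ a]) (simp add: F_def algebra_simps)
  qed auto
  finally show ?thesis by (simp add: F_def)
qed

lemma iq_vandermonde:
  assumes "finite A" "{a..r} \<subseteq> A"
  shows "(\<Sum>t\<in>A. q powi ((t - a) * (t - b)) * iq (t - a) * iq (t - b) * iq (r - t) * iq (n - t))
    = qp (r + n - a - b) * iq (r - a) * iq (r - b) * iq (n - a) * iq (n - b)"
proof -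
  define F where "F t = q powi ((t - a) * (t - b)) * iq (t - a) * iq (t - b) * iq (r - t) * iq (n - t)" for t
  have "sum F A = sum F {a..r}"
    by (rule sum.mono_neutral_right) (use assms in \<open>auto simp: F_def\<close>)
  also have "\<dots> = qp (r + n - a - b) * iq (r - a) * iq (r - b) * iq (n - a) * iq (n - b)"
  proof (cases "a \<le> r")
    case True
    then have m: "int (nat (r - a)) = r - a" by simp
    show ?thesis
      using iq_vandermonde_aux[where d = "a - b" and n = "n - a" and m = "nat (r - a)"]
      unfolding m by (subst int_sum_shift[of _ _ _ a]) (simp add: F_def algebra_simps)
  qed auto
  finally show ?thesis by (simp add: F_def)
qed

text \<open>The limiting summation with t = -u, multiplied by q^(-xy). For fixed u the exponent on
  the right has no term xy; this is the device that removes a cross term from a quadratic form and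
  makes a double sum factor.\<close>

lemma qpow_mult_expansion:
  assumes "finite A" "{0..x} \<subseteq> A"
  shows "q powi (- (x * y)) * iq x * iq y
    = (\<Sum>u\<in>A. q powi (u\<^sup>2 - u * x - u * y) * iq u * iq (x - u) * iq (y - u))"
proof -
  have "iq x * iq y = (\<Sum>t\<in>uminus ` A. q powi ((t + x) * (t + y)) * iq (t + x) * iq (t + y) * iq (- t))"
  proof -
    have "- u \<in> A" if "u \<in> {- x..0}" for u
      using assms(2) that by (intro subsetD[OF assms(2)]) simp
    then have "{- x..0} \<subseteq> uminus ` A"
      by (force intro: image_eqI[of _ _ "- _"])
    with assms(1) show ?thesis
      using iq_vandermonde_inf[of "uminus ` A" "- x" 0 "- y"] by simp
  qed
  also have "\<dots> = (\<Sum>u\<in>A. q powi ((x - u) * (y - u)) * iq (x - u) * iq (y - u) * iq u)"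
    by (subst sum.reindex) (auto simp: inj_on_def)
  also have "\<dots> = (\<Sum>u\<in>A. q powi (x * y) * (q powi (u\<^sup>2 - u * x - u * y) * iq u * iq (x - u) * iq (y - u)))"
    by (intro sum.cong refl) (simp add: mult.assoc qpow_comb_left, simp add: algebra_simps power2_eq_square)
  finally have "iq x * iq y = q powi (x * y) * (\<Sum>u\<in>A. q powi (u\<^sup>2 - u * x - u * y) * iq u * iq (x - u) * iq (y - u))"
    by (simp only: sum_distrib_left)
  then show ?thesis
    unfolding mult.assoc by (simp add: qpow_comb_left)
qed

lemma qbin_eq_0: "m < 0 \<or> m > n \<Longrightarrow> qbin n m = 0"
  by (auto simp: qbin_def)

lemma qbin_sym: "qbin n (n - m) = qbin n m"
  by (simp add: qbin_def)

text \<open>Expanding \<open>q powi (- (a + b) * s)\<close> in terms of \<open>iq\<close>'s reduces the left side to the case \<open>b = - a\<close>.\<close>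
lemma iq_sum_eq_qbin_sum:
  assumes "a + b \<ge> 0"
  shows "(\<Sum>s\<in>{0..S}. q powi (s\<^sup>2 - b * s) * iq (S - s) * iq s * iq (s + a))
    = iq S * (\<Sum>m\<in>{0..a + b}. q powi (m\<^sup>2 - b * m) * qbin (a + b) m * iq (S - b + m))"
proof -
  define N where "N = a + b"
  have N: "N \<ge> 0" using assms by (simp add: N_def)
  have expand: "q powi (s\<^sup>2 - b * s) * iq (s + a)
    = (\<Sum>m\<in>{0..N}. qbin N m * q powi (m\<^sup>2 - m * N + N * a - m * a) * (q powi (s * (s + a - m)) * iq (s + a - m)))" for s
  proof -
    have "q powi (- (N * (s + a))) * iq (s + a) = qp N * (q powi (- (N * (s + a))) * iq N * iq (s + a))"
      using qp_iq[OF N] by (simp add: mult_ac)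
    also have "\<dots> = (\<Sum>m\<in>{0..N}. qbin N m * q powi (m\<^sup>2 - m * N - m * (s + a)) * iq (s + a - m))"
      unfolding qpow_mult_expansion[OF finite_atLeastAtMost_int order_refl] sum_distrib_left
      using N by (intro sum.cong refl) (simp add: qbin_def mult_ac)
    finally have e: "q powi (- (N * (s + a))) * iq (s + a) = \<dots>" .
    have "q powi (s\<^sup>2 - b * s) * iq (s + a) = q powi (s * (s + a) + N * a) * (q powi (- (N * (s + a))) * iq (s + a))"
      by (simp add: qpow_comb_left, simp add: N_def algebra_simps power2_eq_square)
    also have "\<dots> = (\<Sum>m\<in>{0..N}. qbin N m * q powi (m\<^sup>2 - m * N + N * a - m * a) * (q powi (s * (s + a - m)) * iq (s + a - m)))"
      unfolding e sum_distrib_left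
      by (intro sum.cong refl)
        (simp only: mult.left_commute[of _ "qbin _ _"] mult.assoc qpow_comb_left, simp add: algebra_simps power2_eq_square)
    finally show ?thesis .
  qed
  have "(\<Sum>s\<in>{0..S}. q powi (s\<^sup>2 - b * s) * iq (S - s) * iq s * iq (s + a))
     = (\<Sum>s\<in>{0..S}. iq (S - s) * iq s * (q powi (s\<^sup>2 - b * s) * iq (s + a)))"
    by (simp add: mult_ac)
  also have "\<dots> = (\<Sum>m\<in>{0..N}. qbin N m * q powi (m\<^sup>2 - m * N + N * a - m * a) *
     (\<Sum>s\<in>{0..S}. q powi (s * (s + a - m)) * iq s * iq (s + a - m) * iq (S - s)))"
    unfolding expand sum_distrib_left
    by (subst sum.swap) (intro sum.cong refl, simp add: mult_ac)
  also have "\<dots> = (\<Sum>m\<in>{0..N}. qbin N m * q powi (m\<^sup>2 - m * N + N * a - m * a) * (iq S * iq (S + a - m)))"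
    using iq_vandermonde_inf[of "{0..S}" 0 S "_ - a"]
    by (intro sum.cong refl) (simp add: algebra_simps)
  \<comment> \<open>Reversing the binomial coefficient, m -> N - m, cancels the constant N a and
    turns the exponent into m^2 - b m.\<close>
  also have "\<dots> = (\<Sum>m\<in>{0..N}. iq S * (q powi (m\<^sup>2 - b * m) * qbin N m * iq (S - b + m)))"
    by (rule sum.reindex_bij_witness[of _ "\<lambda>m. N - m" "\<lambda>m. N - m"])
      (auto simp: qbin_sym N_def algebra_simps power2_eq_square)
  finally show ?thesis by (simp add: N_def sum_distrib_left)
qed

section \<open>The A_2 Bailey lemma\<close>

definition bf :: "int \<Rightarrow> int \<Rightarrow> int \<Rightarrow> int \<Rightarrow> int \<Rightarrow> 'a" where
  "bf L M x y z = iq (L - x) * iq (L - y) * iq (L - z) * iq (M + x) * iq (M + y) * iq (M + z)"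

lemma bf_nonzeroD:
  assumes "bf L M x y z \<noteq> 0"
  shows "x \<le> L" "y \<le> L" "z \<le> L" "- M \<le> x" "- M \<le> y" "- M \<le> z"
proof -
  show "x \<le> L" by (rule ccontr) (use assms in \<open>simp add: bf_def\<close>)
  show "y \<le> L" by (rule ccontr) (use assms in \<open>simp add: bf_def\<close>)
  show "z \<le> L" by (rule ccontr) (use assms in \<open>simp add: bf_def\<close>)
  show "- M \<le> x" by (rule ccontr) (use assms in \<open>simp add: bf_def\<close>)
  show "- M \<le> y" by (rule ccontr) (use assms in \<open>simp add: bf_def\<close>)
  show "- M \<le> z" by (rule ccontr) (use assms in \<open>simp add: bf_def\<close>)
qed

text \<open>The finite summation, read backwards, resolves (q)_(r+s) and four of the six
  denominators into a sum over t; \<open>qpow_mult_expansion\<close> with a new index u removes the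
  cross term -rs, whereupon the sums over r and s separate and fall to the limiting summation. With
  v = t + u, the sum over t is again the limiting summation and the sum over v the finite
  one.\<close>

lemma A2_bailey:
  assumes k: "k1 + k2 + k3 = 0"
  shows "(\<Sum>r\<in>{0..L}. \<Sum>s\<in>{0..M}. q powi (r\<^sup>2 - r * s + s\<^sup>2) * qp (r + s) * bf r s k1 k2 k3 * iq (L - r) * iq (M - s))
    = q powi (k1\<^sup>2 + k1 * k2 + k2\<^sup>2) * qp (L + M) * bf L M k1 k2 k3"
proof -
  \<comment> \<open>Large enough that the supports in r, s, t and v lie in the one interval
    I.\<close>
  define D where "D = 2 * (\<bar>k1\<bar> + \<bar>k2\<bar> + \<bar>k3\<bar> + \<bar>L\<bar> + \<bar>M\<bar>)"
  have D: "L \<le> D" "M \<le> D" "- D \<le> k1" "- D \<le> - k3" "D \<ge> 0" by (auto simp: D_def)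
  define I where "I = {-D..D}"
  have fin [simp]: "finite I" by (simp add: I_def)
  define G where "G r s = q powi (r\<^sup>2 - r * s + s\<^sup>2) * qp (r + s) * bf r s k1 k2 k3 * iq (L - r) * iq (M - s)" for r s
  define W where "W t = q powi ((t - k1) * (t - k2)) * iq (t - k1) * iq (t - k2)" for t
  have G0: "r \<in> {0..L} \<and> s \<in> {0..M}" if "G r s \<noteq> 0" for r s
  proof -
    from that have "bf r s k1 k2 k3 \<noteq> 0" "\<not> L - r < 0" "\<not> M - s < 0"
      unfolding G_def by (metis iq_neg mult_zero_left mult_zero_right)+
    with bf_nonzeroD[OF this(1)] k show ?thesis by auto
  qed
  have sub: "{0..L} \<subseteq> I" "{0..M} \<subseteq> I" by (use D in \<open>auto simp: I_def\<close>)
  have "(\<Sum>r\<in>{0..L}. \<Sum>s\<in>{0..M}. G r s) = (\<Sum>r\<in>I. \<Sum>s\<in>I. G r s)"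
    unfolding sum.cartesian_product
  proof (rule sum.mono_neutral_left)
    show "\<forall>i\<in>I \<times> I - {0..L} \<times> {0..M}. (case i of (r, s) \<Rightarrow> G r s) = 0"
      using G0 by fast
  qed (use sub in auto)
  also have "\<dots> = (\<Sum>r\<in>I. \<Sum>s\<in>I. \<Sum>t\<in>I. W t *
     (q powi (r\<^sup>2 - r * s + s\<^sup>2) * iq (L - r) * iq (M - s) * iq (r - k3) * iq (s + k3) * (iq (r - t) * iq (s - k3 - t))))"
  proof (intro sum.cong refl)
    fix r s assume "r \<in> I" "s \<in> I"
    show "G r s = (\<Sum>t\<in>I. W t *
     (q powi (r\<^sup>2 - r * s + s\<^sup>2) * iq (L - r) * iq (M - s) * iq (r - k3) * iq (s + k3) * (iq (r - t) * iq (s - k3 - t))))"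
    proof (cases "r > L")
      case False
      with D have sub': "{k1..r} \<subseteq> I" by (auto simp: I_def)
      have v: "qp (r + s) * iq (r - k1) * iq (r - k2) * iq (s + k2) * iq (s + k1)
           = (\<Sum>t\<in>I. W t * iq (r - t) * iq (s - k3 - t))"
      proof -
        have "r + (s - k3) - k1 - k2 = r + s" "s - k3 - k1 = s + k2" "s - k3 - k2 = s + k1"
          using k by simp_all
        with iq_vandermonde[OF fin sub', of k2 "s - k3"] show ?thesis
          unfolding W_def by simp
      qed
      have "G r s = (q powi (r\<^sup>2 - r * s + s\<^sup>2) * iq (L - r) * iq (M - s) * iq (r - k3) * iq (s + k3))
           * (qp (r + s) * iq (r - k1) * iq (r - k2) * iq (s + k2) * iq (s + k1))"
        by (simp add: G_def bf_def mult_ac)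
      also have "\<dots> = (\<Sum>t\<in>I. W t *
     (q powi (r\<^sup>2 - r * s + s\<^sup>2) * iq (L - r) * iq (M - s) * iq (r - k3) * iq (s + k3) * (iq (r - t) * iq (s - k3 - t))))"
        unfolding v sum_distrib_left by (simp add: mult_ac)
      finally show ?thesis .
    qed (simp add: G_def)
  qed
  also have "\<dots> = (\<Sum>t\<in>I. W t * (\<Sum>r\<in>I. \<Sum>s\<in>I.
     q powi (r\<^sup>2 - r * s + s\<^sup>2) * iq (L - r) * iq (M - s) * iq (r - k3) * iq (s + k3) * (iq (r - t) * iq (s - k3 - t))))"
    unfolding sum_distrib_left
    by (rule sum_swap3)
  also have "\<dots> = (\<Sum>t\<in>I. W t * (iq (L - k3) * iq (M + k3) *
     (\<Sum>v\<in>I. q powi (v\<^sup>2 + k3 * v + k3\<^sup>2) * iq (v - t) * iq (L - v) * iq (M - k3 - v))))"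
  proof (intro sum.cong refl arg_cong2[of _ _ _ _ "(*)"])
    fix t assume t: "t \<in> I"
    define J where "J = {0..2 * D}"
    have [simp]: "finite J" by (simp add: J_def)
    define X where "X u r = q powi ((r - (t + u)) * (r - k3)) * iq (r - (t + u)) * iq (r - k3) * iq (L - r)" for u r
    define Y where "Y u s = q powi ((s - (k3 + t + u)) * (s - (- k3))) * iq (s - (k3 + t + u)) * iq (s - (- k3)) * iq (M - s)" for u s
    have "(\<Sum>r\<in>I. \<Sum>s\<in>I. q powi (r\<^sup>2 - r * s + s\<^sup>2) * iq (L - r) * iq (M - s) * iq (r - k3) * iq (s + k3) * (iq (r - t) * iq (s - k3 - t)))
      = (\<Sum>r\<in>I. \<Sum>s\<in>I. \<Sum>u\<in>J. (q powi ((t + u)\<^sup>2 + k3 * (t + u) + k3\<^sup>2) * iq u) * (X u r * Y u s))"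
    proof (intro sum.cong refl)
      fix r s assume r: "r \<in> I" and "s \<in> I"
      have "{0..r - t} \<subseteq> J" using r t by (auto simp: I_def J_def)
      have "q powi (r\<^sup>2 - r * s + s\<^sup>2) * iq (L - r) * iq (M - s) * iq (r - k3) * iq (s + k3) * (iq (r - t) * iq (s - k3 - t))
        = (q powi (r\<^sup>2 - r * s + s\<^sup>2 + (r - t) * (s - k3 - t)) * iq (L - r) * iq (M - s) * iq (r - k3) * iq (s + k3))
          * (\<Sum>u\<in>J. q powi (u\<^sup>2 - u * (r - t) - u * (s - k3 - t)) * iq u * iq (r - t - u) * iq (s - k3 - t - u))"
      proof -
        have p: "q powi (r\<^sup>2 - r * s + s\<^sup>2) = q powi (r\<^sup>2 - r * s + s\<^sup>2 + (r - t) * (s - k3 - t)) * q powi (- ((r - t) * (s - k3 - t)))"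
          by (simp add: qpow_comb)
        have "finite J" "{0..r - t} \<subseteq> J" by fact+
        note qpow_mult_expansion[OF this, of "s - k3 - t", symmetric]
        then show ?thesis by (simp only: p mult_ac)
      qed
      also have "\<dots> = (\<Sum>u\<in>J. (q powi ((t + u)\<^sup>2 + k3 * (t + u) + k3\<^sup>2) * iq u) * (X u r * Y u s))"
        unfolding sum_distrib_left
      proof (intro sum.cong refl)
        fix u
        \<comment> \<open>The terms -rs and rs cancel; what depends on r and on s then splits into
          precisely the two exponents that the limiting summation asks for.\<close>
        have e: "r\<^sup>2 - r * s + s\<^sup>2 + (r - t) * (s - k3 - t) + (u\<^sup>2 - u * (r - t) - u * (s - k3 - t))
         = ((t + u)\<^sup>2 + k3 * (t + u) + k3\<^sup>2) + (r - (t + u)) * (r - k3) + (s - (k3 + t + u)) * (s - (- k3))"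
          by (simp add: algebra_simps power2_eq_square)
        have "q powi (r\<^sup>2 - r * s + s\<^sup>2 + (r - t) * (s - k3 - t)) * iq (L - r) * iq (M - s) * iq (r - k3) * iq (s + k3) *
         (q powi (u\<^sup>2 - u * (r - t) - u * (s - k3 - t)) * iq u * iq (r - t - u) * iq (s - k3 - t - u))
         = q powi (r\<^sup>2 - r * s + s\<^sup>2 + (r - t) * (s - k3 - t) + (u\<^sup>2 - u * (r - t) - u * (s - k3 - t))) *
           (iq (L - r) * iq (M - s) * iq (r - k3) * iq (s + k3) * iq u * iq (r - (t + u)) * iq (s - (k3 + t + u)))"
          unfolding qpow_comb[symmetric] by (simp add: mult_ac diff_diff_add add_ac)
        also have "\<dots> = q powi ((t + u)\<^sup>2 + k3 * (t + u) + k3\<^sup>2) * iq u * (X u r * Y u s)"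
          unfolding e qpow_comb[symmetric] X_def Y_def by (simp add: mult_ac)
        finally show "q powi (r\<^sup>2 - r * s + s\<^sup>2 + (r - t) * (s - k3 - t)) * iq (L - r) * iq (M - s) * iq (r - k3) * iq (s + k3) *
         (q powi (u\<^sup>2 - u * (r - t) - u * (s - k3 - t)) * iq u * iq (r - t - u) * iq (s - k3 - t - u))
         = q powi ((t + u)\<^sup>2 + k3 * (t + u) + k3\<^sup>2) * iq u * (X u r * Y u s)" .
      qed
      finally show "q powi (r\<^sup>2 - r * s + s\<^sup>2) * iq (L - r) * iq (M - s) * iq (r - k3) * iq (s + k3) * (iq (r - t) * iq (s - k3 - t))
        = (\<Sum>u\<in>J. (q powi ((t + u)\<^sup>2 + k3 * (t + u) + k3\<^sup>2) * iq u) * (X u r * Y u s))" .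
    qed
    also have "\<dots> = (\<Sum>u\<in>J. (q powi ((t + u)\<^sup>2 + k3 * (t + u) + k3\<^sup>2) * iq u) * ((\<Sum>r\<in>I. X u r) * (\<Sum>s\<in>I. Y u s)))"
      unfolding sum_product
      by (subst sum_swap3) (simp add: sum_distrib_left)
    also have "\<dots> = (\<Sum>u\<in>J. (q powi ((t + u)\<^sup>2 + k3 * (t + u) + k3\<^sup>2) * iq u) * ((iq (L - (t + u)) * iq (L - k3)) * (iq (M - (k3 + t + u)) * iq (M + k3))))"
    proof (intro sum.cong refl arg_cong2[of _ _ _ _ "(*)"])
      fix u assume u: "u \<in> J"
      have "{t + u..L} \<subseteq> I" using u t D by (auto simp: I_def J_def)
      from iq_vandermonde_inf[OF fin this, of k3]
      show "(\<Sum>r\<in>I. X u r) = iq (L - (t + u)) * iq (L - k3)" by (simp add: X_def)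
      show "(\<Sum>s\<in>I. Y u s) = iq (M - (k3 + t + u)) * iq (M + k3)"
      proof -
        have "(\<Sum>s\<in>I. Y u s) = (\<Sum>s\<in>{- k3..M}. Y u s)"
          by (rule sum.mono_neutral_right) (use D in \<open>auto simp: I_def Y_def\<close>)
        also have "\<dots> = (\<Sum>s\<in>{- k3..M}. q powi ((s - (- k3)) * (s - (k3 + t + u))) * iq (s - (- k3)) * iq (s - (k3 + t + u)) * iq (M - s))"
          by (simp add: Y_def mult_ac)
        also have "\<dots> = iq (M - (k3 + t + u)) * iq (M + k3)"
          by (subst iq_vandermonde_inf) (simp_all add: mult_ac)
        finally show ?thesis .
      qed
    qed
    also have "\<dots> = iq (L - k3) * iq (M + k3) * (\<Sum>u\<in>J. q powi ((t + u)\<^sup>2 + k3 * (t + u) + k3\<^sup>2) * iq (t + u - t) * iq (L - (t + u)) * iq (M - k3 - (t + u)))"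
      unfolding sum_distrib_left by (simp add: mult_ac diff_diff_add add.assoc)
    also have "(\<Sum>u\<in>J. q powi ((t + u)\<^sup>2 + k3 * (t + u) + k3\<^sup>2) * iq (t + u - t) * iq (L - (t + u)) * iq (M - k3 - (t + u)))
       = (\<Sum>v\<in>(+) t ` J. q powi (v\<^sup>2 + k3 * v + k3\<^sup>2) * iq (v - t) * iq (L - v) * iq (M - k3 - v))"
      by (subst sum.reindex) (auto simp: inj_on_def)
    also have "\<dots> = (\<Sum>v\<in>{t..L}. q powi (v\<^sup>2 + k3 * v + k3\<^sup>2) * iq (v - t) * iq (L - v) * iq (M - k3 - v))"
    proof (rule sum.mono_neutral_right)
      have "v \<in> (+) t ` J" if "v \<in> {t..L}" for v
        using that t D by (intro image_eqI[of _ _ "v - t"]) (auto simp: J_def I_def)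
      then show "{t..L} \<subseteq> (+) t ` J" by blast
    qed (auto simp: J_def)
    also have "\<dots> = (\<Sum>v\<in>I. q powi (v\<^sup>2 + k3 * v + k3\<^sup>2) * iq (v - t) * iq (L - v) * iq (M - k3 - v))"
      by (rule sum.mono_neutral_left) (use t D in \<open>auto simp: I_def\<close>)
    finally show "(\<Sum>r\<in>I. \<Sum>s\<in>I. q powi (r\<^sup>2 - r * s + s\<^sup>2) * iq (L - r) * iq (M - s) * iq (r - k3) * iq (s + k3) * (iq (r - t) * iq (s - k3 - t)))
      = iq (L - k3) * iq (M + k3) * (\<Sum>v\<in>I. q powi (v\<^sup>2 + k3 * v + k3\<^sup>2) * iq (v - t) * iq (L - v) * iq (M - k3 - v))" .
  qed
  also have "\<dots> = iq (L - k3) * iq (M + k3) * (\<Sum>v\<in>I. q powi (v\<^sup>2 + k3 * v + k3\<^sup>2) * iq (L - v) * iq (M - k3 - v) * (\<Sum>t\<in>I. W t * iq (v - t)))"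
    unfolding sum_distrib_left by (subst sum.swap) (simp add: mult_ac)
  also have "(\<Sum>v\<in>I. q powi (v\<^sup>2 + k3 * v + k3\<^sup>2) * iq (L - v) * iq (M - k3 - v) * (\<Sum>t\<in>I. W t * iq (v - t)))
     = (\<Sum>v\<in>I. q powi (k1\<^sup>2 + k1 * k2 + k2\<^sup>2) * (q powi ((v - k1) * (v - k2)) * iq (v - k1) * iq (v - k2) * iq (L - v) * iq (M - k3 - v)))"
  proof (intro sum.cong refl)
    fix v assume "v \<in> I"
    with D have "{k1..v} \<subseteq> I" by (auto simp: I_def)
    then have w: "(\<Sum>t\<in>I. W t * iq (v - t)) = iq (v - k1) * iq (v - k2)"
      using iq_vandermonde_inf[of I k1 v k2] by (simp add: W_def)
    have k3: "k3 = - k1 - k2" using k by simp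
    have e: "v\<^sup>2 + k3 * v + k3\<^sup>2 = k1\<^sup>2 + k1 * k2 + k2\<^sup>2 + (v - k1) * (v - k2)"
      unfolding k3 by (simp add: algebra_simps power2_eq_square)
    show "q powi (v\<^sup>2 + k3 * v + k3\<^sup>2) * iq (L - v) * iq (M - k3 - v) * (\<Sum>t\<in>I. W t * iq (v - t))
      = q powi (k1\<^sup>2 + k1 * k2 + k2\<^sup>2) * (q powi ((v - k1) * (v - k2)) * iq (v - k1) * iq (v - k2) * iq (L - v) * iq (M - k3 - v))"
      unfolding w e qpow_comb[symmetric] by (simp add: mult_ac)
  qed
  also have "\<dots> = q powi (k1\<^sup>2 + k1 * k2 + k2\<^sup>2) * (qp (L + M) * iq (L - k1) * iq (L - k2) * iq (M + k2) * iq (M + k1))"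
  proof -
    have "{k1..L} \<subseteq> I" by (use D in \<open>auto simp: I_def\<close>)
    moreover have e: "L + (M - k3) - k1 - k2 = L + M" "M - k3 - k1 = M + k2" "M - k3 - k2 = M + k1"
      using k by simp_all
    ultimately show ?thesis
      using iq_vandermonde[OF fin, of k1 L k2 "M - k3"]
      unfolding e sum_distrib_left[symmetric] by simp
  qed
  finally show ?thesis
    unfolding G_def by (simp add: bf_def mult_ac)
qed

end

subsection \<open>Alternating sums over the $A_2$ root lattice\<close>

text \<open>
  \<open>chi (a - b)\<close> is the sign of the affine Weyl group element that moves \<open>(1, 0, -1)\<close> to
  \<open>(a, b, -a-b)\<close>, and \<open>0\<close> if there is none: the residues of these coordinates modulo 3 are
  either all equal or a permutation of \<open>1, 0, -1\<close>, and \<open>a - b\<close> determines its parity.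
\<close>
definition chi :: "int \<Rightarrow> 'a::comm_ring_1" where
  "chi d = (if d mod 3 = 1 then 1 else if d mod 3 = 2 then - 1 else 0)"

text \<open>Covers all reflections at once: a <-> b, b <-> -a-b and the affine one (a, b) -> (3 - a
  - b, b) each negate a - b modulo 3.\<close>

lemma chi_uminus_cong: "(d + d') mod 3 = 0 \<Longrightarrow> chi d' = - chi d"
  unfolding chi_def by (cases "d mod 3 = 0"; cases "d mod 3 = 1") (auto, presburger+)

text \<open>The division is exact wherever \<open>chi (a - b)\<close> does not vanish.\<close>
definition qform :: "int \<Rightarrow> int \<Rightarrow> int" where
  "qform a b = (a\<^sup>2 + a * b + b\<^sup>2 - 1) div 3"

lemma qform_swap12: "qform b a = qform a b"
  by (simp add: qform_def algebra_simps)

lemma qform_swap23: "qform a (- a - b) = qform a b"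
  by (simp add: qform_def algebra_simps power2_eq_square)

text \<open>With c = -a-b the map is (a, b, c) -> (c + 3, b, a - 3), the reflection in the wall a -
  c = 3. The form is not preserved, and the defect 3 - (a - c) has to be absorbed by a linear
  exponent.\<close>

lemma qform_affine: "qform (3 - a - b) b = qform a b + (3 - 2 * a - b)"
proof -
  have "(3 - a - b)\<^sup>2 + (3 - a - b) * b + b\<^sup>2 - 1 = (a\<^sup>2 + a * b + b\<^sup>2 - 1) + (3 - 2 * a - b) * 3"
    by (simp add: algebra_simps power2_eq_square)
  then show ?thesis unfolding qform_def by simp
qed

lemma qform_exact: "chi (a - b) \<noteq> (0::'a::comm_ring_1) \<Longrightarrow> 3 * qform a b = a\<^sup>2 + a * b + b\<^sup>2 - 1"
proof -
  assume "chi (a - b) \<noteq> (0::'a)"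
  then have "(a - b) mod 3 = 1 \<or> (a - b) mod 3 = 2"
    by (auto simp: chi_def split: if_splits)
  then obtain r where r: "r = 1 \<or> r = 2" "a - b = r + 3 * ((a - b) div 3)"
    by (metis add.commute mod_mult_div_eq)
  define t where "t = (a - b) div 3"
  have a: "a = b + r + 3 * t" using r(2) unfolding t_def[symmetric] by simp
  have "\<exists>z. a\<^sup>2 + a * b + b\<^sup>2 - 1 = 3 * z"
    using r(1)
  proof
    assume "r = 1"
    then show ?thesis unfolding a
      by (intro exI[of _ "b\<^sup>2 + b + 3 * t * b + 2 * t + 3 * t\<^sup>2"]) (simp add: algebra_simps power2_eq_square)
  next
    assume "r = 2"
    then show ?thesis unfolding a
      by (intro exI[of _ "b\<^sup>2 + 2 * b + 3 * t * b + 4 * t + 3 * t\<^sup>2 + 1"]) (simp add: algebra_simps power2_eq_square)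
  qed
  then show ?thesis by (auto simp: qform_def)
qed

text \<open>The pair \<open>(a, b)\<close> stands for the \<open>A\<^sub>2\<close> root lattice vector \<open>(a, b, -a-b)\<close>.\<close>
definition lat :: "int \<Rightarrow> (int \<times> int) set" where
  "lat D = {(a, b). a \<le> D \<and> b \<le> D \<and> - a - b \<le> D}"

lemma finite_lat [simp]: "finite (lat D)"
  by (rule finite_subset[of _ "{- 2 * D..D} \<times> {- 2 * D..D}"]) (auto simp: lat_def)

lemma lat_sum_swap12: "(\<Sum>(a, b)\<in>lat D. g b a) = (\<Sum>(a, b)\<in>lat D. g a b)"
  by (rule sum.reindex_bij_witness[of _ "\<lambda>(a, b). (b, a)" "\<lambda>(a, b). (b, a)"]) (auto simp: lat_def)

lemma lat_sum_swap23: "(\<Sum>(a, b)\<in>lat D. g a (- a - b)) = (\<Sum>(a, b)\<in>lat D. g a b)"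
  by (rule sum.reindex_bij_witness[of _ "\<lambda>(a, b). (a, - a - b)" "\<lambda>(a, b). (a, - a - b)"]) (auto simp: lat_def)

lemma lat_sum_antisym12:
  fixes g :: "int \<Rightarrow> int \<Rightarrow> 'a::field_char_0"
  assumes "\<And>a b. g b a = - g a b"
  shows "(\<Sum>(a, b)\<in>lat D. g a b) = 0"
proof -
  have "(\<Sum>(a, b)\<in>lat D. g a b) = (\<Sum>(a, b)\<in>lat D. g b a)"
    by (rule lat_sum_swap12[symmetric])
  also have "\<dots> = (\<Sum>(a, b)\<in>lat D. - g a b)"
    by (intro sum.cong refl) (auto intro: assms)
  also have "\<dots> = - (\<Sum>(a, b)\<in>lat D. g a b)"
    by (simp add: sum_negf case_prod_unfold)
  finally show ?thesis by simp
qed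

lemma lat_sum_antisym23:
  fixes g :: "int \<Rightarrow> int \<Rightarrow> 'a::field_char_0"
  assumes "\<And>a b. g a (- a - b) = - g a b"
  shows "(\<Sum>(a, b)\<in>lat D. g a b) = 0"
proof -
  have "(\<Sum>(a, b)\<in>lat D. g a b) = (\<Sum>(a, b)\<in>lat D. g a (- a - b))"
    by (rule lat_sum_swap23[symmetric])
  also have "\<dots> = (\<Sum>(a, b)\<in>lat D. - g a b)"
    by (intro sum.cong refl) (auto intro: assms)
  also have "\<dots> = - (\<Sum>(a, b)\<in>lat D. g a b)"
    by (simp add: sum_negf case_prod_unfold)
  finally show ?thesis by simp
qed

text \<open>The affine reflection does not map the triangle \<open>lat D\<close> to itself, so the
  support of g is required to lie inside; the support is invariant by antisymmetry.\<close>

lemma lat_sum_antisym_affine: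
  fixes g :: "int \<Rightarrow> int \<Rightarrow> 'a::field_char_0"
  assumes anti: "\<And>a b. g (3 - a - b) b = - g a b"
    and supp: "\<And>a b. g a b \<noteq> 0 \<Longrightarrow> (a, b) \<in> lat D"
  shows "(\<Sum>(a, b)\<in>lat D. g a b) = 0"
proof -
  have "(\<Sum>(a, b)\<in>lat D. g a b) = (\<Sum>(a, b)\<in>lat D. g (3 - a - b) b)"
    by (rule sum.reindex_bij_witness_not_neutral[where S' = "{(a, b)\<in>lat D. g a b = 0}"
          and T' = "{(a, b)\<in>lat D. g a b = 0}"
          and i = "\<lambda>(a, b). (3 - a - b, b)" and j = "\<lambda>(a, b). (3 - a - b, b)"])
      (use supp anti in \<open>auto intro!: finite_subset[OF _ finite_lat[of D]]\<close>)
  also have "\<dots> = (\<Sum>(a, b)\<in>lat D. - g a b)"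
    by (intro sum.cong refl) (auto intro: anti)
  also have "\<dots> = - (\<Sum>(a, b)\<in>lat D. g a b)"
    by (simp add: sum_negf case_prod_unfold)
  finally show ?thesis by simp
qed

text \<open>Since f is alternating, permuting the coordinates in h multiplies the sum by the sign of
  the permutation. Hence six times the sum is the sum of f times the antisymmetrization of h, which
  vanishes on the support of f.\<close>

lemma lat_sum_alternating:
  fixes f h :: "int \<Rightarrow> int \<Rightarrow> 'a::field_char_0"
  assumes f12: "\<And>a b. f b a = - f a b" and f23: "\<And>a b. f a (- a - b) = - f a b"
    and h: "\<And>a b. f a b \<noteq> 0 \<Longrightarrow> h a b - h b a - h a (- a - b) - h (- a - b) b + h b (- a - b) + h (- a - b) a = 0"
  shows "(\<Sum>(a, b)\<in>lat D. f a b * h a b) = 0"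
proof -
  define S where "S g = (\<Sum>(a, b)\<in>lat D. f a b * g a b)" for g
  have s12: "S (\<lambda>a b. g b a) = - S g" for g
  proof -
    have "S g = (\<Sum>(a, b)\<in>lat D. f b a * g b a)"
      unfolding S_def by (rule lat_sum_swap12[symmetric, where g = "\<lambda>a b. f a b * g a b"])
    also have "\<dots> = (\<Sum>(a, b)\<in>lat D. - (f a b * g b a))"
    proof (intro sum.cong refl, clarify)
      fix a b show "f b a * g b a = - (f a b * g b a)" by (simp add: f12[of b a])
    qed
    finally show ?thesis unfolding S_def by (simp add: sum_negf case_prod_unfold)
  qed
  have s23: "S (\<lambda>a b. g a (- a - b)) = - S g" for g
  proof -
    have "S g = (\<Sum>(a, b)\<in>lat D. f a (- a - b) * g a (- a - b))"
      unfolding S_def by (rule lat_sum_swap23[symmetric, where g = "\<lambda>a b. f a b * g a b"])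
    also have "\<dots> = (\<Sum>(a, b)\<in>lat D. - (f a b * g a (- a - b)))"
    proof (intro sum.cong refl, clarify)
      fix a b show "f a (- a - b) * g a (- a - b) = - (f a b * g a (- a - b))" by (simp only: f23[of a b] mult_minus_left)
    qed
    finally show ?thesis unfolding S_def by (simp add: sum_negf case_prod_unfold)
  qed
  have 1: "S (\<lambda>a b. h b a) = - S h" by (rule s12)
  have 2: "S (\<lambda>a b. h a (- a - b)) = - S h" by (rule s23)
  have 3: "S (\<lambda>a b. h b (- a - b)) = S h"
    using s12[of "\<lambda>a b. h a (- a - b)"] 2 by (simp add: minus_diff_commute)
  have 4: "S (\<lambda>a b. h (- a - b) a) = S h"
    using s23[of "\<lambda>a b. h b a"] 1 by (simp add: algebra_simps)
  have 5: "S (\<lambda>a b. h (- a - b) b) = - S h"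
    using s12[of "\<lambda>a b. h (- a - b) a"] 4 by (simp add: minus_diff_commute)
  have "0 = S (\<lambda>a b. h a b - h b a - h a (- a - b) - h (- a - b) b + h b (- a - b) + h (- a - b) a)"
    unfolding S_def by (rule sum.neutral[symmetric]) (use h in force)
  also have "\<dots> = S h - S (\<lambda>a b. h b a) - S (\<lambda>a b. h a (- a - b)) - S (\<lambda>a b. h (- a - b) b)
      + S (\<lambda>a b. h b (- a - b)) + S (\<lambda>a b. h (- a - b) a)"
    unfolding S_def by (simp add: case_prod_unfold algebra_simps sum.distrib sum_subtractf)
  also have "\<dots> = 6 * S h" unfolding 1 2 3 4 5 by simp
  finally show ?thesis by (simp add: S_def)
qed

lemma rho_shift_factor_alternating:
  fixes A B t y1 y2 y3 :: "'a::field"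
  assumes y: "y1 * y2 * y3 = 1"
  defines "P \<equiv> \<lambda>x y z. (y * z\<^sup>2) * ((1 - A * x * z) * (1 - A * x * y) * (1 - A * t * x * y) * (1 - B * t * x) * (1 - B * x) * (1 - B * y)
      - (1 - A * B) * (1 - A * B * t)\<^sup>2)"
  shows "P y1 y2 y3 - P y2 y1 y3 - P y1 y3 y2 - P y3 y2 y1 + P y2 y3 y1 + P y3 y1 y2 = 0"
proof -
  define c where "c = (1 - A * B) * (1 - A * B * t)"
  define Q where "Q = (\<lambda>x y z. (y - x) * ((1 - B * x) * (1 - B * y) * ((z - A) * (z - A * t)) - c * z\<^sup>2))"
  have PQ: "P x y z - P y x z = (1 - A * B * t) * Q x y z" if xyz: "x * y * z = 1" for x y z
  proof -
    define C where "C = (1 - B * x) * (1 - B * y)"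
    have 1: "y * (1 - A * x * z) * (1 - B * t * x) - x * (1 - A * y * z) * (1 - B * t * y) = (y - x) * (1 - A * B * t)"
      using xyz by algebra
    have 2: "z\<^sup>2 * ((1 - A * x * y) * (1 - A * t * x * y)) = (z - A) * (z - A * t)"
      using xyz by algebra
    have opaque: "v * w * (a1 * a2 * a3 * a4 * a5 * a6 - b1 * b2\<^sup>2) = w * (a2 * a3) * (a5 * a6) * (v * a1 * a4) - v * w * (b1 * b2 * b2)"
      for v w a1 a2 a3 a4 a5 a6 b1 b2 :: 'a
      by (simp add: algebra_simps power2_eq_square)
    have 3: "P u v z = (z\<^sup>2 * ((1 - A * u * v) * (1 - A * t * u * v))) * ((1 - B * u) * (1 - B * v)) * (v * (1 - A * u * z) * (1 - B * t * u))
        - v * z\<^sup>2 * (c * (1 - A * B * t))" for u v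
      unfolding P_def c_def by (rule opaque)
    have "P y x z = (z\<^sup>2 * ((1 - A * x * y) * (1 - A * t * x * y))) * C * (x * (1 - A * y * z) * (1 - B * t * y))
        - x * z\<^sup>2 * (c * (1 - A * B * t))"
      unfolding 3 C_def by (simp add: mult_ac)
    moreover have "P x y z = (z\<^sup>2 * ((1 - A * x * y) * (1 - A * t * x * y))) * C * (y * (1 - A * x * z) * (1 - B * t * x))
        - y * z\<^sup>2 * (c * (1 - A * B * t))"
      unfolding 3 C_def ..
    ultimately have "P x y z - P y x z = (z\<^sup>2 * ((1 - A * x * y) * (1 - A * t * x * y))) * C *
        (y * (1 - A * x * z) * (1 - B * t * x) - x * (1 - A * y * z) * (1 - B * t * y))
        - (y - x) * z\<^sup>2 * (c * (1 - A * B * t))"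
      by (simp only: right_diff_distrib left_diff_distrib) simp
    then show ?thesis unfolding 1 2 Q_def C_def by (simp add: algebra_simps)
  qed
  have Q: "Q x y z = (y - x) * z\<^sup>2 - A * (1 + t) * ((y - x) * z) + A\<^sup>2 * t * (y - x) - B * ((y\<^sup>2 - x\<^sup>2) * z\<^sup>2)
     + A * B * (1 + t) * ((y\<^sup>2 - x\<^sup>2) * z) - A\<^sup>2 * B * t * (y\<^sup>2 - x\<^sup>2) + B\<^sup>2 * ((y - x) * z) - A * B\<^sup>2 * (1 + t) * (y - x)
     + A\<^sup>2 * B\<^sup>2 * t * (x * y * (y - x)) - c * ((y - x) * z\<^sup>2)" if xyz: "x * y * z = 1" for x y z
    using xyz unfolding Q_def by algebra
  have "Q y1 y2 y3 + Q y2 y3 y1 + Q y3 y1 y2 = 0"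
  proof -
    have "y2 * y3 * y1 = 1" "y3 * y1 * y2 = 1" using y by (simp_all add: mult_ac)
    from Q[OF y] Q[OF this(1)] Q[OF this(2)] show ?thesis
      unfolding c_def by (simp only:) (simp add: algebra_simps power2_eq_square)
  qed
  moreover have "P y2 y3 y1 - P y3 y2 y1 = (1 - A * B * t) * Q y2 y3 y1" "P y3 y1 y2 - P y1 y3 y2 = (1 - A * B * t) * Q y3 y1 y2"
    by (rule PQ; use y in \<open>simp add: mult_ac\<close>)+
  ultimately have "(P y1 y2 y3 - P y2 y1 y3) + (P y2 y3 y1 - P y3 y2 y1) + (P y3 y1 y2 - P y1 y3 y2) = 0"
    using PQ[OF y] by (simp flip: distrib_left)
  then show ?thesis by (simp add: algebra_simps)
qed

section \<open>Weighted lattice sums and the shift by rho\<close>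

context q_field begin

text \<open>For v = (a, b, -a-b), the number 2a + b is the inner product of v with rho = (1, 0, -1),
  and 2 is rho.rho. The exponent vanishes at v = rho for all K and i.\<close>

definition wt :: "int \<Rightarrow> int \<Rightarrow> int \<Rightarrow> int \<Rightarrow> 'a" where
  "wt K i a b = chi (a - b) * q powi (K * qform a b + i * (2 - (2 * a + b)))"

text \<open>A sign-alternating lattice sum only sees the alternating part of the factor by which
  the shifted and the unshifted products of \<open>iq\<close>'s differ.\<close>
lemma lat_sum_shift_rho:
  "(\<Sum>(a, b)\<in>lat D. wt K 1 a b * bf L M (a - 1) b (- a - b + 1))
   = (1 - q powi (L + M + 2)) * (1 - q powi (L + M + 1))\<^sup>2 *
     (\<Sum>(a, b)\<in>lat D. wt K 1 a b * bf (L + 1) (M + 1) a b (- a - b))"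
proof -
  \<comment> \<open>Substitution turning the quotients of shifted and unshifted \<open>iq\<close>
    into the linear factors of \<open>rho_shift_factor_alternating\<close>. Everything alternating
    goes into f; the remaining q^(-(2a+b)) is y z^2 for y = q^b and z = q^(-a-b).\<close>
  define A where "A = q powi (L + 1)"
  define B where "B = q powi (M + 1)"
  define t where "t = inverse q"
  define f where "f a b = chi (a - b) * q powi (K * qform a b + 2) * bf (L + 1) (M + 1) a b (- a - b)" for a b
  define P where "P x y z = (y * z\<^sup>2) * ((1 - A * x * z) * (1 - A * x * y) * (1 - A * t * x * y) * (1 - B * t * x) * (1 - B * x) * (1 - B * y)
      - (1 - A * B) * (1 - A * B * t)\<^sup>2)" for x y z
  define h where "h a b = P (q powi a) (q powi b) (q powi (- a - b))" for a b
  have "(\<Sum>(a, b)\<in>lat D. f a b * h a b) = 0"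
  proof (rule lat_sum_alternating)
    fix a b
    have "chi (b - a) = (- chi (a - b) :: 'a)" by (rule chi_uminus_cong) simp
    then show "f b a = - f a b"
      by (simp add: f_def qform_swap12 bf_def mult_ac algebra_simps)
    have "chi (a - (- a - b)) = (- chi (a - b) :: 'a)" by (rule chi_uminus_cong) (simp add: algebra_simps)
    then show "f a (- a - b) = - f a b"
      by (simp add: f_def qform_swap23 bf_def mult_ac)
    have y: "q powi a * q powi b * q powi (- a - b) = 1"
      by (simp add: qpow_comb)
    have e: "- b - (- a - b) = a" "- a - (- a - b) = b" "- (- a - b) - b = a" "- (- a - b) - a = b" "- b - a = - a - b"
      by simp_all
    show "h a b - h b a - h a (- a - b) - h (- a - b) b + h b (- a - b) + h (- a - b) a = 0"
      using rho_shift_factor_alternating[OF y, where A = A and B = B and t = t] unfolding h_def P_def e .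
  qed
  moreover have "f a b * h a b = wt K 1 a b * bf L M (a - 1) b (- a - b + 1)
     - (1 - q powi (L + M + 2)) * (1 - q powi (L + M + 1))\<^sup>2 * (wt K 1 a b * bf (L + 1) (M + 1) a b (- a - b))" for a b
  proof -
    define c where "c = - a - b"
    have AB: "A * B = q powi (L + M + 2)" "q powi (L + M + 2) * t = q powi (L + M + 1)"
      unfolding A_def B_def t_def by (simp_all add: power_int_add field_simps power2_eq_square)
    have m: "A * q powi a * q powi c = q powi (L + 1 - b)" "A * q powi a * q powi b = q powi (L + 1 - c)"
       "A * t * q powi a * q powi b = q powi (L - c)" "B * t * q powi a = q powi (M + a)"
       "B * q powi a = q powi (M + 1 + a)" "B * q powi b = q powi (M + 1 + b)"
      unfolding A_def B_def t_def c_def by (simp_all add: power_int_add power_int_diff power_int_minus field_simps)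
    have w: "q powi b * (q powi c)\<^sup>2 = q powi (- (2 * a + b))"
      unfolding c_def power2_eq_square qpow_comb by (simp add: algebra_simps)
    have step: "iq m = (1 - q powi k) * iq k" if "m = k - 1" for m k
      unfolding that by (rule iq_pred)
    have "iq (L - c) = (1 - q powi (L + 1 - c)) * iq (L + 1 - c)" "iq (M + a) = (1 - q powi (M + 1 + a)) * iq (M + 1 + a)"
      by (rule step; simp)+
    moreover have "iq (L - (c + 1)) = (1 - q powi (L - c)) * iq (L - c)" "iq (M + (a - 1)) = (1 - q powi (M + a)) * iq (M + a)"
      by (rule step; simp)+
    ultimately have i: "iq (L - (c + 1)) = (1 - q powi (L - c)) * ((1 - q powi (L + 1 - c)) * iq (L + 1 - c))"
       "iq (M + (a - 1)) = (1 - q powi (M + a)) * ((1 - q powi (M + 1 + a)) * iq (M + 1 + a))"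
      by (simp_all only:)
    have i': "iq (L - b) = (1 - q powi (L + 1 - b)) * iq (L + 1 - b)"
       "iq (M + b) = (1 - q powi (M + 1 + b)) * iq (M + 1 + b)"
      by (rule step; simp)+
    have "L - (a - 1) = L + 1 - a" "M + (c + 1) = M + 1 + c" by simp_all
    then have bf: "bf L M (a - 1) b (c + 1) = bf (L + 1) (M + 1) a b c * ((1 - q powi (L + 1 - b)) * (1 - q powi (L + 1 - c)) * (1 - q powi (L - c)) *
        (1 - q powi (M + a)) * (1 - q powi (M + 1 + a)) * (1 - q powi (M + 1 + b)))"
      unfolding bf_def i i' by (simp only: mult_ac)
    have wt: "wt K 1 a b = chi (a - b) * q powi (K * qform a b + 2) * q powi (- (2 * a + b))"
      unfolding wt_def mult.assoc qpow_comb by (simp add: algebra_simps)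
    show ?thesis
      unfolding f_def h_def P_def c_def[symmetric] m w wt bf AB
      by (simp add: algebra_simps)
  qed
  ultimately show ?thesis
    by (simp add: case_prod_unfold sum_subtractf sum_distrib_left)
qed

section \<open>Lattice expansion of the initial function\<close>

definition seed_sum :: "int \<Rightarrow> int \<Rightarrow> int \<Rightarrow> (int \<Rightarrow> int \<Rightarrow> 'a) \<Rightarrow> 'a" where
  "seed_sum D L M g = (\<Sum>(a, b)\<in>lat D. wt 4 1 a b * bf L M (a - 1) b (- a - b + 1) * g a b)"

text \<open>The inserted factors lower 1/(q)_(L+1-a) to 1/(q)_(L-a) and 1/(q)_(M+b) to
  1/(q)_(M+b-1), which undoes the effect of rho between the first two coordinates; the power q^(L-b)
  left over makes the exponent symmetric too. The result changes sign under a <-> b for every h of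
  the fixed third coordinate.\<close>

lemma seed_null12:
  "seed_sum D L M (\<lambda>a b. (1 - q powi (L + 1 - a)) * (q powi (L - b) - q powi (L + M)) * h (a + b)) = 0"
  unfolding seed_sum_def
proof (rule lat_sum_antisym12)
  define G where "G a b = chi (a - b) * q powi (4 * qform a b + (2 + L - 2 * (a + b))) *
    (iq (L - a) * iq (L - b) * iq (M + a - 1) * iq (M + b - 1)) * (iq (L - 1 + a + b) * iq (M + 1 - a - b) * h (a + b))" for a b
  have e: "wt 4 1 a b * bf L M (a - 1) b (- a - b + 1) * ((1 - q powi (L + 1 - a)) * (q powi (L - b) - q powi (L + M)) * h (a + b)) = G a b" for a b
  proof -
    have 1: "iq (L - a) = (1 - q powi (L + 1 - a)) * iq (L - (a - 1))"
      using iq_pred[of "L + 1 - a"] by (simp add: algebra_simps)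
    have 2: "q powi (L - b) * iq (M + b - 1) = (q powi (L - b) - q powi (L + M)) * iq (M + b)"
      unfolding iq_pred by (simp add: algebra_simps qpow_comb qpow_comb_left)
    have 3: "q powi (4 * qform a b + (2 + L - 2 * (a + b))) = q powi (4 * qform a b + 1 * (2 - (2 * a + b))) * q powi (L - b)"
      unfolding qpow_comb by (simp add: algebra_simps)
    have "G a b = chi (a - b) * q powi (4 * qform a b + 1 * (2 - (2 * a + b))) * iq (L - a) * iq (L - b) * iq (M + a - 1)
       * (q powi (L - b) * iq (M + b - 1)) * (iq (L - 1 + a + b) * iq (M + 1 - a - b) * h (a + b))"
      unfolding G_def 3 by (simp only: mult_ac)
    also have "\<dots> = wt 4 1 a b * bf L M (a - 1) b (- a - b + 1) * ((1 - q powi (L + 1 - a)) * (q powi (L - b) - q powi (L + M)) * h (a + b))"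
    proof -
      have "L - 1 + a + b = L - (- a - b + 1)" "M + 1 - a - b = M + (- a - b + 1)" "M + a - 1 = M + (a - 1)" by simp_all
      then show ?thesis unfolding 1 2 wt_def bf_def by (simp only: mult_ac)
    qed
    finally show ?thesis by simp
  qed
  fix a b
  have "chi (b - a) = (- chi (a - b) :: 'a)" by (rule chi_uminus_cong) simp
  then show "wt 4 1 b a * bf L M (b - 1) a (- b - a + 1) * ((1 - q powi (L + 1 - b)) * (q powi (L - a) - q powi (L + M)) * h (b + a))
    = - (wt 4 1 a b * bf L M (a - 1) b (- a - b + 1) * ((1 - q powi (L + 1 - a)) * (q powi (L - b) - q powi (L + M)) * h (a + b)))"
    unfolding e unfolding G_def by (simp add: qform_swap12 algebra_simps)
qed

text \<open>The same mechanism for the transposition of the last two coordinates, which fixes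
  a.\<close>

lemma seed_null23:
  "seed_sum D L M (\<lambda>a b. (1 - q powi (L - b)) * (q powi (L - 1 + a + b) - q powi (L + M)) * h a) = 0"
  unfolding seed_sum_def
proof (rule lat_sum_antisym23)
  define G where "G a b = chi (a - b) * q powi (4 * qform a b + (1 + L - a)) *
    (iq (L - 1 - b) * iq (L - 1 + a + b) * iq (M + b) * iq (M - a - b)) * (iq (L + 1 - a) * iq (M - 1 + a) * h a)" for a b
  have e: "wt 4 1 a b * bf L M (a - 1) b (- a - b + 1) * ((1 - q powi (L - b)) * (q powi (L - 1 + a + b) - q powi (L + M)) * h a) = G a b" for a b
  proof -
    have 1: "iq (L - 1 - b) = (1 - q powi (L - b)) * iq (L - b)"
      using iq_pred[of "L - b"] by (simp add: algebra_simps)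
    have "iq (M - a - b) = (1 - q powi (M + (- a - b + 1))) * iq (M + (- a - b + 1))"
      using iq_pred[of "M + (- a - b + 1)"] by (simp add: algebra_simps)
    then have 2: "q powi (L - 1 + a + b) * iq (M - a - b) = (q powi (L - 1 + a + b) - q powi (L + M)) * iq (M + (- a - b + 1))"
      by (simp only: mult.assoc[symmetric] right_diff_distrib qpow_comb) simp
    have 3: "q powi (4 * qform a b + (1 + L - a)) = q powi (4 * qform a b + 1 * (2 - (2 * a + b))) * q powi (L - 1 + a + b)"
      unfolding qpow_comb by (simp add: algebra_simps)
    have "G a b = chi (a - b) * q powi (4 * qform a b + 1 * (2 - (2 * a + b))) * iq (L - 1 - b) * iq (L - 1 + a + b) * iq (M + b)
       * (q powi (L - 1 + a + b) * iq (M - a - b)) * (iq (L + 1 - a) * iq (M - 1 + a) * h a)"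
      unfolding G_def 3 by (simp only: mult_ac)
    also have "\<dots> = wt 4 1 a b * bf L M (a - 1) b (- a - b + 1) * ((1 - q powi (L - b)) * (q powi (L - 1 + a + b) - q powi (L + M)) * h a)"
    proof -
      have x: "iq (L - 1 + a + b) = iq (L - (- a - b + 1))" "iq (L + 1 - a) = iq (L - (a - 1))" "iq (M - 1 + a) = iq (M + (a - 1))"
        by (simp_all add: algebra_simps)
      show ?thesis unfolding 1 2 wt_def bf_def x by (simp only: mult_ac)
    qed
    finally show ?thesis by simp
  qed
  fix a b
  have "chi (a - (- a - b)) = (- chi (a - b) :: 'a)" by (rule chi_uminus_cong) (simp add: algebra_simps)
  then have "G a (- a - b) = - G a b"
    unfolding G_def qform_swap23 by (simp add: algebra_simps)
  then show "wt 4 1 a (- a - b) * bf L M (a - 1) (- a - b) (- a - (- a - b) + 1) * ((1 - q powi (L - (- a - b))) * (q powi (L - 1 + a + (- a - b)) - q powi (L + M)) * h a)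
    = - (wt 4 1 a b * bf L M (a - 1) b (- a - b + 1) * ((1 - q powi (L - b)) * (q powi (L - 1 + a + b) - q powi (L + M)) * h a))"
    unfolding e .
qed

text \<open>Here the reflection is the affine one. As it changes \<open>qform\<close>, one more
  power q^(L+1-a) is inserted to make the exponent invariant; D >= L + 1 keeps the support inside
  \<open>lat D\<close>.\<close>

lemma seed_null31:
  assumes D: "D \<ge> L + 1"
  shows "seed_sum D L M (\<lambda>a b. (1 - q powi (L - 1 + a + b)) * (q powi (L + 1 - a) - q powi (L + M)) * q powi (L + 1 - a) * h b) = 0"
  unfolding seed_sum_def
proof (rule lat_sum_antisym_affine)
  define G where "G a b = chi (a - b) * q powi (4 * qform a b + (4 + 2 * L - 4 * a - b)) *
    (iq (L + 1 - a) * iq (L - 2 + a + b) * iq (M - 2 + a) * iq (M + 1 - a - b)) * (iq (L - b) * iq (M + b) * h b)" for a b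
  have e: "wt 4 1 a b * bf L M (a - 1) b (- a - b + 1) * ((1 - q powi (L - 1 + a + b)) * (q powi (L + 1 - a) - q powi (L + M)) * q powi (L + 1 - a) * h b) = G a b" for a b
  proof -
    have 1: "iq (L - 2 + a + b) = (1 - q powi (L - 1 + a + b)) * iq (L - (- a - b + 1))"
      using iq_pred[of "L - (- a - b + 1)"] by (simp add: algebra_simps)
    have "iq (M - 2 + a) = (1 - q powi (M + (a - 1))) * iq (M + (a - 1))"
      using iq_pred[of "M + (a - 1)"] by (simp add: algebra_simps)
    then have 2: "q powi (L + 1 - a) * iq (M - 2 + a) = (q powi (L + 1 - a) - q powi (L + M)) * iq (M + (a - 1))"
      by (simp only: mult.assoc[symmetric] right_diff_distrib qpow_comb) simp
    have 3: "q powi (4 * qform a b + (4 + 2 * L - 4 * a - b)) = q powi (4 * qform a b + 1 * (2 - (2 * a + b))) * q powi (L + 1 - a) * q powi (L + 1 - a)"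
      unfolding qpow_comb by (simp add: algebra_simps)
    have "G a b = chi (a - b) * q powi (4 * qform a b + 1 * (2 - (2 * a + b))) * q powi (L + 1 - a) * iq (L + 1 - a) * iq (L - 2 + a + b) * iq (M + 1 - a - b)
       * (q powi (L + 1 - a) * iq (M - 2 + a)) * (iq (L - b) * iq (M + b) * h b)"
      unfolding G_def 3 by (simp only: mult_ac)
    also have "\<dots> = wt 4 1 a b * bf L M (a - 1) b (- a - b + 1) * ((1 - q powi (L - 1 + a + b)) * (q powi (L + 1 - a) - q powi (L + M)) * q powi (L + 1 - a) * h b)"
    proof -
      have x: "iq (L + 1 - a) = iq (L - (a - 1))" "iq (M + 1 - a - b) = iq (M + (- a - b + 1))"
        by (simp_all add: algebra_simps)
      show ?thesis unfolding 1 2 wt_def bf_def x by (simp only: mult_ac)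
    qed
    finally show ?thesis by simp
  qed
  {
    fix a b
    have c: "chi (3 - a - b - b) = (- chi (a - b) :: 'a)" by (rule chi_uminus_cong) (simp add: algebra_simps)
    have x: "4 * (qform a b + (3 - 2 * a - b)) + (4 + 2 * L - 4 * (3 - a - b) - b) = 4 * qform a b + (4 + 2 * L - 4 * a - b)"
      by (simp add: algebra_simps)
    have "G (3 - a - b) b = - G a b"
      unfolding G_def qform_affine c x by (simp add: algebra_simps)
    then show "wt 4 1 (3 - a - b) b * bf L M (3 - a - b - 1) b (- (3 - a - b) - b + 1) *
      ((1 - q powi (L - 1 + (3 - a - b) + b)) * (q powi (L + 1 - (3 - a - b)) - q powi (L + M)) * q powi (L + 1 - (3 - a - b)) * h b)
    = - (wt 4 1 a b * bf L M (a - 1) b (- a - b + 1) * ((1 - q powi (L - 1 + a + b)) * (q powi (L + 1 - a) - q powi (L + M)) * q powi (L + 1 - a) * h b))"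
      unfolding e .
  next
    fix a b
    assume "wt 4 1 a b * bf L M (a - 1) b (- a - b + 1) * ((1 - q powi (L - 1 + a + b)) * (q powi (L + 1 - a) - q powi (L + M)) * q powi (L + 1 - a) * h b) \<noteq> 0"
    then have "bf L M (a - 1) b (- a - b + 1) \<noteq> 0" by auto
    from bf_nonzeroD[OF this] D show "(a, b) \<in> lat D" by (simp add: lat_def)
  }
qed

lemma seed_sum_diff: "seed_sum D L M (\<lambda>a b. f a b - g a b) = seed_sum D L M f - seed_sum D L M g"
  by (simp add: seed_sum_def case_prod_unfold right_diff_distrib sum_subtractf)

lemma seed_sum_cmult: "seed_sum D L M (\<lambda>a b. c * g a b) = c * seed_sum D L M g"
  by (simp add: seed_sum_def case_prod_unfold sum_distrib_left mult_ac)

text \<open>These are the factors by which the denominators at level L - 1 differ from those at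
  level L; inserting them is the step of the induction on L.\<close>

lemma seed_sum_lower:
  "seed_sum D L M (\<lambda>a b. (1 - q powi (L + 1 - a)) * (1 - q powi (L - b)) * (1 - q powi (L - 1 + a + b)) * g a b)
    = seed_sum D (L - 1) M g"
proof -
  have "bf L M (a - 1) b (- a - b + 1) * ((1 - q powi (L + 1 - a)) * (1 - q powi (L - b)) * (1 - q powi (L - 1 + a + b)) * g a b)
     = bf (L - 1) M (a - 1) b (- a - b + 1) * g a b" for a b
  proof -
    have i: "iq (L - 1 - (a - 1)) = (1 - q powi (L + 1 - a)) * iq (L - (a - 1))"
       "iq (L - 1 - b) = (1 - q powi (L - b)) * iq (L - b)"
       "iq (L - 1 - (- a - b + 1)) = (1 - q powi (L - 1 + a + b)) * iq (L - (- a - b + 1))"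
      using iq_pred[of "L - (a - 1)"] iq_pred[of "L - b"] iq_pred[of "L - (- a - b + 1)"]
      by (simp_all add: algebra_simps)
    show ?thesis unfolding bf_def i by (simp only: mult_ac)
  qed
  note lower = this
  show ?thesis
    unfolding seed_sum_def
  proof (intro sum.cong refl, clarify)
    fix a b
    show "wt 4 1 a b * bf L M (a - 1) b (- a - b + 1) * ((1 - q powi (L + 1 - a)) * (1 - q powi (L - b)) * (1 - q powi (L - 1 + a + b)) * g a b)
      = wt 4 1 a b * bf (L - 1) M (a - 1) b (- a - b + 1) * g a b"
      unfolding mult.assoc[of "wt 4 1 a b"] lower ..
  qed
qed

text \<open>
  Think of three particles on a cycle, each of which moves (factor \<open>1 - u\<close>) or stays (factor
  \<open>u - n\<close>) in one unit of time, where \<open>(1 - u) + (u - n) = 1 - n\<close>. By the vanishing sums above,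
  a particle cannot stay when the one behind it moves; the three relations start from the three
  particles in turn.
\<close>
lemma seed_sum_relations:
  fixes D L M :: int
  assumes D: "D \<ge> L + 1"
  defines "X \<equiv> seed_sum D L M" and "n \<equiv> q powi (L + M)"
    and "u1 \<equiv> \<lambda>(a::int) (b::int). q powi (L + 1 - a)" and "u2 \<equiv> \<lambda>(a::int) (b::int). q powi (L - b)"
  shows "seed_sum D (L - 1) M (\<lambda>a b. 1) = (1 - n)\<^sup>2 * (X (\<lambda>a b. 1) - X u1)"
    and "seed_sum D (L - 1) M u1 = (1 - n)\<^sup>2 * (X u1 - X (\<lambda>a b. u1 a b * u2 a b))"
    and "seed_sum D (L - 1) M (\<lambda>a b. u1 a b * u2 a b)
      = (1 - n)\<^sup>2 * (X (\<lambda>a b. u1 a b * u2 a b) - q powi (3 * L) * X (\<lambda>a b. 1))"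
proof -
  define u3 where "u3 a b = q powi (L - 1 + a + b)" for a b
  \<comment> \<open>The exponents add up to 3L because the shifted coordinates a - 1, b, -a-b+1 have
    sum zero. This constant leads the third relation back to the first sum and closes the
    cycle.\<close>
  have prod: "u1 a b * u2 a b * u3 a b = q powi (3 * L)" for a b
    unfolding u1_def u2_def u3_def qpow_comb by (simp add: algebra_simps)
  have lower: "seed_sum D (L - 1) M g = X (\<lambda>a b. (1 - u1 a b) * (1 - u2 a b) * (1 - u3 a b) * g a b)" for g
    unfolding X_def u1_def u2_def u3_def by (rule seed_sum_lower[symmetric])
  have n12: "X (\<lambda>a b. (1 - u1 a b) * (u2 a b - n) * h (a + b)) = 0" for h
    unfolding X_def u1_def u2_def n_def by (rule seed_null12)
  have n23: "X (\<lambda>a b. (1 - u2 a b) * (u3 a b - n) * h a) = 0" for h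
    unfolding X_def u2_def u3_def n_def by (rule seed_null23)
  have n31: "X (\<lambda>a b. (1 - u3 a b) * (u1 a b - n) * u1 a b * h b) = 0" for h
    unfolding X_def u3_def u1_def n_def using D by (rule seed_null31)
  have lin: "X (\<lambda>a b. f a b - g a b) = X f - X g" "X (\<lambda>a b. c * g a b) = c * X g" for f g c
    unfolding X_def by (rule seed_sum_diff seed_sum_cmult)+
  show "seed_sum D (L - 1) M (\<lambda>a b. 1) = (1 - n)\<^sup>2 * (X (\<lambda>a b. 1) - X u1)"
  proof -
    have "(\<lambda>a b. (1 - u1 a b) * (1 - u2 a b) * (1 - u3 a b) * 1)
       = (\<lambda>a b. (1 - n)\<^sup>2 * (1 - u1 a b) - (1 - n) * ((1 - u1 a b) * (u2 a b - n) * (\<lambda>_. 1) (a + b))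
         - (1 - u2 a b) * (u3 a b - n) * (1 - u1 a b))"
      by (simp add: algebra_simps power2_eq_square)
    then have "seed_sum D (L - 1) M (\<lambda>a b. 1) = (1 - n)\<^sup>2 * X (\<lambda>a b. 1 - u1 a b)
         - (1 - n) * X (\<lambda>a b. (1 - u1 a b) * (u2 a b - n) * (\<lambda>_. 1) (a + b))
         - X (\<lambda>a b. (1 - u2 a b) * (u3 a b - n) * (1 - u1 a b))"
      unfolding lower by (simp only: lin)
    moreover have "X (\<lambda>a b. (1 - u2 a b) * (u3 a b - n) * (1 - u1 a b)) = 0"
      using n23[of "\<lambda>a. 1 - u1 a 0"] by (simp add: u1_def)
    ultimately show ?thesis using n12[of "\<lambda>_. 1"] unfolding lin by simp
  qed
  show "seed_sum D (L - 1) M u1 = (1 - n)\<^sup>2 * (X u1 - X (\<lambda>a b. u1 a b * u2 a b))"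
  proof -
    have "(\<lambda>a b. (1 - u1 a b) * (1 - u2 a b) * (1 - u3 a b) * u1 a b)
       = (\<lambda>a b. (1 - n)\<^sup>2 * (u1 a b - u1 a b * u2 a b) - (1 - n) * ((1 - u2 a b) * (u3 a b - n) * u1 a b)
         - (1 - u3 a b) * (u1 a b - n) * u1 a b * (1 - u2 a b))"
      by (simp add: algebra_simps power2_eq_square)
    then have "seed_sum D (L - 1) M u1 = (1 - n)\<^sup>2 * X (\<lambda>a b. u1 a b - u1 a b * u2 a b)
         - (1 - n) * X (\<lambda>a b. (1 - u2 a b) * (u3 a b - n) * u1 a b)
         - X (\<lambda>a b. (1 - u3 a b) * (u1 a b - n) * u1 a b * (1 - u2 a b))"
      unfolding lower by (simp only: lin)
    moreover have "X (\<lambda>a b. (1 - u2 a b) * (u3 a b - n) * u1 a b) = 0"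
      using n23[of "\<lambda>a. u1 a 0"] by (simp add: u1_def)
    moreover have "X (\<lambda>a b. (1 - u3 a b) * (u1 a b - n) * u1 a b * (1 - u2 a b)) = 0"
      using n31[of "\<lambda>b. 1 - u2 0 b"] by (simp add: u2_def)
    ultimately show ?thesis unfolding lin by simp
  qed
  show "seed_sum D (L - 1) M (\<lambda>a b. u1 a b * u2 a b)
      = (1 - n)\<^sup>2 * (X (\<lambda>a b. u1 a b * u2 a b) - q powi (3 * L) * X (\<lambda>a b. 1))"
  proof -
    \<comment> \<open>The product u1 u2 (1 - u3) depends on a + b only, as the vanishing sum for the
      first two coordinates demands.\<close>
    define h where "h s = q powi (2 * L + 1 - s) * (1 - q powi (L - 1 + s))" for s
    have h: "h (a + b) = u1 a b * u2 a b * (1 - u3 a b)" for a b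
      unfolding h_def u1_def u2_def u3_def qpow_comb by (simp add: algebra_simps)
    have "(\<lambda>a b. (1 - u1 a b) * (1 - u2 a b) * (1 - u3 a b) * (u1 a b * u2 a b))
       = (\<lambda>a b. (1 - n)\<^sup>2 * (u1 a b * u2 a b - q powi (3 * L) * 1)
         - (1 - n) * ((1 - u3 a b) * (u1 a b - n) * u1 a b * u2 a b)
         - (1 - u1 a b) * (u2 a b - n) * h (a + b))"
    proof (intro ext)
      fix a b
      show "(1 - u1 a b) * (1 - u2 a b) * (1 - u3 a b) * (u1 a b * u2 a b)
       = (1 - n)\<^sup>2 * (u1 a b * u2 a b - q powi (3 * L) * 1)
         - (1 - n) * ((1 - u3 a b) * (u1 a b - n) * u1 a b * u2 a b)
         - (1 - u1 a b) * (u2 a b - n) * h (a + b)"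
        unfolding h prod[of a b, symmetric] by (simp add: algebra_simps power2_eq_square)
    qed
    then have "seed_sum D (L - 1) M (\<lambda>a b. u1 a b * u2 a b) = (1 - n)\<^sup>2 * X (\<lambda>a b. u1 a b * u2 a b - q powi (3 * L) * 1)
         - (1 - n) * X (\<lambda>a b. (1 - u3 a b) * (u1 a b - n) * u1 a b * u2 a b)
         - X (\<lambda>a b. (1 - u1 a b) * (u2 a b - n) * h (a + b))"
      unfolding lower by (simp only: lin)
    moreover have "X (\<lambda>a b. (1 - u3 a b) * (u1 a b - n) * u1 a b * u2 a b) = 0"
      using n31[of "\<lambda>b. u2 0 b"] by (simp add: u2_def)
    ultimately show ?thesis unfolding n12 lin by simp
  qed
qed

text \<open>The three sums are evaluated together: from their values at L - 1 the relations give the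
  consecutive differences around a cycle that closes with the factor q^(3L). Adding them leaves 1 -
  q^(3L) times the first sum. M >= 0 makes 1 - q^(L+M) nonzero for L >= 1, so that its square
  cancels.\<close>

lemma seed_sum_eval:
  assumes M: "M \<ge> 0" and D: "D \<ge> int L + 1"
  shows "seed_sum D (int L) M (\<lambda>a b. 1) = iq (int L) * iq M * (iq (int L + M))\<^sup>2 \<and>
    seed_sum D (int L) M (\<lambda>a b. q powi (int L + 1 - a)) = q powi (int L) * (iq (int L) * iq M * (iq (int L + M))\<^sup>2) \<and>
    seed_sum D (int L) M (\<lambda>a b. q powi (int L + 1 - a) * q powi (int L - b))
      = q powi (2 * int L) * (iq (int L) * iq M * (iq (int L + M))\<^sup>2)"
  using D
proof (induction L)
  case 0
  \<comment> \<open>At L = 0 the coordinates a - 1, b, -a-b+1 are at most 0 with sum 0, so only v =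
    rho contributes.\<close>
  have "seed_sum D 0 M g = iq M * (iq M)\<^sup>2 * g 1 0" if "D \<ge> 1" for g
  proof -
    have "seed_sum D 0 M g = (\<Sum>(a, b)\<in>{(1, 0)}. wt 4 1 a b * bf 0 M (a - 1) b (- a - b + 1) * g a b)"
      unfolding seed_sum_def
    proof (rule sum.mono_neutral_right)
      show "\<forall>i\<in>lat D - {(1, 0)}. (case i of (a, b) \<Rightarrow> wt 4 1 a b * bf 0 M (a - 1) b (- a - b + 1) * g a b) = 0"
      proof
        fix i :: "int \<times> int" assume "i \<in> lat D - {(1, 0)}"
        moreover obtain a b where i: "i = (a, b)" by fastforce
        ultimately have "bf 0 M (a - 1) b (- a - b + 1) = 0"
          using bf_nonzeroD[of 0 M "a - 1" b "- a - b + 1"] by fastforce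
        then show "(case i of (a, b) \<Rightarrow> wt 4 1 a b * bf 0 M (a - 1) b (- a - b + 1) * g a b) = 0"
          by (simp add: i)
      qed
    qed (rule finite_lat, use that in \<open>auto simp: lat_def\<close>)
    also have "\<dots> = iq M * (iq M)\<^sup>2 * g 1 0"
      by (simp add: wt_def bf_def chi_def qform_def power2_eq_square)
    finally show ?thesis .
  qed
  then show ?case using 0 by simp
next
  case (Suc L)
  define l where "l = int (Suc L)"
  have l: "int L = l - 1" "l \<ge> 1" by (simp_all add: l_def)
  define X where "X = seed_sum D l M"
  define n where "n = q powi (l + M)"
  define u1 where "u1 = (\<lambda>(a::int) (b::int). q powi (l + 1 - a))"
  define u2 where "u2 = (\<lambda>(a::int) (b::int). q powi (l - b))"
  define A where "A = q powi l"
  define T where "T = iq l * iq M * (iq (l + M))\<^sup>2"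
  note IH = Suc.IH[unfolded l]
  have D: "D \<ge> l - 1 + 1" "D \<ge> l + 1" using Suc.prems by (simp_all add: l_def)
  have uu: "(\<lambda>a b. q powi (l + 1 - a) * q powi (l - b)) = (\<lambda>a b. u1 a b * u2 a b)"
    by (simp add: u1_def u2_def)
  note rel = seed_sum_relations[OF D(2), of M, folded X_def n_def u1_def u2_def, unfolded uu]
  have n: "n \<noteq> 1" using l(2) M unfolding n_def by (intro powi_not_root) simp
  have T: "iq (l - 1) * iq M * (iq (l - 1 + M))\<^sup>2 = (1 - n)\<^sup>2 * ((1 - A) * T)"
  proof -
    have "iq (l - 1 + M) = (1 - n) * iq (l + M)"
      using iq_pred[of "l + M"] by (simp add: n_def algebra_simps)
    then show ?thesis unfolding iq_pred[of l] T_def A_def by (simp add: power_mult_distrib)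
  qed
  have 0: "seed_sum D (l - 1) M (\<lambda>a b. 1) = (1 - n)\<^sup>2 * ((1 - A) * T)"
    using IH[OF D(1)] unfolding T by blast
  have u1': "u1 = (\<lambda>a b. q * q powi (l - 1 + 1 - a))"
    unfolding u1_def by (simp add: power_int_add power_int_diff field_simps)
  have 1: "seed_sum D (l - 1) M u1 = (1 - n)\<^sup>2 * (A * (1 - A) * T)"
  proof -
    have "q * q powi (l - 1) = A" by (simp add: A_def power_int_diff)
    then have "seed_sum D (l - 1) M u1 = A * (iq (l - 1) * iq M * (iq (l - 1 + M))\<^sup>2)"
      using IH[OF D(1)] unfolding u1' seed_sum_cmult by (simp add: mult.assoc[symmetric])
    then show ?thesis unfolding T by simp
  qed
  have u2': "(\<lambda>a b. u1 a b * u2 a b) = (\<lambda>a b. q\<^sup>2 * (q powi (l - 1 + 1 - a) * q powi (l - 1 - b)))"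
    unfolding u1_def u2_def by (simp add: power_int_add power_int_diff field_simps power2_eq_square)
  have 2: "seed_sum D (l - 1) M (\<lambda>a b. u1 a b * u2 a b) = (1 - n)\<^sup>2 * (A\<^sup>2 * (1 - A) * T)"
  proof -
    have "q\<^sup>2 * q powi (2 * (l - 1)) = A\<^sup>2"
      by (simp add: A_def power2_eq_square qpow_comb power_int_diff right_diff_distrib)
    then have "seed_sum D (l - 1) M (\<lambda>a b. u1 a b * u2 a b) = A\<^sup>2 * (iq (l - 1) * iq M * (iq (l - 1 + M))\<^sup>2)"
      using IH[OF D(1)] unfolding u2' seed_sum_cmult by (simp add: mult.assoc[symmetric])
    then show ?thesis unfolding T by simp
  qed
  have A3: "q powi (3 * l) = A ^ 3"
    by (simp add: A_def power3_eq_cube qpow_comb)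
  have d0: "X (\<lambda>a b. 1) - X u1 = (1 - A) * T"
    and d1: "X u1 - X (\<lambda>a b. u1 a b * u2 a b) = A * (1 - A) * T"
    and d2: "X (\<lambda>a b. u1 a b * u2 a b) - A ^ 3 * X (\<lambda>a b. 1) = A\<^sup>2 * (1 - A) * T"
    using rel 0 1 2 n unfolding A3 by simp_all
  have "(1 - A ^ 3) * X (\<lambda>a b. 1) = (X (\<lambda>a b. 1) - X u1) + (X u1 - X (\<lambda>a b. u1 a b * u2 a b))
      + (X (\<lambda>a b. u1 a b * u2 a b) - A ^ 3 * X (\<lambda>a b. 1))"
    by (simp add: algebra_simps)
  also have "\<dots> = (1 - A ^ 3) * T"
    unfolding d0 d1 d2 by (simp add: algebra_simps power2_eq_square power3_eq_cube)
  finally have "(1 - A ^ 3) * X (\<lambda>a b. 1) = (1 - A ^ 3) * T" .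
  moreover have "1 - A ^ 3 \<noteq> 0"
    unfolding A3[symmetric] using powi_not_root[of "3 * l"] l(2) by simp
  ultimately have x0: "X (\<lambda>a b. 1) = T" by simp
  then have x1: "X u1 = A * T" using d0 by (simp add: algebra_simps)
  then have x2: "X (\<lambda>a b. u1 a b * u2 a b) = A\<^sup>2 * T" using d1 by (simp add: algebra_simps power2_eq_square)
  have "A\<^sup>2 = q powi (2 * l)" by (simp add: A_def power2_eq_square qpow_comb)
  with x0 x1 x2 show ?case
    unfolding X_def T_def u1_def u2_def A_def l_def by simp
qed

text \<open>The shifted sum at (R - 1, S - 1), transported back by \<open>lat_sum_shift_rho\<close>.
  The three factors of the shift, together with (q)_(R+S), reduce its value to the starting function
  of the chain at (R - 1, S - 1).\<close>

lemma seed_identity: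
  assumes "R \<ge> 1" "S \<ge> 1" "D \<ge> R"
  shows "(\<Sum>(a, b)\<in>lat D. wt 4 1 a b * (qp (R + S) * bf R S a b (- a - b))) = iq (R - 1) * iq (S - 1) * iq (R + S - 1)"
proof -
  define L where "L = nat (R - 1)"
  have R: "R = int L + 1" using assms by (simp add: L_def)
  define M where "M = S - 1"
  have S: "S = M + 1" "M \<ge> 0" using assms by (simp_all add: M_def)
  define Z where "Z = (\<Sum>(a, b)\<in>lat D. wt 4 1 a b * bf R S a b (- a - b))"
  define n where "n = int L + M + 1"
  have n: "n \<ge> 1" using S by (simp add: n_def)
  have "(1 - q powi (n + 1)) * (1 - q powi n)\<^sup>2 * Z = iq (int L) * iq M * (iq (n - 1))\<^sup>2"
    using lat_sum_shift_rho[where K = 4 and D = D and L = "int L" and M = M] seed_sum_eval[OF S(2), of L D] assms(3)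
    unfolding Z_def R S(1) seed_sum_def n_def by (simp add: add_ac)
  also have "\<dots> = (1 - q powi n)\<^sup>2 * (iq (int L) * iq M * (iq n)\<^sup>2)"
    unfolding iq_pred[of n] by (simp add: power_mult_distrib)
  finally have "(1 - q powi (n + 1)) * Z = iq (int L) * iq M * (iq n)\<^sup>2"
    using powi_not_root[of n] n by simp
  moreover have "qp (n + 1) * iq n = 1 - q powi (n + 1)"
    using qp_rec[of "n + 1"] qp_iq[of n] n by simp
  ultimately have "iq n * (qp (n + 1) * Z) = iq n * (iq (int L) * iq M * iq n)"
    by (simp add: mult_ac power2_eq_square)
  then have "qp (n + 1) * Z = iq (int L) * iq M * iq n"
    using iq_nonzero[of n] n by simp
  then show ?thesis
    unfolding Z_def R S(1) n_def by (simp add: sum_distrib_left case_prod_unfold mult_ac add_ac)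
qed

end

subsection \<open>Iterated Bailey transforms\<close>

context q_field begin

definition phi :: "int \<Rightarrow> (int \<Rightarrow> int \<Rightarrow> 'a) \<Rightarrow> int \<Rightarrow> int \<Rightarrow> 'a" where
  "phi e g L M = (\<Sum>r\<in>{0..L}. \<Sum>s\<in>{0..M}. q powi (r\<^sup>2 - r * s + s\<^sup>2 + e * (r + s)) * g r s * iq (L - r) * iq (M - s))"

definition gam :: "int \<Rightarrow> int \<Rightarrow> 'a" where
  "gam L M = iq L * iq M * iq (L + M + 1)"

lemma phi_cong:
  assumes "\<And>r s. \<lbrakk>0 \<le> r; r \<le> L; 0 \<le> s; s \<le> M\<rbrakk> \<Longrightarrow> g r s = g' r s"
  shows "phi e g L M = phi e g' L M"
  unfolding phi_def by (intro sum.cong refl) (simp add: assms)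

lemma phi_diff: "phi e (\<lambda>r s. f r s - c * g r s) L M = phi e f L M - c * phi e g L M"
proof -
  have "q powi x * (u - c * v) * y * z = q powi x * u * y * z - c * (q powi x * v * y * z)" for x u v y z
    by (simp add: algebra_simps)
  then show ?thesis unfolding phi_def by (simp add: sum_subtractf sum_distrib_left)
qed

lemma phi_funpow_diff:
  "(phi e ^^ j) (\<lambda>r s. f r s - c * g r s) = (\<lambda>L M. (phi e ^^ j) f L M - c * (phi e ^^ j) g L M)"
  by (induction j) (simp_all add: phi_diff)

text \<open>The two exponents differ by r + s. The combination is formed because 1 - q^(r+s+1) is
  exactly the factor that the shift by rho consumes.\<close>

lemma phi_0_phi_1: "phi 0 g L M - q * phi 1 g L M = phi 0 (\<lambda>r s. (1 - q powi (r + s + 1)) * g r s) L M"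
proof -
  have *: "q powi x * ((1 - q powi (y + 1)) * u) * v * w = q powi x * u * v * w - q * (q powi (x + y) * u * v * w)" for x y u v w
    by (simp add: algebra_simps power_int_add)
  show ?thesis
    unfolding phi_def * by (simp add: sum_subtractf sum_distrib_left)
qed

text \<open>Wherever the sign is nonzero, |v|^2/2 = 3 \<open>qform\<close> + 1 and |v - rho|^2/2 = 3
  \<open>qform\<close> + 2 - (2a + b). So a transform acting on v raises K by 3, and one acting on v
  - rho also raises i by 1.\<close>

lemma wt_times_qpow:
  assumes "i' = i" "K' = K + 3"
  shows "wt K i a b * q powi (a\<^sup>2 + a * b + b\<^sup>2 - 1) = wt K' i' a b"
    and "wt K i a b * q powi ((a - 1)\<^sup>2 + (a - 1) * b + b\<^sup>2) = wt K' (i' + 1) a b"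
proof -
  have "chi (a - b) * q powi (K * qform a b + i * (2 - (2 * a + b)) + x) = (chi (a - b) * q powi (K * qform a b + i * (2 - (2 * a + b)) + y) :: 'a)"
    if "x = y \<or> chi (a - b) = (0 :: 'a)" for x y using that by auto
  note * = this
  have e: "a\<^sup>2 + a * b + b\<^sup>2 - 1 = 3 * qform a b \<or> chi (a - b) = (0 :: 'a)"
    using qform_exact[where 'a = 'a, of a b] by auto
  show "wt K i a b * q powi (a\<^sup>2 + a * b + b\<^sup>2 - 1) = wt K' i' a b"
    unfolding wt_def mult.assoc qpow_comb using *[OF e] assms by (simp add: algebra_simps)
  have e': "(a - 1)\<^sup>2 + (a - 1) * b + b\<^sup>2 = 3 * qform a b + (2 - (2 * a + b)) \<or> chi (a - b) = (0 :: 'a)"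
    using e by (auto simp: algebra_simps power2_eq_square)
  show "wt K i a b * q powi ((a - 1)\<^sup>2 + (a - 1) * b + b\<^sup>2) = wt K' (i' + 1) a b"
    unfolding wt_def mult.assoc qpow_comb using *[OF e'] assms by (simp add: algebra_simps)
qed

lemma phi_lat_sum:
  "phi e (\<lambda>r s. \<Sum>(a, b)\<in>S. w a b * f r s a b) L M
    = (\<Sum>(a, b)\<in>S. w a b * (\<Sum>r\<in>{0..L}. \<Sum>s\<in>{0..M}. q powi (r\<^sup>2 - r * s + s\<^sup>2 + e * (r + s)) * f r s a b * iq (L - r) * iq (M - s)))"
proof -
  have "phi e (\<lambda>r s. \<Sum>(a, b)\<in>S. w a b * f r s a b) L M
    = (\<Sum>r\<in>{0..L}. \<Sum>s\<in>{0..M}. \<Sum>p\<in>S. w (fst p) (snd p) * (q powi (r\<^sup>2 - r * s + s\<^sup>2 + e * (r + s)) * f r s (fst p) (snd p) * iq (L - r) * iq (M - s)))"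
    unfolding phi_def by (intro sum.cong refl) (simp add: case_prod_unfold sum_distrib_left sum_distrib_right mult_ac)
  also have "\<dots> = (\<Sum>p\<in>S. \<Sum>r\<in>{0..L}. \<Sum>s\<in>{0..M}. w (fst p) (snd p) * (q powi (r\<^sup>2 - r * s + s\<^sup>2 + e * (r + s)) * f r s (fst p) (snd p) * iq (L - r) * iq (M - s)))"
    by (rule sum_swap3)
  finally show ?thesis by (simp add: case_prod_unfold sum_distrib_left)
qed

text \<open>The linear exponent completes the square: r^2 - rs + s^2 + r + s is the quadratic form
  at (r + 1, s + 1) minus 1. A step is therefore the Bailey lemma at (L + 1, M + 1), and the -1
  combines with |v|^2/2 to 3 \<open>qform\<close>.\<close>

lemma phi_1_gam:
  assumes "L \<ge> 0" "M \<ge> 0" "D \<ge> L + 1"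
  shows "(phi 1 ^^ d) gam L M = (\<Sum>(a, b)\<in>lat D. wt (4 + 3 * int d) 1 a b * (qp (L + M + 2) * bf (L + 1) (M + 1) a b (- a - b)))"
  using assms
proof (induction d arbitrary: L M)
  case 0
  then show ?case
    using seed_identity[of "L + 1" "M + 1" D] by (simp add: gam_def add_ac)
next
  case (Suc d)
  let ?K = "4 + 3 * int d"
  have "(phi 1 ^^ Suc d) gam L M = phi 1 (\<lambda>r s. \<Sum>(a, b)\<in>lat D. wt ?K 1 a b * (qp (r + s + 2) * bf (r + 1) (s + 1) a b (- a - b))) L M"
    unfolding funpow.simps comp_def by (rule phi_cong) (rule Suc.IH, use Suc.prems in auto)
  also have "\<dots> = (\<Sum>(a, b)\<in>lat D. wt ?K 1 a b * (\<Sum>r\<in>{0..L}. \<Sum>s\<in>{0..M}.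
      q powi (r\<^sup>2 - r * s + s\<^sup>2 + 1 * (r + s)) * (qp (r + s + 2) * bf (r + 1) (s + 1) a b (- a - b)) * iq (L - r) * iq (M - s)))"
    by (rule phi_lat_sum)
  also have "\<dots> = (\<Sum>(a, b)\<in>lat D. wt (4 + 3 * int (Suc d)) 1 a b * (qp (L + M + 2) * bf (L + 1) (M + 1) a b (- a - b)))"
  proof (intro sum.cong refl, clarify)
    fix a b :: int
    define c where "c = - a - b"
    show "wt ?K 1 a b * (\<Sum>r\<in>{0..L}. \<Sum>s\<in>{0..M}.
      q powi (r\<^sup>2 - r * s + s\<^sup>2 + 1 * (r + s)) * (qp (r + s + 2) * bf (r + 1) (s + 1) a b (- a - b)) * iq (L - r) * iq (M - s))
      = wt (4 + 3 * int (Suc d)) 1 a b * (qp (L + M + 2) * bf (L + 1) (M + 1) a b (- a - b))"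
    proof (cases "a = 0 \<and> b = 0")
      case True
      then show ?thesis by (simp add: wt_def chi_def)
    next
      case False
      define G where "G r s = q powi (r\<^sup>2 - r * s + s\<^sup>2) * qp (r + s) * bf r s a b c * iq (L + 1 - r) * iq (M + 1 - s)" for r s
      \<comment> \<open>The Bailey lemma at (L + 1, M + 1) also sums over r = 0 and s = 0. Only v =
        0 could contribute there, and \<open>chi 0\<close> is 0.\<close>
      have G0: "G 0 s = 0" "G r 0 = 0" for r s
      proof -
        have "bf 0 s a b c = 0" using False bf_nonzeroD[of 0 s a b c] by (cases "bf 0 s a b c = 0") (auto simp: c_def)
        then show "G 0 s = 0" by (simp add: G_def)
        have "bf r 0 a b c = 0" using False bf_nonzeroD[of r 0 a b c] by (cases "bf r 0 a b c = 0") (auto simp: c_def)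
        then show "G r 0 = 0" by (simp add: G_def)
      qed
      have "(\<Sum>r\<in>{0..L}. \<Sum>s\<in>{0..M}.
        q powi (r\<^sup>2 - r * s + s\<^sup>2 + 1 * (r + s)) * (qp (r + s + 2) * bf (r + 1) (s + 1) a b (- a - b)) * iq (L - r) * iq (M - s))
         = (\<Sum>r\<in>{0..L}. \<Sum>s\<in>{0..M}. q powi (- 1) * G (r + 1) (s + 1))"
      proof (intro sum.cong refl)
        fix r s :: int
        have "r\<^sup>2 - r * s + s\<^sup>2 + 1 * (r + s) = - 1 + ((r + 1)\<^sup>2 - (r + 1) * (s + 1) + (s + 1)\<^sup>2)"
          by (simp add: algebra_simps power2_eq_square)
        then have e: "q powi (r\<^sup>2 - r * s + s\<^sup>2 + 1 * (r + s)) = q powi (- 1) * q powi ((r + 1)\<^sup>2 - (r + 1) * (s + 1) + (s + 1)\<^sup>2)"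
          unfolding qpow_comb by (rule arg_cong)
        have "r + s + 2 = r + 1 + (s + 1)" "L - r = L + 1 - (r + 1)" "M - s = M + 1 - (s + 1)" by simp_all
        then show "q powi (r\<^sup>2 - r * s + s\<^sup>2 + 1 * (r + s)) * (qp (r + s + 2) * bf (r + 1) (s + 1) a b (- a - b)) * iq (L - r) * iq (M - s)
          = q powi (- 1) * G (r + 1) (s + 1)"
          unfolding G_def c_def e by (simp only: mult_ac)
      qed
      also have "\<dots> = (\<Sum>r\<in>{1..L + 1}. \<Sum>s\<in>{1..M + 1}. q powi (- 1) * G r s)"
        by (simp add: int_sum_shift[of _ 1 _ 1])
      also have "\<dots> = (\<Sum>r\<in>{0..L + 1}. \<Sum>s\<in>{0..M + 1}. q powi (- 1) * G r s)"
        unfolding sum.cartesian_product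
      proof (rule sum.mono_neutral_left)
        show "\<forall>i\<in>{0..L + 1} \<times> {0..M + 1} - {1..L + 1} \<times> {1..M + 1}. (case i of (r, s) \<Rightarrow> q powi (- 1) * G r s) = 0"
        proof
          fix i assume "i \<in> {0..L + 1} \<times> {0..M + 1} - {1..L + 1} \<times> {1..M + 1}"
          then have "fst i = 0 \<or> snd i = 0" by auto
          then show "(case i of (r, s) \<Rightarrow> q powi (- 1) * G r s) = 0" using G0 by (auto simp: case_prod_unfold)
        qed
      qed auto
      also have "\<dots> = q powi (- 1) * (q powi (a\<^sup>2 + a * b + b\<^sup>2) * qp (L + 1 + (M + 1)) * bf (L + 1) (M + 1) a b c)"
        unfolding sum_distrib_left[symmetric] G_def by (subst A2_bailey) (simp_all add: c_def)
      also have "\<dots> = q powi (a\<^sup>2 + a * b + b\<^sup>2 - 1) * (qp (L + M + 2) * bf (L + 1) (M + 1) a b c)"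
        unfolding mult.assoc qpow_comb_left by (simp add: add_ac)
      finally have e: "(\<Sum>r\<in>{0..L}. \<Sum>s\<in>{0..M}.
        q powi (r\<^sup>2 - r * s + s\<^sup>2 + 1 * (r + s)) * (qp (r + s + 2) * bf (r + 1) (s + 1) a b (- a - b)) * iq (L - r) * iq (M - s))
        = q powi (a\<^sup>2 + a * b + b\<^sup>2 - 1) * (qp (L + M + 2) * bf (L + 1) (M + 1) a b c)" .
      have "wt ?K 1 a b * q powi (a\<^sup>2 + a * b + b\<^sup>2 - 1) = wt (4 + 3 * int (Suc d)) 1 a b"
        by (rule wt_times_qpow(1)) simp_all
      then show ?thesis unfolding e unfolding c_def mult.assoc[symmetric] by (simp only:)
    qed
  qed
  finally show ?case .
qed

text \<open>The factor 1 - q^(L+M+1) and the two top factors of (q)_(L+M+2) are those of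
  \<open>lat_sum_shift_rho\<close>, which replaces v by v - rho and the levels L + 1, M + 1 by L, M.
  From there the transforms without linear exponent act.\<close>

lemma phi_0_phi_1_gam:
  assumes "L \<ge> 0" "M \<ge> 0" "D \<ge> L + 1"
  shows "(phi 0 ^^ j) (\<lambda>r s. (1 - q powi (r + s + 1)) * (phi 1 ^^ d) gam r s) L M
     = (\<Sum>(a, b)\<in>lat D. wt (4 + 3 * int d + 3 * int j) (1 + int j) a b * (qp (L + M) * bf L M (a - 1) b (- a - b + 1)))"
  using assms
proof (induction j arbitrary: L M)
  case 0
  define n where "n = L + M"
  have n: "n \<ge> 0" using 0 by (simp add: n_def)
  have qp: "qp (n + 2) = (1 - q powi (n + 2)) * (1 - q powi (n + 1)) * qp n"
  proof -
    have "n + 2 - 1 = n + 1" by simp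
    then show ?thesis using qp_rec[of "n + 2"] qp_rec[of "n + 1"] n by (simp only:) simp
  qed
  have "(1 - q powi (L + M + 1)) * (phi 1 ^^ d) gam L M
     = (1 - q powi (n + 1)) * qp (n + 2) * (\<Sum>(a, b)\<in>lat D. wt (4 + 3 * int d) 1 a b * bf (L + 1) (M + 1) a b (- a - b))"
    unfolding phi_1_gam[OF 0] n_def by (simp add: sum_distrib_left case_prod_unfold mult_ac)
  also have "\<dots> = qp n * (\<Sum>(a, b)\<in>lat D. wt (4 + 3 * int d) 1 a b * bf L M (a - 1) b (- a - b + 1))"
    unfolding lat_sum_shift_rho qp unfolding n_def by (simp add: power2_eq_square mult_ac)
  finally show ?case
    by (simp add: n_def sum_distrib_left case_prod_unfold mult_ac)
next
  case (Suc j)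
  let ?K = "4 + 3 * int d + 3 * int j"
  have "(phi 0 ^^ Suc j) (\<lambda>r s. (1 - q powi (r + s + 1)) * (phi 1 ^^ d) gam r s) L M
      = phi 0 (\<lambda>r s. \<Sum>(a, b)\<in>lat D. wt ?K (1 + int j) a b * (qp (r + s) * bf r s (a - 1) b (- a - b + 1))) L M"
    unfolding funpow.simps comp_def by (rule phi_cong) (rule Suc.IH, use Suc.prems in auto)
  also have "\<dots> = (\<Sum>(a, b)\<in>lat D. wt ?K (1 + int j) a b * (\<Sum>r\<in>{0..L}. \<Sum>s\<in>{0..M}.
      q powi (r\<^sup>2 - r * s + s\<^sup>2 + 0 * (r + s)) * (qp (r + s) * bf r s (a - 1) b (- a - b + 1)) * iq (L - r) * iq (M - s)))"
    by (rule phi_lat_sum)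
  also have "\<dots> = (\<Sum>(a, b)\<in>lat D. wt ?K (1 + int j) a b * (q powi ((a - 1)\<^sup>2 + (a - 1) * b + b\<^sup>2) * qp (L + M) * bf L M (a - 1) b (- a - b + 1)))"
  proof (intro sum.cong refl, clarify)
    fix a b :: int
    show "wt ?K (1 + int j) a b * (\<Sum>r\<in>{0..L}. \<Sum>s\<in>{0..M}.
      q powi (r\<^sup>2 - r * s + s\<^sup>2 + 0 * (r + s)) * (qp (r + s) * bf r s (a - 1) b (- a - b + 1)) * iq (L - r) * iq (M - s))
     = wt ?K (1 + int j) a b * (q powi ((a - 1)\<^sup>2 + (a - 1) * b + b\<^sup>2) * qp (L + M) * bf L M (a - 1) b (- a - b + 1))"
      using A2_bailey[of "a - 1" b "- a - b + 1" L M] by (simp add: mult.assoc)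
  qed
  also have "\<dots> = (\<Sum>(a, b)\<in>lat D. wt (4 + 3 * int d + 3 * int (Suc j)) (1 + int (Suc j)) a b * (qp (L + M) * bf L M (a - 1) b (- a - b + 1)))"
  proof (intro sum.cong refl, clarify)
    fix a b :: int
    have "wt ?K (1 + int j) a b * q powi ((a - 1)\<^sup>2 + (a - 1) * b + b\<^sup>2) = wt (4 + 3 * int d + 3 * int (Suc j)) (1 + int j + 1) a b"
      by (rule wt_times_qpow(2)) simp_all
    moreover have "1 + int j + 1 = 1 + int (Suc j)" by simp
    ultimately show "wt ?K (1 + int j) a b * (q powi ((a - 1)\<^sup>2 + (a - 1) * b + b\<^sup>2) * qp (L + M) * bf L M (a - 1) b (- a - b + 1))
      = wt (4 + 3 * int d + 3 * int (Suc j)) (1 + int (Suc j)) a b * (qp (L + M) * bf L M (a - 1) b (- a - b + 1))"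
      unfolding mult.assoc[symmetric] by (simp only:)
  qed
  finally show ?case .
qed

text \<open>The two chains differ in a single transform, the one where the linear exponents end, and
  \<open>phi_0_phi_1\<close> merges them there. The weight is 4 + 3 (k - 1).\<close>

lemma phi_chain_diff:
  assumes "2 \<le> s" "s < k" "L \<ge> 0" "M \<ge> 0" "D \<ge> L + 1"
  shows "(phi 0 ^^ (s - 1)) ((phi 1 ^^ (k - s)) gam) L M - q * (phi 0 ^^ (s - 2)) ((phi 1 ^^ (k - (s - 1))) gam) L M
    = (\<Sum>(a, b)\<in>lat D. wt (3 * int k + 1) (int s) a b * (qp (L + M) * bf L M (a - 1) b (- a - b + 1)))"
proof -
  define g where "g = (phi 1 ^^ (k - s)) gam"
  have s: "s - 1 = Suc (s - 2)" "k - (s - 1) = Suc (k - s)" using assms by simp_all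
  have "(phi 0 ^^ (s - 1)) g L M - q * (phi 0 ^^ (s - 2)) (phi 1 g) L M
      = (phi 0 ^^ (s - 2)) (\<lambda>r t. phi 0 g r t - q * phi 1 g r t) L M"
    unfolding s phi_funpow_diff by (simp add: funpow_swap1)
  also have "\<dots> = (phi 0 ^^ (s - 1)) (\<lambda>r t. (1 - q powi (r + t + 1)) * g r t) L M"
    unfolding phi_0_phi_1 s by (simp add: funpow_swap1)
  also have "\<dots> = (\<Sum>(a, b)\<in>lat D. wt (4 + 3 * int (k - s) + 3 * int (s - 1)) (1 + int (s - 1)) a b * (qp (L + M) * bf L M (a - 1) b (- a - b + 1)))"
    unfolding g_def by (rule phi_0_phi_1_gam) (use assms in auto)
  also have "4 + 3 * int (k - s) + 3 * int (s - 1) = 3 * int k + 1"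
    using assms by auto
  also have "1 + int (s - 1) = int s"
    using assms by auto
  finally show ?thesis unfolding g_def s(2) by simp
qed

end

subsection \<open>From the Bailey chain to the multisum\<close>

lemma sum_int_atLeastAtMost_eq_nat:
  assumes "\<And>r. r > L \<Longrightarrow> f r = 0" "L \<le> int D"
  shows "(\<Sum>r\<in>{0..L::int}. f r) = (\<Sum>r\<le>D. f (int r))"
proof -
  have "(\<Sum>r\<in>{0..L}. f r) = (\<Sum>r\<in>{0..int D}. f r)"
    by (rule sum.mono_neutral_left) (use assms in auto)
  also have "\<dots> = (\<Sum>r\<le>D. f (int r))"
    by (rule sum.reindex_bij_witness[of _ int nat]) auto
  finally show ?thesis .
qed

lemma sum_PiE_atLeastAtMost_rec:
  assumes "l \<le> u"
  shows "(\<Sum>n\<in>Pi\<^sub>E {l..u} B. F n) = (\<Sum>r\<in>B l. \<Sum>n\<in>Pi\<^sub>E {Suc l..u} B. F (n(l := r)))"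
proof -
  have "{l..u} = insert l {Suc l..u}" using assms by auto
  then have "Pi\<^sub>E {l..u} B = (\<lambda>(r, n). n(l := r)) ` (B l \<times> Pi\<^sub>E {Suc l..u} B)"
    by (simp add: PiE_insert_eq)
  moreover have "inj_on (\<lambda>(r, n). n(l := r)) (B l \<times> Pi\<^sub>E {Suc l..u} B)"
    using inj_combinator[of l "{Suc l..u}" B] by simp
  ultimately show ?thesis
    by (simp add: sum.reindex sum.cartesian_product case_prod_unfold)
qed

definition ev :: "nat \<Rightarrow> nat \<Rightarrow> int" where
  "ev s i = (if s \<le> i then 1 else 0)"

text \<open>The origin of the Kronecker delta in the binomial coefficients: the jump of the linear
  exponent between adjacent levels.\<close>

lemma ev_Suc: "1 \<le> s \<Longrightarrow> 1 \<le> l \<Longrightarrow> ev s (Suc l) - ev s l = kdelta l (s - 1)"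
  by (auto simp: ev_def kdelta_def)

text \<open>Bound for \<open>m\<^sub>i\<close> when all \<open>n\<^sub>i \<le> D\<close> and all the binomial coefficients are nonzero.\<close>
definition mbound :: "nat \<Rightarrow> nat \<Rightarrow> nat \<Rightarrow> nat" where
  "mbound k D i = (k - i) * (D + 1) + D"

context q_field begin

definition quad :: "nat \<Rightarrow> nat \<Rightarrow> nat \<Rightarrow> nat \<Rightarrow> 'a" where
  "quad s i r m = q powi ((int r)\<^sup>2 - int r * int m + (int m)\<^sup>2 + ev s i * (int r + int m))"

definition tw :: "nat \<Rightarrow> nat \<Rightarrow> nat \<Rightarrow> (nat \<Rightarrow> nat) \<Rightarrow> (nat \<Rightarrow> nat) \<Rightarrow> 'a" where
  "tw k s l n m = (\<Prod>i=l..k - 1. quad s i (n i) (m i)) * qbin (2 * int (n (k - 1))) (int (m (k - 1))) *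
     (\<Prod>i=l..k - 2. qbin (int (n i)) (int (n (i + 1))) *
        qbin (int (n i) - int (n (i + 1)) + int (m (i + 1)) + kdelta i (s - 1)) (int (m i)))"

text \<open>The last two factors are those that \<open>iq_sum_eq_qbin_sum\<close> leaves over when
  the second index of a transform is traded for m.\<close>

definition gq :: "nat \<Rightarrow> nat \<Rightarrow> int \<Rightarrow> int \<Rightarrow> nat \<Rightarrow> nat \<Rightarrow> 'a" where
  "gq s l L M r m = iq (int r) * iq (L - int r) * iq M * iq (M - int r + ev s l + int m)"

text \<open>
  The multisum over the levels \<open>l, \<dots>, k - 1\<close>, cut off at \<open>n\<^sub>i \<le> D\<close>, with a weight that
  depends on \<open>L\<close> and \<open>M\<close> and becomes independent of the indices for \<open>L, M \<rightarrow> \<infinity>\<close>.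
\<close>
definition gsum :: "nat \<Rightarrow> nat \<Rightarrow> nat \<Rightarrow> nat \<Rightarrow> int \<Rightarrow> int \<Rightarrow> 'a" where
  "gsum k s D l L M = (\<Sum>n\<in>Pi\<^sub>E {l..k - 1} (\<lambda>_. {..D}). \<Sum>m\<in>Pi\<^sub>E {l..k - 1} (\<lambda>i. {..mbound k D i}).
     tw k s l n m * gq s l L M (n l) (m l))"

lemma qbin_iq: "r \<ge> 0 \<Longrightarrow> qbin r r' * iq r = iq r' * iq (r - r')"
  using qp_iq[of r] by (simp add: qbin_def mult_ac)

text \<open>This is \<open>iq_sum_eq_qbin_sum\<close> with b = r - e. It trades the second summation
  index of a transform for the index m of the multisum.\<close>

lemma phi_inner_sum:
  assumes N: "N \<ge> 0" and a: "a = N - r + e" and bd: "N \<le> int B"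
  shows "(\<Sum>s\<in>{0..M}. q powi (r\<^sup>2 - r * s + s\<^sup>2 + e * (r + s)) * (iq s * iq (s + a)) * iq (M - s))
    = (\<Sum>\<mu>\<le>B. q powi (r\<^sup>2 - r * int \<mu> + (int \<mu>)\<^sup>2 + e * (r + int \<mu>)) * qbin N (int \<mu>) * (iq M * iq (M - r + e + int \<mu>)))"
proof -
  have b: "a + (r - e) = N" using a by simp
  have "(\<Sum>s\<in>{0..M}. q powi (r\<^sup>2 - r * s + s\<^sup>2 + e * (r + s)) * (iq s * iq (s + a)) * iq (M - s))
     = q powi (r\<^sup>2 + e * r) * (\<Sum>s\<in>{0..M}. q powi (s\<^sup>2 - (r - e) * s) * iq (M - s) * iq s * iq (s + a))"
    unfolding sum_distrib_left
  proof (intro sum.cong refl)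
    fix s :: int
    have "r\<^sup>2 - r * s + s\<^sup>2 + e * (r + s) = (r\<^sup>2 + e * r) + (s\<^sup>2 - (r - e) * s)" by (simp add: algebra_simps)
    then show "q powi (r\<^sup>2 - r * s + s\<^sup>2 + e * (r + s)) * (iq s * iq (s + a)) * iq (M - s)
       = q powi (r\<^sup>2 + e * r) * (q powi (s\<^sup>2 - (r - e) * s) * iq (M - s) * iq s * iq (s + a))"
      by (simp only: qpow_comb[symmetric] mult_ac)
  qed
  also have "\<dots> = q powi (r\<^sup>2 + e * r) * (iq M * (\<Sum>m\<in>{0..N}. q powi (m\<^sup>2 - (r - e) * m) * qbin N m * iq (M - (r - e) + m)))"
    using iq_sum_eq_qbin_sum[of a "r - e" M] N unfolding b by simp
  also have "(\<Sum>m\<in>{0..N}. q powi (m\<^sup>2 - (r - e) * m) * qbin N m * iq (M - (r - e) + m))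
     = (\<Sum>m\<le>B. q powi ((int m)\<^sup>2 - (r - e) * int m) * qbin N (int m) * iq (M - (r - e) + int m))"
    by (rule sum_int_atLeastAtMost_eq_nat) (use bd in \<open>auto simp: qbin_eq_0\<close>)
  also have "q powi (r\<^sup>2 + e * r) * (iq M * \<dots>) = (\<Sum>\<mu>\<le>B. q powi (r\<^sup>2 - r * int \<mu> + (int \<mu>)\<^sup>2 + e * (r + int \<mu>)) * qbin N (int \<mu>) * (iq M * iq (M - r + e + int \<mu>)))"
    unfolding sum_distrib_left
  proof (intro sum.cong refl)
    fix m :: nat
    have "r\<^sup>2 - r * int m + (int m)\<^sup>2 + e * (r + int m) = (r\<^sup>2 + e * r) + ((int m)\<^sup>2 - (r - e) * int m)"
      "M - (r - e) + int m = M - r + e + int m" by (simp_all add: algebra_simps)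
    then show "q powi (r\<^sup>2 + e * r) * (iq M * (q powi ((int m)\<^sup>2 - (r - e) * int m) * qbin N (int m) * iq (M - (r - e) + int m)))
       = q powi (r\<^sup>2 - r * int m + (int m)\<^sup>2 + e * (r + int m)) * qbin N (int m) * (iq M * iq (M - r + e + int m))"
      by (simp only: qpow_comb[symmetric] mult_ac)
  qed
  finally show ?thesis .
qed

text \<open>\<open>gam r s\<close> contains 1/((q)_s (q)_(s+r+1)), so a = r + 1; with e = 1 the
  upper index a + r - e is 2r, which explains the exceptional upper index 2 n_(k-1).\<close>

lemma gsum_last:
  assumes k: "k \<ge> 2" and s: "s \<le> k - 1" and L: "L \<le> int D"
  shows "gsum k s D (k - 1) L M = phi 1 gam L M"
proof -
  have e: "ev s (k - 1) = 1" using s by (simp add: ev_def)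
  have mb: "2 * D \<le> mbound k D (k - 1)" using k by (simp add: mbound_def)
  have emp: "{Suc (k - 1)..k - 1} = {}" "{k - 1..k - 2} = {}" using k by auto
  have "gsum k s D (k - 1) L M = (\<Sum>r\<le>D. \<Sum>\<mu>\<le>mbound k D (k - 1). tw k s (k - 1) ((\<lambda>_. undefined)(k - 1 := r)) ((\<lambda>_. undefined)(k - 1 := \<mu>)) * gq s (k - 1) L M r \<mu>)"
    unfolding gsum_def sum_PiE_atLeastAtMost_rec[OF order_refl] by (simp add: emp fun_upd_def)
  also have "\<dots> = (\<Sum>r\<le>D. iq (int r) * iq (L - int r) * (\<Sum>\<mu>\<le>mbound k D (k - 1).
     q powi ((int r)\<^sup>2 - int r * int \<mu> + (int \<mu>)\<^sup>2 + 1 * (int r + int \<mu>)) * qbin (2 * int r) (int \<mu>) * (iq M * iq (M - int r + 1 + int \<mu>))))"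
    unfolding tw_def quad_def gq_def e emp sum_distrib_left by (intro sum.cong refl) (simp add: mult_ac e[unfolded One_nat_def])
  also have "\<dots> = (\<Sum>r\<le>D. iq (int r) * iq (L - int r) * (\<Sum>s\<in>{0..M}. q powi ((int r)\<^sup>2 - int r * s + s\<^sup>2 + 1 * (int r + s)) * (iq s * iq (s + (int r + 1))) * iq (M - s)))"
  proof (intro sum.cong refl arg_cong2[of _ _ _ _ "(*)"] phi_inner_sum[symmetric])
    fix r assume "r \<in> {..D}"
    then have "2 * r \<le> mbound k D (k - 1)" using mb by simp
    then show "2 * int r \<le> int (mbound k D (k - 1))" by linarith
  qed auto
  also have "\<dots> = (\<Sum>r\<in>{0..L}. iq r * iq (L - r) * (\<Sum>s\<in>{0..M}. q powi (r\<^sup>2 - r * s + s\<^sup>2 + 1 * (r + s)) * (iq s * iq (s + (r + 1))) * iq (M - s)))"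
    by (rule sum_int_atLeastAtMost_eq_nat[symmetric]) (use L in auto)
  also have "\<dots> = phi 1 gam L M"
    unfolding phi_def gam_def sum_distrib_left by (intro sum.cong refl) (simp add: mult_ac add_ac)
  finally show ?thesis .
qed

text \<open>The weight at level l + 1 involves the inner index t through 1/((q)_t (q)_(t+a)) with a
  = m_(l+1) - n_(l+1) + \<open>ev s (Suc l)\<close>. Trading t for m_l gives the upper index r + a -
  \<open>ev s l\<close>, where the two values of \<open>ev\<close> combine to the Kronecker
  delta.\<close>

lemma gsum_rec:
  assumes k: "Suc l \<le> k - 1" and l: "1 \<le> l" and s: "1 \<le> s" and L: "L \<le> int D"
  shows "gsum k s D l L M = phi (ev s l) (gsum k s D (Suc l)) L M"
proof -
  define Bn where "Bn = Pi\<^sub>E {Suc l..k - 1} (\<lambda>_. {..D})"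
  define Bm where "Bm = Pi\<^sub>E {Suc l..k - 1} (\<lambda>i. {..mbound k D i})"
  define N where "N r n m = int r - int (n (Suc l)) + int (m (Suc l)) + kdelta l (s - 1)" for r :: nat and n m :: "nat \<Rightarrow> nat"
  define P where "P n m = tw k s (Suc l) n m * iq (int (n (Suc l)))" for n m
  have e: "ev s (Suc l) - ev s l = kdelta l (s - 1)" using ev_Suc[OF s l] .
  have tw: "tw k s l (n(l := r)) (m(l := \<mu>)) = quad s l r \<mu> * (qbin (int r) (int (n (Suc l))) * qbin (N r n m) (int \<mu>)) * tw k s (Suc l) n m"
    for n m r \<mu>
  proof -
    have 1: "{l..k - 1} = insert l {Suc l..k - 1}" "{l..k - 2} = insert l {Suc l..k - 2}" using k by auto
    have "(\<Prod>i=Suc l..k - 1. quad s i ((n(l := r)) i) ((m(l := \<mu>)) i)) = (\<Prod>i=Suc l..k - 1. quad s i (n i) (m i))"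
      by (intro prod.cong) auto
    moreover have "(\<Prod>i=Suc l..k - 2. qbin (int ((n(l := r)) i)) (int ((n(l := r)) (i + 1))) *
        qbin (int ((n(l := r)) i) - int ((n(l := r)) (i + 1)) + int ((m(l := \<mu>)) (i + 1)) + kdelta i (s - 1)) (int ((m(l := \<mu>)) i)))
       = (\<Prod>i=Suc l..k - 2. qbin (int (n i)) (int (n (i + 1))) *
        qbin (int (n i) - int (n (i + 1)) + int (m (i + 1)) + kdelta i (s - 1)) (int (m i)))"
      by (intro prod.cong) auto
    ultimately show ?thesis
      unfolding tw_def 1 N_def using k by (simp add: mult_ac)
  qed
  have "gsum k s D l L M = (\<Sum>r\<le>D. \<Sum>n\<in>Bn. \<Sum>\<mu>\<le>mbound k D l. \<Sum>m\<in>Bm. tw k s l (n(l := r)) (m(l := \<mu>)) * gq s l L M r \<mu>)"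
    unfolding gsum_def Bn_def Bm_def using k by (simp add: sum_PiE_atLeastAtMost_rec)
  also have "\<dots> = (\<Sum>r\<le>D. \<Sum>n\<in>Bn. \<Sum>m\<in>Bm. P n m * iq (int r - int (n (Suc l))) * iq (L - int r) * (\<Sum>\<mu>\<le>mbound k D l.
       q powi ((int r)\<^sup>2 - int r * int \<mu> + (int \<mu>)\<^sup>2 + ev s l * (int r + int \<mu>)) * qbin (N r n m) (int \<mu>) * (iq M * iq (M - int r + ev s l + int \<mu>))))"
  proof (rule sum.cong[OF refl], rule sum.cong[OF refl], subst sum.swap, rule sum.cong[OF refl])
    fix r n m
    have "iq (int (n (Suc l))) * iq (int r - int (n (Suc l))) = qbin (int r) (int (n (Suc l))) * iq (int r)"
      by (simp add: qbin_iq)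
    then show "(\<Sum>\<mu>\<le>mbound k D l. tw k s l (n(l := r)) (m(l := \<mu>)) * gq s l L M r \<mu>)
      = P n m * iq (int r - int (n (Suc l))) * iq (L - int r) * (\<Sum>\<mu>\<le>mbound k D l.
       q powi ((int r)\<^sup>2 - int r * int \<mu> + (int \<mu>)\<^sup>2 + ev s l * (int r + int \<mu>)) * qbin (N r n m) (int \<mu>) * (iq M * iq (M - int r + ev s l + int \<mu>)))"
      unfolding tw P_def sum_distrib_left mult.assoc[of "tw _ _ _ _ _"] \<open>iq (int (n (Suc l))) * _ = _\<close>
      by (intro sum.cong refl) (simp add: quad_def gq_def mult_ac)
  qed
  also have "\<dots> = (\<Sum>r\<le>D. \<Sum>n\<in>Bn. \<Sum>m\<in>Bm. P n m * iq (int r - int (n (Suc l))) * iq (L - int r) *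
      (\<Sum>t\<in>{0..M}. q powi ((int r)\<^sup>2 - int r * t + t\<^sup>2 + ev s l * (int r + t)) * (iq t * iq (t + (- int (n (Suc l)) + ev s (Suc l) + int (m (Suc l))))) * iq (M - t)))"
  proof (intro sum.cong refl)
    fix r n m assume r: "r \<in> {..D}" and n: "n \<in> Bn" and m: "m \<in> Bm"
    show "P n m * iq (int r - int (n (Suc l))) * iq (L - int r) * (\<Sum>\<mu>\<le>mbound k D l.
       q powi ((int r)\<^sup>2 - int r * int \<mu> + (int \<mu>)\<^sup>2 + ev s l * (int r + int \<mu>)) * qbin (N r n m) (int \<mu>) * (iq M * iq (M - int r + ev s l + int \<mu>)))
     = P n m * iq (int r - int (n (Suc l))) * iq (L - int r) *
      (\<Sum>t\<in>{0..M}. q powi ((int r)\<^sup>2 - int r * t + t\<^sup>2 + ev s l * (int r + t)) * (iq t * iq (t + (- int (n (Suc l)) + ev s (Suc l) + int (m (Suc l))))) * iq (M - t))"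
    proof (cases "n (Suc l) \<le> r")
      case True
      have d: "kdelta l (s - 1) \<in> {0, 1}" by (simp add: kdelta_def)
      have "m (Suc l) \<le> mbound k D (Suc l)" using m k by (auto simp: Bm_def PiE_def Pi_def)
      moreover have "mbound k D l = mbound k D (Suc l) + (D + 1)"
      proof -
        have "k - l = Suc (k - Suc l)" using k by simp
        then show ?thesis by (simp add: mbound_def)
      qed
      ultimately have "r + m (Suc l) + 1 \<le> mbound k D l" using r by simp
      then have bd: "N r n m \<le> int (mbound k D l)" using d unfolding N_def by auto
      have "N r n m \<ge> 0" using True d unfolding N_def by auto
      moreover have "- int (n (Suc l)) + ev s (Suc l) + int (m (Suc l)) = N r n m - int r + ev s l"
        unfolding N_def e[symmetric] by simp
      ultimately show ?thesis using bd by (subst phi_inner_sum) auto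
    qed simp
  qed
  also have "\<dots> = (\<Sum>r\<in>{0..L}. \<Sum>n\<in>Bn. \<Sum>m\<in>Bm. P n m * iq (r - int (n (Suc l))) * iq (L - r) *
      (\<Sum>t\<in>{0..M}. q powi (r\<^sup>2 - r * t + t\<^sup>2 + ev s l * (r + t)) * (iq t * iq (t + (- int (n (Suc l)) + ev s (Suc l) + int (m (Suc l))))) * iq (M - t)))"
    by (rule sum_int_atLeastAtMost_eq_nat[symmetric]) (use L in auto)
  also have "\<dots> = phi (ev s l) (gsum k s D (Suc l)) L M"
    unfolding phi_def gsum_def Bn_def[symmetric] Bm_def[symmetric]
  proof (rule sum.cong[OF refl])
    fix r
    have "(\<Sum>n\<in>Bn. \<Sum>m\<in>Bm. P n m * iq (r - int (n (Suc l))) * iq (L - r) *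
      (\<Sum>t\<in>{0..M}. q powi (r\<^sup>2 - r * t + t\<^sup>2 + ev s l * (r + t)) * (iq t * iq (t + (- int (n (Suc l)) + ev s (Suc l) + int (m (Suc l))))) * iq (M - t)))
      = (\<Sum>n\<in>Bn. \<Sum>m\<in>Bm. \<Sum>t\<in>{0..M}. q powi (r\<^sup>2 - r * t + t\<^sup>2 + ev s l * (r + t)) *
          (tw k s (Suc l) n m * gq' r t n m) * iq (L - r) * iq (M - t))"
      if "\<And>t n m. gq' r t n m = iq (int (n (Suc l))) * iq (r - int (n (Suc l))) * iq t * iq (t - int (n (Suc l)) + ev s (Suc l) + int (m (Suc l)))" for gq'
      unfolding that sum_distrib_left P_def by (intro sum.cong refl) (simp add: algebra_simps)
    note * = this[of "\<lambda>r t n m. gq s (Suc l) r t (n (Suc l)) (m (Suc l))", unfolded gq_def, OF refl]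
    show "(\<Sum>n\<in>Bn. \<Sum>m\<in>Bm. P n m * iq (r - int (n (Suc l))) * iq (L - r) *
      (\<Sum>t\<in>{0..M}. q powi (r\<^sup>2 - r * t + t\<^sup>2 + ev s l * (r + t)) * (iq t * iq (t + (- int (n (Suc l)) + ev s (Suc l) + int (m (Suc l))))) * iq (M - t)))
      = (\<Sum>t\<in>{0..M}. q powi (r\<^sup>2 - r * t + t\<^sup>2 + ev s l * (r + t)) *
          (\<Sum>n\<in>Bn. \<Sum>m\<in>Bm. tw k s (Suc l) n m * gq s (Suc l) r t (n (Suc l)) (m (Suc l))) * iq (L - r) * iq (M - t))"
      unfolding * gq_def by (subst sum_swap3) (simp only: sum_distrib_left sum_distrib_right)
  qed
  finally show ?thesis .
qed

lemma gsum_eq_phi: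
  assumes "1 \<le> s" "s \<le> k - 1" "1 \<le> l" "l \<le> k - 1" "0 \<le> L" "L \<le> int D"
  shows "gsum k s D l L M = (phi 0 ^^ (s - l)) ((phi 1 ^^ (k - max l s)) gam) L M"
  using assms(4,3,5,6)
proof (induction l arbitrary: L M rule: inc_induct)
  case base
  then have "max (k - 1) s = k - 1" "s - (k - 1) = 0" "k - (k - 1) = Suc 0" using assms by auto
  then show ?case using gsum_last[of k s L D M] assms base by simp
next
  case (step l)
  have "gsum k s D l L M = phi (ev s l) (gsum k s D (Suc l)) L M"
    by (rule gsum_rec) (use step assms in auto)
  also have "\<dots> = phi (ev s l) ((phi 0 ^^ (s - Suc l)) ((phi 1 ^^ (k - max (Suc l) s)) gam)) L M"
    by (rule phi_cong) (use step in auto)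
  also have "\<dots> = (phi 0 ^^ (s - l)) ((phi 1 ^^ (k - max l s)) gam) L M"
  proof (cases "s \<le> l")
    case True
    then have "ev s l = 1" "s - Suc l = 0" "s - l = 0" "max (Suc l) s = Suc l" "max l s = l" "k - l = Suc (k - Suc l)"
      using step by (auto simp: ev_def)
    then show ?thesis by simp
  next
    case False
    then have "ev s l = 0" "s - l = Suc (s - Suc l)" "max (Suc l) s = s" "max l s = s"
      by (auto simp: ev_def)
    then show ?thesis by simp
  qed
  finally show ?case .
qed

end

subsection \<open>Power series modulo powers of $X$\<close>

definition fcong :: "nat \<Rightarrow> rat fps \<Rightarrow> rat fps \<Rightarrow> bool" where
  "fcong N f g \<longleftrightarrow> (\<forall>j<N. fps_nth f j = fps_nth g j)"

lemma fcong_refl [simp]: "fcong N f f"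
  by (simp add: fcong_def)

lemma fcong_sym: "fcong N f g \<Longrightarrow> fcong N g f"
  by (simp add: fcong_def)

lemma fcong_trans [trans]: "fcong N f g \<Longrightarrow> fcong N g h \<Longrightarrow> fcong N f h"
  by (simp add: fcong_def)

lemma fcong_mono: "fcong N f g \<Longrightarrow> M \<le> N \<Longrightarrow> fcong M f g"
  by (simp add: fcong_def)

lemma fcong_mult: "fcong N f f' \<Longrightarrow> fcong N g g' \<Longrightarrow> fcong N (f * g) (f' * g')"
  unfolding fcong_def fps_mult_nth by (intro allI impI sum.cong refl) simp

lemma fcong_add: "fcong N f f' \<Longrightarrow> fcong N g g' \<Longrightarrow> fcong N (f + g) (f' + g')"
  by (simp add: fcong_def)

lemma fcong_diff: "fcong N f f' \<Longrightarrow> fcong N g g' \<Longrightarrow> fcong N (f - g) (f' - g')"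
  by (simp add: fcong_def)

lemma fcong_sum: "(\<And>x. x \<in> A \<Longrightarrow> fcong N (f x) (g x)) \<Longrightarrow> fcong N (sum f A) (sum g A)"
  by (simp add: fcong_def fps_sum_nth)

lemma fcong_X_power_mult: "N \<le> e \<Longrightarrow> fcong N (fps_X ^ e * f) 0"
  by (simp add: fcong_def fps_X_power_mult_nth)

lemma fcong_sum_subset:
  assumes "finite A" "B \<subseteq> A" "\<And>x. x \<in> A - B \<Longrightarrow> fcong N (f x) 0"
  shows "fcong N (sum f A) (sum f B)"
proof -
  have "(\<Sum>x\<in>A. fps_nth (f x) j) = (\<Sum>x\<in>B. fps_nth (f x) j)" if "j < N" for j
    by (rule sum.mono_neutral_right) (use assms that in \<open>auto simp: fcong_def\<close>)
  then show ?thesis by (simp add: fcong_def fps_sum_nth)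
qed

lemma fcong_eqI: "(\<And>N. fcong N f g) \<Longrightarrow> f = g"
  by (rule fps_ext) (auto simp: fcong_def)

text \<open>Summability is coefficientwise finiteness, so a finite index set with the right partial
  sum for each precision X^N suffices.\<close>

lemma has_sum_fps_of_fcong:
  assumes "\<And>N. finite (B N)" "\<And>N. B N \<subseteq> A" "\<And>N x. x \<in> A - B N \<Longrightarrow> fcong N (f x) 0"
    and "\<And>N. fcong N (sum f (B N)) S"
  shows "(f has_sum S) A"
proof (rule has_sum_fpsI)
  fix n
  have sub: "{x \<in> A. fps_nth (f x) n \<noteq> 0} \<subseteq> B (Suc n)"
    using assms(3)[of _ "Suc n"] by (auto simp: fcong_def)
  then show "finite {x \<in> A. fps_nth (f x) n \<noteq> 0}"
    using assms(1) by (rule finite_subset)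
  have "fps_nth S n = (\<Sum>x\<in>B (Suc n). fps_nth (f x) n)"
    using assms(4)[of "Suc n"] by (simp add: fcong_def fps_sum_nth)
  also have "\<dots> = (\<Sum>x | x \<in> A \<and> fps_nth (f x) n \<noteq> 0. fps_nth (f x) n)"
    by (rule sum.mono_neutral_right) (use sub assms(1,2) in auto)
  finally show "fps_nth S n = (\<Sum>x | x \<in> A \<and> fps_nth (f x) n \<noteq> 0. fps_nth (f x) n)" .
qed

lemma has_sum_fps_nth:
  fixes f :: "'b \<Rightarrow> rat fps"
  assumes "(f has_sum S) A" "finite F" "F \<subseteq> A" "\<And>x. x \<in> A - F \<Longrightarrow> fps_nth (f x) n = 0"
  shows "fps_nth S n = (\<Sum>x\<in>F. fps_nth (f x) n)"
proof -
  have "fps_nth S n = (\<Sum>x | x \<in> A \<and> fps_nth (f x) n \<noteq> 0. fps_nth (f x) n)"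
    by (rule has_sum_fpsD(2)[OF assms(1)])
  also have "\<dots> = (\<Sum>x\<in>F. fps_nth (f x) n)"
    by (rule sum.mono_neutral_left) (use assms in auto)
  finally show ?thesis .
qed

lemma has_sum_fps_times:
  fixes f :: "'b \<Rightarrow> rat fps" and g :: "'c \<Rightarrow> rat fps"
  assumes f: "(f has_sum S) A" and g: "(g has_sum T) B"
  shows "((\<lambda>(x, y). f x * g y) has_sum (S * T)) (A \<times> B)"
proof -
  define F where "F n = (\<Union>i\<le>n. {x \<in> A. fps_nth (f x) i \<noteq> 0})" for n
  define G where "G n = (\<Union>i\<le>n. {x \<in> B. fps_nth (g x) i \<noteq> 0})" for n
  have fin: "finite (F n)" "finite (G n)" for n
    using has_sum_fpsD(1)[OF f] has_sum_fpsD(1)[OF g] by (auto simp: F_def G_def)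
  have S: "fcong (Suc n) S (sum f (F n))" "fcong (Suc n) T (sum g (G n))" for n
    unfolding fcong_def fps_sum_nth
    using has_sum_fps_nth[OF f fin(1)[of n]] has_sum_fps_nth[OF g fin(2)[of n]]
    by (force simp: F_def G_def)+
  show ?thesis
  proof (rule has_sum_fps_of_fcong[where B = "\<lambda>N. F N \<times> G N"])
    fix N p assume p: "p \<in> A \<times> B - F N \<times> G N"
    then have "fcong N (f (fst p)) 0 \<or> fcong N (g (snd p)) 0"
      by (force simp: F_def G_def fcong_def)
    then show "fcong N (case p of (x, y) \<Rightarrow> f x * g y) 0"
      using fcong_mult[of N "f (fst p)" 0 "g (snd p)" "g (snd p)"] fcong_mult[of N "f (fst p)" "f (fst p)" "g (snd p)" 0]
      by (auto simp: case_prod_unfold)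
  next
    fix N
    have "fcong N (sum f (F N) * sum g (G N)) (S * T)"
      using fcong_mono[OF S(1)[of N], of N] fcong_mono[OF S(2)[of N], of N] by (auto intro: fcong_mult fcong_sym)
    then show "fcong N (sum (\<lambda>(x, y). f x * g y) (F N \<times> G N)) (S * T)"
      by (simp add: sum_product sum.cartesian_product)
  qed (auto simp: fin, auto simp: F_def G_def)
qed

lemma has_sum_fps_cmult:
  fixes f :: "'b \<Rightarrow> rat fps"
  assumes "(f has_sum S) A"
  shows "((\<lambda>x. c * f x) has_sum (c * S)) A"
proof -
  define F where "F N = (\<Union>i\<le>N. {x \<in> A. fps_nth (f x) i \<noteq> 0})" for N
  have fin: "finite (F N)" for N using has_sum_fpsD(1)[OF assms] by (auto simp: F_def)
  show ?thesis
  proof (rule has_sum_fps_of_fcong[where B = F])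
    fix N x assume "x \<in> A - F N"
    then have "fcong N (f x) 0" by (auto simp: F_def fcong_def)
    from fcong_mult[OF fcong_refl this, of c] show "fcong N (c * f x) 0" by simp
  next
    fix N
    have "fcong N (sum f (F N)) S"
      unfolding fcong_def fps_sum_nth using has_sum_fps_nth[OF assms fin[of N]] by (force simp: F_def)
    from fcong_mult[OF fcong_refl this, of c] show "fcong N (\<Sum>x\<in>F N. c * f x) (c * S)"
      by (simp add: sum_distrib_left)
  qed (use fin in \<open>auto simp: F_def\<close>)
qed

lemma has_sum_fps_section:
  fixes f :: "'b \<times> 'c \<Rightarrow> rat fps"
  assumes "(f has_sum S) (A \<times> B)" "x \<in> A"
  shows "\<exists>T. ((\<lambda>y. f (x, y)) has_sum T) B"
proof (intro exI has_sum_fpsI)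
  fix n
  have "{y \<in> B. fps_nth (f (x, y)) n \<noteq> 0} = Pair x -` {p \<in> A \<times> B. fps_nth (f p) n \<noteq> 0}"
    using assms(2) by auto
  also have "finite \<dots>"
    by (rule finite_vimageI[OF has_sum_fpsD(1)[OF assms(1)]]) (auto simp: inj_on_def)
  finally show "finite {y \<in> B. fps_nth (f (x, y)) n \<noteq> 0}" .
qed (rule fps_nth_Abs_fps)

lemma has_sum_fps_Sigma:
  fixes f :: "'b \<times> 'c \<Rightarrow> rat fps"
  assumes f: "(f has_sum S) (A \<times> B)" and g: "\<And>x. x \<in> A \<Longrightarrow> ((\<lambda>y. f (x, y)) has_sum g x) B"
  shows "(g has_sum S) A"
proof -
  define F where "F N = (\<Union>i\<le>N. {p \<in> A \<times> B. fps_nth (f p) i \<noteq> 0})" for N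
  have fin: "finite (F N)" for N using has_sum_fpsD(1)[OF f] by (auto simp: F_def)
  have F0: "fps_nth (f p) i = 0" if "p \<in> A \<times> B" "p \<notin> F N" "i \<le> N" for p i N
    using that by (auto simp: F_def)
  have FA: "F N \<subseteq> A \<times> B" for N by (auto simp: F_def)
  have gx: "fps_nth (g x) i = (\<Sum>y\<in>snd ` F N. fps_nth (f (x, y)) i)" if "x \<in> A" "i \<le> N" for x i N
    by (rule has_sum_fps_nth[OF g[OF that(1)]]) (use fin FA F0[of "(x, _)" N i] that in \<open>force+\<close>)
  show ?thesis
  proof (rule has_sum_fps_of_fcong[where B = "\<lambda>N. fst ` F N"])
    fix N x assume x: "x \<in> A - fst ` F N"
    show "fcong N (g x) 0"
      unfolding fcong_def
    proof (intro allI impI)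
      fix j assume j: "j < N"
      have "fps_nth (f (x, y)) j = 0" if "y \<in> snd ` F N" for y
        by (rule F0[of _ N]) (use x j FA[of N] that in \<open>force+\<close>)
      then show "fps_nth (g x) j = fps_nth 0 j" using gx[of x j N] x j by simp
    qed
  next
    fix N
    show "fcong N (sum g (fst ` F N)) S"
      unfolding fcong_def fps_sum_nth
    proof (intro allI impI)
      fix j assume j: "j < N"
      have "(\<Sum>x\<in>fst ` F N. fps_nth (g x) j) = (\<Sum>x\<in>fst ` F N. \<Sum>y\<in>snd ` F N. fps_nth (f (x, y)) j)"
        by (intro sum.cong refl gx) (use FA[of N] j in auto)
      also have "\<dots> = (\<Sum>p\<in>fst ` F N \<times> snd ` F N. fps_nth (f p) j)"
        by (simp add: sum.cartesian_product)
      also have "\<dots> = fps_nth S j"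
        by (rule has_sum_fps_nth[OF f, symmetric])
          (use fin FA[of N] F0[of _ N j] j in \<open>force+\<close>)
      finally show "(\<Sum>x\<in>fst ` F N. fps_nth (g x) j) = fps_nth S j" .
    qed
  qed (use fin FA in force)+
qed

lemma prod_one_minus_X_power_stable:
  assumes "K \<ge> 1" "a \<ge> 1" "n \<le> n'"
  shows "fcong (Suc n) (\<Prod>t<n'. 1 - fps_X ^ a * (fps_X ^ K) ^ t) (\<Prod>t<n. 1 - fps_X ^ a * (fps_X ^ K) ^ t)"
  using assms(3)
proof (induction n' rule: dec_induct)
  case base
  then show ?case by simp
next
  case (step m)
  have "n + 1 \<le> a + K * m"
    using assms(1,2) step(1) by (metis add.commute add_mono le_trans mult.commute mult_le_mono2 nat_mult_1_right)
  then have "fcong (Suc n) (fps_X ^ (a + K * m) * 1) 0" by (intro fcong_X_power_mult) simp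
  then have "fcong (Suc n) (1 - fps_X ^ a * (fps_X ^ K) ^ m) (1 - 0)"
    by (intro fcong_diff fcong_refl) (simp add: power_add power_mult)
  from fcong_mult[OF step.IH this] show ?case by simp
qed

text \<open>The factors with t >= n are 1 modulo X^(n+1), since a + K t >= n + 1.\<close>

lemma qpoch_inf_approx:
  assumes "K \<ge> 1" "a \<ge> 1"
  shows "fcong (Suc n) (qpoch_inf (fps_X ^ a) (fps_X ^ K)) (\<Prod>t<n. 1 - fps_X ^ a * (fps_X ^ K) ^ t)"
proof -
  let ?f = "\<lambda>t. 1 - fps_X ^ a * (fps_X ^ K) ^ t :: rat fps"
  have nth0: "fps_nth (?f t) 0 = 1" for t using assms by (simp add: fps_nth_power_0)
  then have nz: "?f t \<noteq> 0" for t by (metis fps_zero_nth zero_neq_one)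
  have "fps_nth (fps_X ^ K :: rat fps) 0 = 0" using assms by (simp add: fps_nth_power_0)
  from qpoch_inf_has_prod[OF this, of "fps_X ^ a"]
  have "raw_has_prod ?f 0 (qpoch_inf (fps_X ^ a) (fps_X ^ K))"
    unfolding has_prod_def using nz by auto
  then have "(\<lambda>n. \<Prod>t\<le>n. ?f t) \<longlonglongrightarrow> qpoch_inf (fps_X ^ a) (fps_X ^ K)"
    by (simp add: raw_has_prod_def)
  then have lim: "\<forall>\<^sub>F m in sequentially. fps_nth (\<Prod>t\<le>m. ?f t) j = fps_nth (qpoch_inf (fps_X ^ a) (fps_X ^ K)) j" for j
    unfolding tendsto_fps_iff by blast
  show ?thesis
    unfolding fcong_def
  proof (intro allI impI)
    fix j assume j: "j < Suc n"
    from lim[of j] obtain m0 where m0: "\<And>m. m \<ge> m0 \<Longrightarrow> fps_nth (\<Prod>t\<le>m. ?f t) j = fps_nth (qpoch_inf (fps_X ^ a) (fps_X ^ K)) j"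
      unfolding eventually_sequentially by blast
    define m where "m = max m0 n"
    have "fps_nth (qpoch_inf (fps_X ^ a) (fps_X ^ K)) j = fps_nth (\<Prod>t<Suc m. ?f t) j"
      using m0[of m] by (simp add: m_def lessThan_Suc_atMost)
    also have "\<dots> = fps_nth (\<Prod>t<n. ?f t) j"
      using prod_one_minus_X_power_stable[OF assms, of n "Suc m"] j by (simp add: m_def fcong_def)
    finally show "fps_nth (qpoch_inf (fps_X ^ a) (fps_X ^ K)) j = fps_nth (\<Prod>t<n. ?f t) j" .
  qed
qed

lemma qpoch_inf_nth_0:
  assumes "K \<ge> 1" "a \<ge> 1"
  shows "fps_nth (qpoch_inf (fps_X ^ a) (fps_X ^ K)) 0 = 1"
  using qpoch_inf_approx[OF assms, of 0] by (simp add: fcong_def)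

text \<open>The defining quotient of infinite products is resolved through (q)_inf = (q)_n
  (q^(n+1))_inf, proved modulo each power of X.\<close>

lemma qpoch_eq_prod: "qpoch fps_X fps_X n = (\<Prod>t<n. 1 - fps_X ^ Suc t)"
proof -
  let ?P = "\<lambda>n. \<Prod>t<n. 1 - fps_X ^ Suc t :: rat fps"
  have P1: "fcong (Suc m) (qpoch_inf fps_X fps_X) (?P m)" for m
    using qpoch_inf_approx[of 1 1 m] by simp
  have P2: "fcong (Suc m) (qpoch_inf (fps_X * fps_X ^ n) fps_X) (\<Prod>t<m. 1 - fps_X ^ Suc (n + t))" for m
    using qpoch_inf_approx[of 1 "Suc n" m] by (simp add: power_add mult.assoc)
  have "qpoch_inf fps_X fps_X = ?P n * qpoch_inf (fps_X * fps_X ^ n) fps_X"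
  proof (rule fcong_eqI)
    fix N
    have "fcong (Suc N) (qpoch_inf fps_X fps_X) (?P (n + N))"
      using P1[of "n + N"] by (rule fcong_mono) simp
    also have "?P (n + N) = ?P n * (\<Prod>t<N. 1 - fps_X ^ Suc (n + t))"
      by (induction N) (simp_all add: mult.assoc)
    also have "fcong (Suc N) \<dots> (?P n * qpoch_inf (fps_X * fps_X ^ n) fps_X)"
      by (intro fcong_mult fcong_refl fcong_sym[OF P2])
    finally show "fcong N (qpoch_inf fps_X fps_X) (?P n * qpoch_inf (fps_X * fps_X ^ n) fps_X)"
      by (rule fcong_mono) simp
  qed
  moreover have "qpoch_inf (fps_X * fps_X ^ n) fps_X \<noteq> 0"
    using qpoch_inf_nth_0[of 1 "Suc n"] by auto
  ultimately show ?thesis by (simp add: qpoch_def)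
qed

subsection \<open>The Jacobi triple product\<close>

definition tri :: "int \<Rightarrow> int" where
  "tri j = j * (j - 1) div 2"

lemma tri_double: "2 * tri j = j * (j - 1)"
proof -
  have "even (j * (j - 1))" by simp
  then show ?thesis by (simp add: tri_def)
qed

lemma tri_Suc: "tri (j + 1) = tri j + j"
proof -
  have "2 * tri (j + 1) = 2 * (tri j + j)" unfolding distrib_left tri_double by (simp add: algebra_simps)
  then show ?thesis by simp
qed

lemma tri_uminus: "tri (- j) = tri j + j"
proof -
  have "2 * tri (- j) = 2 * (tri j + j)" unfolding distrib_left tri_double by (simp add: algebra_simps)
  then show ?thesis by simp
qed

text \<open>The reflection j -> -j exchanges i and K - i, which reduces the bound to j >= 0. It
  gives both nonnegative exponents and summability of theta series.\<close>

lemma tri_exponent_ge: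
  assumes "0 < i" "i < K"
  shows "K * tri j + i * j \<ge> \<bar>j\<bar>"
proof -
  have p: "K * tri j + i * j \<ge> j" if "j \<ge> 0" "i > 0" "K \<ge> 0" for i j :: int
  proof -
    have "2 * tri j \<ge> 0" unfolding tri_double using that by (cases "j = 0") auto
    then have "K * tri j \<ge> 0" using that by simp
    moreover have "i * j \<ge> 1 * j" by (rule mult_right_mono) (use that in auto)
    ultimately show ?thesis by simp
  qed
  show ?thesis
  proof (cases "j \<ge> 0")
    case True
    then show ?thesis using p[of j i] assms by simp
  next
    case False
    have "K * tri j + i * j = K * tri (- j) + (K - i) * (- j)"
      unfolding tri_uminus by (simp add: algebra_simps)
    then show ?thesis using p[of "- j" "K - i"] assms False by simp
  qed
qed

context q_field begin

definition jsum :: "'a \<Rightarrow> nat \<Rightarrow> nat \<Rightarrow> 'a" where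
  "jsum z L M = (\<Sum>j\<in>{- int L..int M}. (- z) powi j * q powi tri j * iq (int L + j) * iq (int M - j))"

lemma jsum_sym: "z \<noteq> 0 \<Longrightarrow> jsum z L M = jsum (q / z) M L"
  unfolding jsum_def
proof (rule sum.reindex_bij_witness[of _ uminus uminus])
  fix j assume z: "z \<noteq> 0"
  have "- (q / z) = q * inverse (- z)" by (simp add: divide_inverse)
  then have "(- (q / z)) powi (- j) = q powi (- j) * inverse ((- z) powi (- j))"
    by (simp only: power_int_mult_distrib power_int_inverse)
  also have "\<dots> = q powi (- j) * (- z) powi j"
    by (simp only: power_int_minus inverse_inverse_eq)
  finally have "(- (q / z)) powi (- j) * q powi tri (- j) = (- z) powi j * q powi tri j"
    unfolding tri_uminus by (simp add: mult_ac qpow_comb qpow_comb_left)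
  then show "(- (q / z)) powi (- j) * q powi tri (- j) * iq (int M + - j) * iq (int L - - j) = (- z) powi j * q powi tri j * iq (int L + j) * iq (int M - j)"
    by (simp only: mult_ac) (simp add: mult_ac)
qed auto

text \<open>The splitting used for q-Chu--Vandermonde, now of 1 - q^(L+M+1): one part lowers M + 1
  to M, the other also shifts j and contributes -z q^M.\<close>

lemma jsum_rec:
  assumes z: "z \<noteq> 0"
  shows "(1 - q powi (int L + int M + 1)) * jsum z L (Suc M) = (1 - z * q ^ M) * jsum z L M"
proof -
  define F where "F M j = (- z) powi j * q powi tri j * iq (int L + j) * iq (M - j)" for M j
  let ?M = "int M + 1"
  have split: "(1 - q powi (int L + ?M)) * F ?M j = F (int M) j - z * q ^ M * F (int M) (j - 1)" for j
  proof -
    have 1: "1 - q powi (int L + ?M) = (1 - q powi (?M - j)) + q powi (?M - j) * (1 - q powi (int L + j))"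
      by (simp add: algebra_simps qpow_comb)
    have "iq (int M - j) = (1 - q powi (?M - j)) * iq (?M - j)"
      using iq_pred[of "?M - j"] by simp
    then have a: "(1 - q powi (?M - j)) * F ?M j = F (int M) j"
      unfolding F_def by (simp only: mult_ac)
    have zj: "(- z) powi j = - (z * (- z) powi (j - 1))"
      using z by (simp add: power_int_diff)
    have e: "q powi (?M - j) * q powi tri j = q ^ M * q powi tri (j - 1)"
    proof -
      have "?M - j + tri j = int M + tri (j - 1)" using tri_Suc[of "j - 1"] by simp
      then show ?thesis unfolding power_int_of_nat[symmetric] qpow_comb by (rule arg_cong)
    qed
    have "q powi (?M - j) * (1 - q powi (int L + j)) * F ?M j
      = (- z) powi j * (q powi (?M - j) * q powi tri j) * ((1 - q powi (int L + j)) * iq (int L + j)) * iq (?M - j)"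
      unfolding F_def by (simp only: mult_ac)
    also have "\<dots> = - (z * q ^ M * F (int M) (j - 1))"
      unfolding zj e iq_rec F_def by (simp add: algebra_simps)
    finally show ?thesis unfolding 1 distrib_right a by simp
  qed
  have "(1 - q powi (int L + ?M)) * jsum z L (Suc M) = (\<Sum>j\<in>{- int L..?M}. (1 - q powi (int L + ?M)) * F ?M j)"
    unfolding jsum_def sum_distrib_left F_def by (simp add: add.commute)
  also have "\<dots> = (\<Sum>j\<in>{- int L..?M}. F (int M) j - z * q ^ M * F (int M) (j - 1))"
    by (simp only: split)
  also have "\<dots> = (\<Sum>j\<in>{- int L..?M}. F (int M) j) - z * q ^ M * (\<Sum>j\<in>{- int L..?M}. F (int M) (j - 1))"
    by (simp add: sum_subtractf sum_distrib_left)
  also have "(\<Sum>j\<in>{- int L..?M}. F (int M) j) = jsum z L M"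
    unfolding jsum_def F_def by (rule sum.mono_neutral_right) auto
  also have "(\<Sum>j\<in>{- int L..?M}. F (int M) (j - 1)) = (\<Sum>j\<in>{- int L - 1..int M}. F (int M) j)"
    by (subst int_sum_shift[of _ _ _ 1]) simp
  also have "\<dots> = jsum z L M"
    unfolding jsum_def F_def by (rule sum.mono_neutral_right) auto
  finally show ?thesis by (simp add: algebra_simps)
qed

lemma jsum_prod_step:
  assumes z: "z \<noteq> 0"
  shows "jsum z L M * iq (int L) = iq (int L + int M) * (\<Prod>t<M. 1 - z * q ^ t) * jsum z L 0"
proof (induction M)
  case (Suc M)
  have n: "1 - q powi (int L + int M + 1) \<noteq> 0" using powi_not_root[of "int L + int M + 1"] by simp
  have "(1 - q powi (int L + int M + 1)) * (jsum z L (Suc M) * iq (int L)) = (1 - z * q ^ M) * (jsum z L M * iq (int L))"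
    using jsum_rec[OF z, of L M] by (simp add: mult.assoc[symmetric])
  also have "\<dots> = iq (int L + int M + 1 - 1) * ((\<Prod>t<Suc M. 1 - z * q ^ t) * jsum z L 0)"
    unfolding Suc.IH by (simp add: mult_ac)
  also have "\<dots> = (1 - q powi (int L + int M + 1)) * (iq (int L + int (Suc M)) * (\<Prod>t<Suc M. 1 - z * q ^ t) * jsum z L 0)"
    unfolding iq_pred by (simp add: mult_ac add_ac)
  finally show ?case using n by simp
qed simp

text \<open>For fixed L the recursion in M yields the factors in z; the exchange of z and q/z, which
  swaps L and M, then yields those in q/z.\<close>

lemma finite_jacobi_triple:
  assumes z: "z \<noteq> 0"
  shows "jsum z L M = iq (int L + int M) * (\<Prod>t<M. 1 - z * q ^ t) * (\<Prod>t<L. 1 - q / z * q ^ t)"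
proof -
  have "jsum (q / z) 0 L * iq 0 = iq (int L) * (\<Prod>t<L. 1 - q / z * q ^ t) * jsum (q / z) 0 0"
    using jsum_prod_step[of "q / z" 0 L] z by simp
  then have "jsum z L 0 = iq (int L) * (\<Prod>t<L. 1 - q / z * q ^ t)"
    using jsum_sym[OF z, of L 0] by (simp add: jsum_def tri_def)
  then show ?thesis
    using jsum_prod_step[OF z, of L M] iq_nonzero[of "int L"] by (simp add: mult_ac)
qed

end

section \<open>Transfer from Laurent series to power series and the infinite triple product\<close>

lemma fps_to_fls_inverse:
  fixes f :: "rat fps"
  assumes "fps_nth f 0 \<noteq> 0"
  shows "fps_to_fls (inverse f) = inverse (fps_to_fls f)"
proof -
  have "fps_to_fls f * fps_to_fls (inverse f) = 1"
    using assms by (simp add: inverse_mult_eq_1' flip: fls_times_fps_to_fls)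
  then show ?thesis by (simp add: inverse_unique)
qed

lemma fps_to_fls_prod: "fps_to_fls (\<Prod>x\<in>A. f x) = (\<Prod>x\<in>A. fps_to_fls (f x :: rat fps))"
  by (induction A rule: infinite_finite_induct) (simp_all add: fls_times_fps_to_fls)

lemma fps_to_fls_sum: "fps_to_fls (\<Sum>x\<in>A. f x) = (\<Sum>x\<in>A. fps_to_fls (f x :: rat fps))"
  by (induction A rule: infinite_finite_induct) simp_all

definition xpoch :: "nat \<Rightarrow> nat \<Rightarrow> rat fps" where
  "xpoch K n = (\<Prod>t<n. 1 - (fps_X ^ K) ^ Suc t)"

definition xinv :: "nat \<Rightarrow> int \<Rightarrow> rat fps" where
  "xinv K n = (if n < 0 then 0 else inverse (xpoch K (nat n)))"

abbreviation xinf :: "nat \<Rightarrow> rat fps" where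
  "xinf K \<equiv> qpoch_inf (fps_X ^ K) (fps_X ^ K)"

lemma xpoch_nth_0: "K \<ge> 1 \<Longrightarrow> fps_nth (xpoch K n) 0 = 1"
  unfolding xpoch_def by (induction n) (simp_all add: fps_nth_power_0)

text \<open>Bases X^K with K > 1 serve the theta functions, K = 1 the Bailey chain.\<close>

lemma q_field_X: "K \<ge> 1 \<Longrightarrow> q_field (fls_X ^ K :: rat fls)"
proof
  fix n :: nat assume K: "K \<ge> 1" and n: "n > 0"
  show "(fls_X ^ K) ^ n \<noteq> (1 :: rat fls)"
  proof
    assume "(fls_X ^ K) ^ n = (1 :: rat fls)"
    then have "fps_to_fls (fps_X ^ (K * n)) = fps_to_fls (1 :: rat fps)"
      by (simp add: fps_to_fls_power power_mult)
    then have "fps_X ^ (K * n) = (1 :: rat fps)" by (simp only: fps_to_fls_eq_iff)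
    from arg_cong[OF this, of "\<lambda>f. fps_nth f 0"] show False
      using K n by (simp add: fps_nth_power_0 zero_power)
  qed
qed simp

lemma qp_X: "K \<ge> 1 \<Longrightarrow> q_field.qp (fls_X ^ K) (int n) = fps_to_fls (xpoch K n)"
  by (simp add: q_field.qp_def[OF q_field_X] xpoch_def fps_to_fls_prod fps_to_fls_power fls_times_fps_to_fls)

lemma iq_X: "K \<ge> 1 \<Longrightarrow> q_field.iq (fls_X ^ K) n = fps_to_fls (xinv K n)"
  using qp_X[of K "nat n"]
  by (cases "n < 0") (simp_all add: q_field.iq_def[OF q_field_X] xinv_def fps_to_fls_inverse xpoch_nth_0)

lemma powi_X: "n \<ge> 0 \<Longrightarrow> (fls_X ^ K) powi n = fps_to_fls (fps_X ^ (K * nat n))"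
  by (simp add: power_int_nonneg_exp fps_to_fls_power power_mult)

lemma xinf_approx: "K \<ge> 1 \<Longrightarrow> fcong (Suc n) (xinf K) (xpoch K n)"
  using qpoch_inf_approx[of K K n] by (simp add: xpoch_def)

lemma xinf_xinv:
  assumes "K \<ge> 1" "int N \<le> n"
  shows "fcong N (xinf K * xinv K n) 1"
proof -
  have "fcong (Suc (nat n)) (xinf K * xinv K n) (xpoch K (nat n) * xinv K n)"
    by (intro fcong_mult xinf_approx fcong_refl assms)
  also have "xpoch K (nat n) * xinv K n = 1"
    using assms by (simp add: xinv_def inverse_mult_eq_1' xpoch_nth_0)
  finally show ?thesis by (rule fcong_mono) (use assms in simp)
qed

text \<open>The general term of the series for theta(q^i; q^K) (q^K; q^K)_inf. For i <= K its
  exponent is nonnegative, so \<open>nat\<close> does not truncate.\<close>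

definition jt :: "nat \<Rightarrow> nat \<Rightarrow> int \<Rightarrow> rat fps" where
  "jt K i j = (if even j then 1 else - 1) * fps_X ^ nat (int K * tri j + int i * j)"

lemma jt_fcong_0: "0 < i \<Longrightarrow> i < K \<Longrightarrow> int N \<le> \<bar>j\<bar> \<Longrightarrow> fcong N (jt K i j) 0"
proof -
  assume "0 < i" "i < K" "int N \<le> \<bar>j\<bar>"
  then have "N \<le> nat (int K * tri j + int i * j)" using tri_exponent_ge[of "int i" "int K" j] by linarith
  then have "fcong N (fps_X ^ nat (int K * tri j + int i * j) * (if even j then 1 else - 1)) 0"
    by (rule fcong_X_power_mult)
  then show ?thesis by (simp add: jt_def mult.commute)
qed

lemma finite_jacobi_triple_fps:
  assumes "0 < i" "i < K"
  shows "(\<Sum>j\<in>{- int n..int n}. jt K i j * (xinv K (int n + j) * xinv K (int n - j)))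
    = xinv K (2 * int n) * (\<Prod>t<n. 1 - fps_X ^ i * (fps_X ^ K) ^ t) * (\<Prod>t<n. 1 - fps_X ^ (K - i) * (fps_X ^ K) ^ t)"
proof -
  have K: "K \<ge> 1" using assms by simp
  interpret G: q_field "fls_X ^ K :: rat fls" by (rule q_field_X[OF K])
  have z: "(fls_X ^ i :: rat fls) \<noteq> 0" by simp
  have 1: "(- (fls_X ^ i :: rat fls)) powi j * (fls_X ^ K) powi tri j = fps_to_fls (jt K i j)" for j
  proof -
    have a1: "(- (fls_X ^ i :: rat fls)) powi j = (if even j then 1 else - 1) * (fls_X ^ i) powi j"
      by (simp add: power_int_minus_left)
    have a2: "(fls_X ^ i :: rat fls) powi j * (fls_X ^ K) powi tri j = fls_X powi (int K * tri j + int i * j)"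
    proof -
      have X: "(fls_X :: rat fls) \<noteq> 0" by simp
      show ?thesis unfolding power_int_power power_int_add[OF disjI1, OF X] by (rule mult.commute)
    qed
    have a3: "fls_X powi (int K * tri j + int i * j) = fps_to_fls (fps_X ^ nat (int K * tri j + int i * j))"
    proof -
      have "int K * tri j + int i * j \<ge> 0" using tri_exponent_ge[of "int i" "int K" j] assms by linarith
      from powi_X[OF this, of 1] show ?thesis by (simp only: power_one_right mult_1)
    qed
    have a4: "fps_to_fls (jt K i j) = (if even j then 1 else - 1) * fps_to_fls (fps_X ^ nat (int K * tri j + int i * j))"
      by (simp add: jt_def)
    show ?thesis unfolding a1 a4 mult.assoc a2 a3 ..
  qed
  have 2: "1 - fls_X ^ i * (fls_X ^ K) ^ t = fps_to_fls (1 - fps_X ^ i * (fps_X ^ K) ^ t)"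
     for t and i :: nat
    by (simp add: fls_times_fps_to_fls fps_to_fls_power)
  have 3: "fls_X ^ K / fls_X ^ i = (fls_X ^ (K - i) :: rat fls)"
    using assms by (simp add: power_diff)
  have "fps_to_fls (\<Sum>j\<in>{- int n..int n}. jt K i j * (xinv K (int n + j) * xinv K (int n - j))) = G.jsum (fls_X ^ i) n n"
    unfolding G.jsum_def 1 iq_X[OF K] by (simp only: fps_to_fls_sum fls_times_fps_to_fls mult.assoc)
  also have "\<dots> = fps_to_fls (xinv K (2 * int n) * (\<Prod>t<n. 1 - fps_X ^ i * (fps_X ^ K) ^ t) * (\<Prod>t<n. 1 - fps_X ^ (K - i) * (fps_X ^ K) ^ t))"
    unfolding G.finite_jacobi_triple[OF z] 3 2 iq_X[OF K]
    by (simp only: fps_to_fls_prod fls_times_fps_to_fls mult_2)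
  finally show ?thesis by (simp only: fps_to_fls_eq_iff)
qed

lemma theta_X_power:
  assumes "i \<le> K"
  shows "theta (fps_X ^ i) (fps_X ^ K) = qpoch_inf (fps_X ^ i) (fps_X ^ K) * qpoch_inf (fps_X ^ (K - i)) (fps_X ^ K)"
proof -
  have "fps_X ^ K = (fps_X ^ (K - i) * fps_X ^ i :: rat fps)"
    using assms by (simp flip: power_add)
  then have "fps_X ^ K / fps_X ^ i = (fps_X ^ (K - i) :: rat fps)"
    by (metis fps_X_power_iff nonzero_mult_div_cancel_right fps_X_neq_zero power_eq_0_iff)
  then show ?thesis by (simp add: theta_def)
qed

lemma jacobi_triple:
  assumes i: "0 < i" "i < K"
  shows "(jt K i has_sum (theta (fps_X ^ i) (fps_X ^ K) * xinf K)) UNIV"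
proof (rule has_sum_fps_of_fcong[where B = "\<lambda>N. {- int N..int N}"])
  fix N x assume "x \<in> UNIV - {- int N..int N}"
  then show "fcong N (jt K i x) 0" by (intro jt_fcong_0 i) auto
next
  fix N :: nat
  have K: "K \<ge> 1" using i by simp
  \<comment> \<open>For |j| <= N both n + j and n - j are at least N, so the denominators may be
    replaced by their limits modulo X^N.\<close>
  define n where "n = 2 * N"
  have "fcong N (\<Sum>j\<in>{- int N..int N}. jt K i j) (\<Sum>j\<in>{- int N..int N}. jt K i j * ((xinf K * xinv K (int n + j)) * (xinf K * xinv K (int n - j))))"
  proof (rule fcong_sum)
    fix j assume j: "j \<in> {- int N..int N}"
    have "fcong N (jt K i j * (1 * 1)) (jt K i j * ((xinf K * xinv K (int n + j)) * (xinf K * xinv K (int n - j))))"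
      by (intro fcong_mult fcong_refl fcong_sym[OF xinf_xinv] K) (use j in \<open>auto simp: n_def\<close>)
    then show "fcong N (jt K i j) (jt K i j * ((xinf K * xinv K (int n + j)) * (xinf K * xinv K (int n - j))))" by simp
  qed
  also have "fcong N \<dots> (\<Sum>j\<in>{- int n..int n}. jt K i j * ((xinf K * xinv K (int n + j)) * (xinf K * xinv K (int n - j))))"
  proof (rule fcong_sym, rule fcong_sum_subset)
    fix j assume "j \<in> {- int n..int n} - {- int N..int N}"
    then have "fcong N (jt K i j) 0" by (intro jt_fcong_0 i) auto
    from fcong_mult[OF this fcong_refl]
    show "fcong N (jt K i j * ((xinf K * xinv K (int n + j)) * (xinf K * xinv K (int n - j)))) 0" by simp
  qed (auto simp: n_def)
  also have "(\<Sum>j\<in>{- int n..int n}. jt K i j * ((xinf K * xinv K (int n + j)) * (xinf K * xinv K (int n - j))))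
     = xinf K * xinf K * (\<Sum>j\<in>{- int n..int n}. jt K i j * (xinv K (int n + j) * xinv K (int n - j)))"
    by (simp add: sum_distrib_left mult_ac)
  also have "\<dots> = (xinf K * xinv K (2 * int n)) * ((\<Prod>t<n. 1 - fps_X ^ i * (fps_X ^ K) ^ t) * (\<Prod>t<n. 1 - fps_X ^ (K - i) * (fps_X ^ K) ^ t)) * xinf K"
    unfolding finite_jacobi_triple_fps[OF i] by (simp add: mult_ac)
  also have "fcong N \<dots> (1 * (qpoch_inf (fps_X ^ i) (fps_X ^ K) * qpoch_inf (fps_X ^ (K - i)) (fps_X ^ K)) * xinf K)"
  proof -
    have "fcong N (\<Prod>t<n. 1 - fps_X ^ a * (fps_X ^ K) ^ t) (qpoch_inf (fps_X ^ a) (fps_X ^ K))" if "a \<ge> 1" for a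
      by (rule fcong_sym, rule fcong_mono, rule qpoch_inf_approx[OF K that, of n]) (simp add: n_def)
    then show ?thesis using i
      by (intro fcong_mult fcong_refl xinf_xinv K) (auto simp: n_def)
  qed
  finally show "fcong N (sum (jt K i) {- int N..int N}) (theta (fps_X ^ i) (fps_X ^ K) * xinf K)"
    using i by (simp add: theta_X_power)
qed auto

text \<open>The triple product with modulus 3K and i = K: sorting the factors 1 - X^(K t) by t
  modulo 3 gives its three infinite products.\<close>

lemma pentagonal:
  assumes "K \<ge> 1"
  shows "(jt (3 * K) K has_sum xinf K) UNIV"
proof -
  have split: "xpoch K (3 * n) = (\<Prod>t<n. 1 - fps_X ^ K * (fps_X ^ (3 * K)) ^ t) * (\<Prod>t<n. 1 - fps_X ^ (2 * K) * (fps_X ^ (3 * K)) ^ t)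
     * (\<Prod>t<n. 1 - fps_X ^ (3 * K) * (fps_X ^ (3 * K)) ^ t)" for n
  proof (induction n)
    case (Suc n)
    have e: "(fps_X ^ K) ^ Suc (3 * n) = fps_X ^ K * (fps_X ^ (3 * K)) ^ n"
      "(fps_X ^ K) ^ Suc (Suc (3 * n)) = fps_X ^ (2 * K) * (fps_X ^ (3 * K)) ^ n"
      "(fps_X ^ K) ^ Suc (Suc (Suc (3 * n))) = fps_X ^ (3 * K) * (fps_X ^ (3 * K)) ^ n"
      unfolding power_mult[symmetric] power_add[symmetric]
      by (rule arg_cong[where f = "\<lambda>e. fps_X ^ e"]; simp add: algebra_simps)+
    have x: "xpoch K (3 * Suc n) = xpoch K (3 * n) * (1 - (fps_X ^ K) ^ Suc (3 * n)) * (1 - (fps_X ^ K) ^ Suc (Suc (3 * n))) * (1 - (fps_X ^ K) ^ Suc (Suc (Suc (3 * n))))"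
    proof -
      have "3 * Suc n = Suc (Suc (Suc (3 * n)))" by simp
      then show ?thesis unfolding xpoch_def by (simp only: prod.lessThan_Suc)
    qed
    show ?case unfolding x e Suc.IH prod.lessThan_Suc by (simp only: mult_ac)
  qed (simp add: xpoch_def)
  have "theta (fps_X ^ K) (fps_X ^ (3 * K)) * xinf (3 * K) = xinf K"
  proof (rule fcong_eqI)
    fix N
    have "fcong (Suc N) (theta (fps_X ^ K) (fps_X ^ (3 * K)) * xinf (3 * K)) (xpoch K (3 * N))"
      unfolding split theta_X_power[of K "3 * K", simplified]
      by (intro fcong_mult qpoch_inf_approx) (use assms in auto)
    also have "fcong (Suc N) (xpoch K (3 * N)) (xinf K)"
      by (rule fcong_sym, rule fcong_mono[OF xinf_approx[OF assms]]) simp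
    finally show "fcong N (theta (fps_X ^ K) (fps_X ^ (3 * K)) * xinf (3 * K)) (xinf K)"
      by (rule fcong_mono) simp
  qed
  then show ?thesis using jacobi_triple[of K "3 * K"] assms by simp
qed

subsection \<open>The specialized $A_2$ Macdonald identity\<close>

lemma has_sum_fps_unique:
  fixes f :: "'b \<Rightarrow> rat fps"
  assumes "(f has_sum S) A" "(f has_sum T) A"
  shows "S = T"
  by (rule fps_ext) (simp add: has_sum_fpsD(2)[OF assms(1)] has_sum_fpsD(2)[OF assms(2)])

definition wf :: "nat \<Rightarrow> nat \<Rightarrow> int \<times> int \<Rightarrow> rat fps" where
  "wf K i = (\<lambda>(x, y). chi (x - y) * fps_X ^ nat (int K * qform x y + int i * (2 - (2 * x + y))))"

lemma tri_nonneg: "tri j \<ge> 0"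
proof -
  have "2 * tri j \<ge> 0"
    unfolding tri_double by (cases "j \<ge> 1") (auto intro: mult_nonneg_nonneg mult_nonpos_nonpos)
  then show ?thesis by simp
qed

lemma jt_nonneg: "i \<le> K \<Longrightarrow> int K * tri j + int i * j \<ge> 0"
proof -
  assume i: "i \<le> K"
  show ?thesis
  proof (cases "j \<ge> 0")
    case False
    have "int K * tri j + int i * j = int K * tri (- j) + (int K - int i) * (- j)"
      unfolding tri_uminus by (simp add: algebra_simps)
    moreover have "(int K - int i) * (- j) \<ge> 0" using False i by (intro mult_nonneg_nonneg) auto
    moreover have "int K * tri (- j) \<ge> 0" by (simp add: tri_nonneg)
    ultimately show ?thesis by linarith
  qed (simp add: tri_nonneg)
qed

text \<open>The parametrization of the triples of summation indices of three theta series
  by a lattice vector \<open>(x, y)\<close> and a remaining free index \<open>c\<close>.\<close>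
lemma jt_triple:
  assumes i: "2 * i \<le> K"
  defines "T \<equiv> \<lambda>x y c. tri (1 - x - c) + tri (1 - x - y - c) + tri c"
  shows "jt K i (1 - x - c) * jt K i (1 - x - y - c) * jt K (2 * i) c
      = (if even (c + y) then 1 else - 1) * fps_X ^ nat (int K * T x y c + int i * (2 - (2 * x + y)))"
    and "int K * T x y c + int i * (2 - (2 * x + y)) \<ge> 0"
proof -
  define E1 where "E1 = int K * tri (1 - x - c) + int i * (1 - x - c)"
  define E2 where "E2 = int K * tri (1 - x - y - c) + int i * (1 - x - y - c)"
  define E3 where "E3 = int K * tri c + int (2 * i) * c"
  have nn: "E1 \<ge> 0" "E2 \<ge> 0" "E3 \<ge> 0"
    unfolding E1_def E2_def E3_def by (rule jt_nonneg; use i in simp)+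
  have E: "E1 + E2 + E3 = int K * T x y c + int i * (2 - (2 * x + y))"
    unfolding E1_def E2_def E3_def T_def by (simp add: algebra_simps)
  show "int K * T x y c + int i * (2 - (2 * x + y)) \<ge> 0"
    unfolding E[symmetric] using nn by simp
  have "fps_X ^ nat (E1 + E2 + E3) = fps_X ^ nat E1 * fps_X ^ nat E2 * (fps_X ^ nat E3 :: rat fps)"
    using nn by (simp add: nat_add_distrib power_add)
  then show "jt K i (1 - x - c) * jt K i (1 - x - y - c) * jt K (2 * i) c
      = (if even (c + y) then 1 else - 1) * fps_X ^ nat (int K * T x y c + int i * (2 - (2 * x + y)))"
    unfolding E[symmetric] unfolding jt_def E1_def[symmetric] E2_def[symmetric] E3_def[symmetric]
    by (cases "even x"; cases "even y"; cases "even c") simp_all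
qed

text \<open>Up to a constant the exponent is K times a quadratic polynomial in c with leading
  coefficient 3/2 and vertex (2m - 1)/6. For m congruent to 0 or 1 modulo 3 the vertex is 1/6 away
  from an integer, and the series in c is pentagonal; for m congruent to 2 it is halfway between
  integers, and reflecting c about it reverses the sign. These cases correspond to the values 1, -1
  and 0 of \<open>chi (x - y)\<close>.\<close>

lemma wf_fibre:
  assumes i: "2 * i \<le> K"
  defines "f \<equiv> \<lambda>x y c. jt K i (1 - x - c) * jt K i (1 - x - y - c) * jt K (2 * i) c"
    and "T \<equiv> \<lambda>x y c. tri (1 - x - c) + tri (1 - x - y - c) + tri c"
  shows "(\<exists>c. chi (x - y) \<noteq> (0 :: rat) \<longrightarrow> T x y c = qform x y) \<and>
    (\<exists>h. bij (h :: int \<Rightarrow> int) \<and> (\<forall>t. chi (x - y) \<noteq> (0 :: rat) \<longrightarrow> f x y (h t) = wf K i (x, y) * jt (3 * K) K t)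
      \<and> (chi (x - y) = (0 :: rat) \<longrightarrow> (\<forall>t. f x y (h t) = - f x y t)))"
proof -
  define m where "m = 2 - (2 * x + y)"
  define u where "u = m div 3"
  have T_fold: "tri (1 - x - c) + tri (1 - x - y - c) + tri c = T x y c" for c
    by (simp add: T_def)
  have T2: "2 * T x y c = 3 * c\<^sup>2 + c * (4 * x + 2 * y - 3) + 2 * x\<^sup>2 + 2 * x * y + y\<^sup>2 - 2 * x - y" for c
    unfolding T_def distrib_left tri_double by (simp add: algebra_simps power2_eq_square)
  have combine: "f x y c = wf K i (x, y) * jt (3 * K) K t"
    if T: "T x y c = qform x y + 3 * tri t + t" and chi: "chi (x - y) = (if even (c + y + t) then 1 else - 1 :: rat)"
      and T0: "T x y c0 = qform x y" for c t c0
  proof -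
    define A where "A = int K * qform x y + int i * m"
    define B where "B = int (3 * K) * tri t + int K * t"
    \<comment> \<open>At c0 this is the exponent of an actual product of three theta terms.\<close>
    have "A \<ge> 0" using jt_triple(2)[OF i, of x c0 y] T0 unfolding A_def m_def T_def by simp
    moreover have "B \<ge> 0" unfolding B_def by (rule jt_nonneg) simp
    moreover have "int K * T x y c + int i * m = A + B" unfolding T A_def B_def by (simp add: algebra_simps)
    ultimately have e: "fps_X ^ nat (int K * T x y c + int i * m) = fps_X ^ nat A * (fps_X ^ nat B :: rat fps)"
      by (simp add: nat_add_distrib power_add)
    have chi': "chi (x - y) = (if even (c + y + t) then 1 else - 1 :: rat fps)"
      using chi by (auto simp: chi_def split: if_splits)
    show ?thesis
      unfolding f_def jt_triple(1)[OF i] T_fold m_def[symmetric] e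
      unfolding wf_def jt_def case_prod_conv m_def[symmetric] unfolding A_def[symmetric] B_def[symmetric] chi'
      by (cases "even (c + y)"; cases "even t") simp_all
  qed
  have q: "3 * qform x y = x\<^sup>2 + x * y + y\<^sup>2 - 1" if "chi (x - y) \<noteq> (0 :: rat)"
    by (rule qform_exact[OF that])
  have tt: "2 * (3 * tri t + t) = 3 * t * (t - 1) + 2 * t" for t
    using tri_double[of t] by (simp add: algebra_simps)
  have "m = 3 * u \<or> m = 3 * u + 1 \<or> m = 3 * u + 2"
    unfolding u_def by presburger
  then consider "m = 3 * u" | "m = 3 * u + 1" | "m = 3 * u + 2"
    by blast
  then show ?thesis
  proof cases
    case 1
    then have y: "y = 2 - 2 * x - 3 * u" by (simp add: m_def)
    have chi: "chi (x - y) = (1 :: rat)" unfolding y chi_def by simp presburger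
    have T: "T x y (u - t) = qform x y + 3 * tri t + t" for t
    proof -
      have "6 * T x y (u - t) = 6 * qform x y + 3 * (2 * (3 * tri t + t))"
        using T2[of "u - t"] q chi unfolding tt unfolding y by (simp add: algebra_simps power2_eq_square)
      then show ?thesis by simp
    qed
    have "bij (\<lambda>t. u - t)" by (rule bij_betw_byWitness[where f' = "\<lambda>t. u - t"]) auto
    moreover have "f x y (u - t) = wf K i (x, y) * jt (3 * K) K t" for t
      by (rule combine[OF T _ T[of 0, simplified tri_def, simplified]]) (simp add: chi, simp add: y)
    ultimately show ?thesis
      using T[of 0] chi by (intro conjI exI[of _ u] exI[of _ "\<lambda>t. u - t"]) (auto simp: tri_def)
  next
    case 2
    then have y: "y = 1 - 2 * x - 3 * u" by (simp add: m_def)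
    have chi: "chi (x - y) = (- 1 :: rat)" unfolding y chi_def by simp presburger
    have T: "T x y (u + t) = qform x y + 3 * tri t + t" for t
    proof -
      have "6 * T x y (u + t) = 6 * qform x y + 3 * (2 * (3 * tri t + t))"
        using T2[of "u + t"] q chi unfolding tt unfolding y by (simp add: algebra_simps power2_eq_square)
      then show ?thesis by simp
    qed
    have "bij (\<lambda>t. u + t)" by (rule bij_betw_byWitness[where f' = "\<lambda>t. t - u"]) auto
    moreover have "f x y (u + t) = wf K i (x, y) * jt (3 * K) K t" for t
      by (rule combine[OF T _ T[of 0, simplified tri_def, simplified]]) (simp add: chi, simp add: y)
    ultimately show ?thesis
      using T[of 0] chi by (intro conjI exI[of _ u] exI[of _ "\<lambda>t. u + t"]) (auto simp: tri_def)
  next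
    case 3
    then have y: "y = - 2 * x - 3 * u" by (simp add: m_def)
    have chi: "chi (x - y) = (0 :: rat)" unfolding y chi_def by simp
    have T: "T x y (2 * u + 1 - t) = T x y t" for t
    proof -
      have "2 * T x y (2 * u + 1 - t) = 2 * T x y t"
        unfolding T2 unfolding y by (simp add: algebra_simps power2_eq_square)
      then show ?thesis by simp
    qed
    have "bij (\<lambda>t. 2 * u + 1 - t)" by (rule bij_betw_byWitness[where f' = "\<lambda>t. 2 * u + 1 - t"]) auto
    moreover have "f x y (2 * u + 1 - t) = - f x y t" for t
      unfolding f_def jt_triple(1)[OF i] T_fold T by simp
    ultimately show ?thesis
      using chi by (intro conjI exI[of _ u] exI[of _ "\<lambda>t. 2 * u + 1 - t"]) auto
  qed
qed

lemma wf_nonneg: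
  assumes "2 * i \<le> K" "chi (x - y) \<noteq> (0 :: 'a::field_char_0)"
  shows "int K * qform x y + int i * (2 - (2 * x + y)) \<ge> 0"
proof -
  have "chi (x - y) \<noteq> (0 :: rat)" using assms(2) by (auto simp: chi_def split: if_splits)
  then show ?thesis using wf_fibre[OF assms(1), of x y] jt_triple(2)[OF assms(1), of x _ y] by metis
qed

text \<open>The triples of indices of three theta series are reparametrized by (x, y) and c, a
  bijection. The sum over c is \<open>wf\<close> times the pentagonal series, or its own negative
  and hence 0 when the sign vanishes.\<close>

lemma wf_times_has_sum:
  assumes i: "1 \<le> i" "2 * i < K"
  shows "((\<lambda>p. wf K i p * xinf K) has_sum (thetas [fps_X ^ i, fps_X ^ i, fps_X ^ (2 * i)] (fps_X ^ K) * xinf K ^ 3)) UNIV"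
proof -
  define f where "f = (\<lambda>((x, y), c). jt K i (1 - x - c) * jt K i (1 - x - y - c) * jt K (2 * i) c)"
  define S where "S = thetas [fps_X ^ i, fps_X ^ i, fps_X ^ (2 * i)] (fps_X ^ K) * xinf K ^ 3"
  have K: "K \<ge> 1" "2 * i \<le> K" using i by simp_all
  note j1 = jacobi_triple[of i K] and j2 = jacobi_triple[of "2 * i" K]
  have "((\<lambda>((a, b), c). jt K i a * jt K i b * jt K (2 * i) c) has_sum S) ((UNIV \<times> UNIV) \<times> UNIV)"
    using has_sum_fps_times[OF has_sum_fps_times[OF j1 j1] j2] i
    by (simp add: S_def thetas_def case_prod_unfold power3_eq_cube mult_ac)
  moreover have "bij_betw (\<lambda>((x, y), c). ((1 - x - c, 1 - x - y - c), c)) UNIV (UNIV :: ((int \<times> int) \<times> int) set)"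
    by (rule bij_betw_byWitness[where f' = "\<lambda>((a, b), c). ((1 - a - c, a - b), c)"]) auto
  ultimately have "((\<lambda>p. (\<lambda>((a, b), c). jt K i a * jt K i b * jt K (2 * i) c) ((\<lambda>((x, y), c). ((1 - x - c, 1 - x - y - c), c)) p)) has_sum S) UNIV"
    by (subst has_sum_reindex_bij_betw) simp_all
  then have f: "(f has_sum S) (UNIV \<times> UNIV)"
    by (simp add: f_def case_prod_unfold)
  show ?thesis
    unfolding S_def[symmetric]
  proof (rule has_sum_fps_Sigma[OF f])
    fix p :: "int \<times> int"
    obtain x y where p: "p = (x, y)" by fastforce
    obtain T where T: "((\<lambda>c. f ((x, y), c)) has_sum T) UNIV"
      using has_sum_fps_section[OF f, of "(x, y)"] by auto
    obtain h where h: "bij h"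
      "\<And>t. chi (x - y) \<noteq> (0 :: rat) \<Longrightarrow> f ((x, y), h t) = wf K i (x, y) * jt (3 * K) K t"
      "\<And>t. chi (x - y) = (0 :: rat) \<Longrightarrow> f ((x, y), h t) = - f ((x, y), t)"
      using wf_fibre[OF K(2), of x y] unfolding f_def by auto
    have Th: "((\<lambda>t. f ((x, y), h t)) has_sum T) UNIV"
      using T h(1) by (subst has_sum_reindex_bij_betw[where f = "\<lambda>c. f ((x, y), c)"]) auto
    have "T = wf K i (x, y) * xinf K"
    proof (cases "chi (x - y) = (0 :: rat)")
      case True
      then have "((\<lambda>t. - 1 * f ((x, y), t)) has_sum T) UNIV" using Th h(3) by simp
      moreover have "((\<lambda>t. - 1 * f ((x, y), t)) has_sum (- 1 * T)) UNIV"
        by (rule has_sum_fps_cmult[OF T])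
      ultimately have "T = - 1 * T" by (rule has_sum_fps_unique)
      moreover have "chi (x - y) = (0 :: rat fps)" using True by (auto simp: chi_def split: if_splits)
      ultimately show ?thesis by (simp add: wf_def)
    next
      case False
      then have "((\<lambda>t. wf K i (x, y) * jt (3 * K) K t) has_sum T) UNIV" using Th h(2) by simp
      then show ?thesis
        using has_sum_fps_cmult[OF pentagonal[OF K(1)], of "wf K i (x, y)"] by (rule has_sum_fps_unique)
    qed
    then show "((\<lambda>c. f (p, c)) has_sum (wf K i p * xinf K)) UNIV" using T p by simp
  qed
qed

theorem wf_has_sum:
  assumes i: "1 \<le> i" "2 * i < K"
  shows "(wf K i has_sum (thetas [fps_X ^ i, fps_X ^ i, fps_X ^ (2 * i)] (fps_X ^ K) * xinf K ^ 2)) UNIV"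
proof -
  have K: "K \<ge> 1" using i by simp
  have nz: "fps_nth (xinf K) 0 = 1" by (rule qpoch_inf_nth_0[OF K K])
  then have inv: "inverse (xinf K) * xinf K = 1" by (simp add: inverse_mult_eq_1)
  have wf: "wf K i = (\<lambda>p. inverse (xinf K) * (wf K i p * xinf K))"
    using inv by (simp add: fun_eq_iff mult.left_commute)
  have S: "thetas [fps_X ^ i, fps_X ^ i, fps_X ^ (2 * i)] (fps_X ^ K) * xinf K ^ 2
     = inverse (xinf K) * (thetas [fps_X ^ i, fps_X ^ i, fps_X ^ (2 * i)] (fps_X ^ K) * xinf K ^ 3)"
  proof -
    have "inverse (xinf K) * (t * xinf K ^ 3) = t * xinf K ^ 2 * (inverse (xinf K) * xinf K)" for t
      by (simp add: power2_eq_square power3_eq_cube mult_ac)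
    then show ?thesis unfolding inv mult_1_right by (rule sym)
  qed
  show ?thesis
    unfolding S by (subst wf) (rule has_sum_fps_cmult[OF wf_times_has_sum[OF i]])
qed

subsection \<open>The limit\<close>

interpretation F: q_field "fls_X :: rat fls"
  using q_field_X[of 1] by simp

abbreviation xq :: "int \<Rightarrow> rat fps" where
  "xq \<equiv> xinv 1"

lemma qpoch_X: "qpoch fps_X fps_X n = xpoch 1 n"
  by (simp add: qpoch_eq_prod xpoch_def)

lemma iq_eq_xinv: "F.iq n = fps_to_fls (xq n)"
  using iq_X[of 1 n] by simp

lemma qp_eq_xpoch: "F.qp (int n) = fps_to_fls (xpoch 1 n)"
  using qp_X[of 1 n] by simp

lemma powi_eq_X_power: "n \<ge> 0 \<Longrightarrow> fls_X powi n = fps_to_fls (fps_X ^ nat n :: rat fps)"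
proof -
  assume "n \<ge> 0"
  from powi_X[OF this, of 1] show ?thesis by (simp only: power_one_right mult_1)
qed

lemma qbin_eq_qbinom: "F.qbin n m = fps_to_fls (qbinom n m)"
proof (cases "0 \<le> m \<and> m \<le> n")
  case True
  have "qbinom n m = xpoch 1 (nat n) * xq m * xq (n - m)"
    using True by (simp add: qbinom_def qpoch_X fps_divide_unit xpoch_nth_0 xinv_def fps_inverse_mult mult.assoc)
  then show ?thesis
    using True qp_eq_xpoch[of "nat n"] by (simp add: F.qbin_def iq_eq_xinv fls_times_fps_to_fls)
next
  case False
  then show ?thesis by (auto simp: F.qbin_def qbinom_def)
qed

lemma fps_to_fls_chi: "fps_to_fls (chi d) = (chi d :: rat fls)"
  by (simp add: chi_def)

lemma wt_eq_wf: "2 * i \<le> K \<Longrightarrow> F.wt (int K) (int i) a b = fps_to_fls (wf K i (a, b))"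
proof (cases "chi (a - b) = (0 :: rat)")
  case True
  then have "chi (a - b) = (0 :: rat fls)" "chi (a - b) = (0 :: rat fps)" by (auto simp: chi_def split: if_splits)
  then show ?thesis by (simp add: F.wt_def wf_def)
next
  case False
  assume "2 * i \<le> K"
  from powi_eq_X_power[OF wf_nonneg[OF this False]] show ?thesis
    by (simp only: F.wt_def wf_def case_prod_conv fls_times_fps_to_fls fps_to_fls_chi)
qed

definition xbf :: "int \<Rightarrow> int \<Rightarrow> int \<Rightarrow> int \<Rightarrow> rat fps" where
  "xbf L x y z = xq (L - x) * xq (L - y) * xq (L - z) * xq (L + x) * xq (L + y) * xq (L + z)"

lemma bf_eq_xbf: "F.bf L L x y z = fps_to_fls (xbf L x y z)"
  by (simp only: F.bf_def xbf_def iq_eq_xinv fls_times_fps_to_fls)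

text \<open>Completing the square, 4 (n^2 - nm + m^2) = 3 n^2 + (n - 2m)^2. The linear bound
  confines the terms relevant modulo X^N to a finite box.\<close>

lemma quad_ge: "4 * ((int n)\<^sup>2 - int n * int m + (int m)\<^sup>2) \<ge> 3 * int n"
  "4 * ((int n)\<^sup>2 - int n * int m + (int m)\<^sup>2) \<ge> 3 * int m"
proof -
  have sq: "int x \<le> (int x)\<^sup>2" for x :: nat
    by (cases "x = 0") (simp_all add: power2_eq_square)
  have "4 * ((int n)\<^sup>2 - int n * int m + (int m)\<^sup>2) = 3 * (int n)\<^sup>2 + (int n - 2 * int m)\<^sup>2"
    by (simp add: algebra_simps power2_eq_square)
  then show "4 * ((int n)\<^sup>2 - int n * int m + (int m)\<^sup>2) \<ge> 3 * int n"
    using sq[of n] zero_le_power2[of "int n - 2 * int m"] by linarith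
  have "4 * ((int n)\<^sup>2 - int n * int m + (int m)\<^sup>2) = 3 * (int m)\<^sup>2 + (int m - 2 * int n)\<^sup>2"
    by (simp add: algebra_simps power2_eq_square)
  then show "4 * ((int n)\<^sup>2 - int n * int m + (int m)\<^sup>2) \<ge> 3 * int m"
    using sq[of m] zero_le_power2[of "int m - 2 * int n"] by linarith
qed

lemma qexponent_eq:
  assumes "1 \<le> s"
  shows "qexponent k s n m = (\<Sum>i=1..k - 1. nat ((int (n i))\<^sup>2 - int (n i) * int (m i) + (int (m i))\<^sup>2 + ev s i * (int (n i) + int (m i))))"
proof -
  have nn: "(int (n i))\<^sup>2 - int (n i) * int (m i) + (int (m i))\<^sup>2 + ev s i * (int (n i) + int (m i)) \<ge> 0" for i
    using quad_ge(1)[of "n i" "m i"] by (simp add: ev_def)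
  have "(\<Sum>i = s..k - 1. int (n i) + int (m i)) = (\<Sum>i = 1..k - 1. ev s i * (int (n i) + int (m i)))"
    by (rule sum.mono_neutral_cong_left) (use assms in \<open>auto simp: ev_def\<close>)
  then have "qexponent k s n m = nat (\<Sum>i=1..k - 1. (int (n i))\<^sup>2 - int (n i) * int (m i) + (int (m i))\<^sup>2 + ev s i * (int (n i) + int (m i)))"
    unfolding qexponent_def by (simp add: sum.distrib)
  also have "\<dots> = nat (int (\<Sum>i=1..k - 1. nat ((int (n i))\<^sup>2 - int (n i) * int (m i) + (int (m i))\<^sup>2 + ev s i * (int (n i) + int (m i)))))"
    using nn by simp
  finally show ?thesis by (simp only: nat_int)
qed

lemma fps_to_fls_summand:
  assumes "1 \<le> s"
  shows "F.tw k s 1 n m * F.iq (int (n 1)) = fps_to_fls (summand k s n m)"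
proof -
  define E where "E i = (int (n i))\<^sup>2 - int (n i) * int (m i) + (int (m i))\<^sup>2 + ev s i * (int (n i) + int (m i))" for i
  have nn: "E i \<ge> 0" for i
    using quad_ge(1)[of "n i" "m i"] by (simp add: ev_def E_def)
  have q: "(\<Prod>i=1..k - 1. F.quad s i (n i) (m i)) = fps_to_fls (fps_X ^ qexponent k s n m)"
    unfolding qexponent_eq[OF assms] F.quad_def E_def[symmetric] powi_eq_X_power[OF nn] power_sum fps_to_fls_prod ..
  have i: "summand k s n m = fps_X ^ qexponent k s n m * xq (int (n 1)) * qbinom (2 * int (n (k - 1))) (int (m (k - 1))) *
     (\<Prod>i = 1..k - 2. qbinom (int (n i)) (int (n (i + 1))) *
        qbinom (int (n i) - int (n (i + 1)) + int (m (i + 1)) + kdelta i (s - 1)) (int (m i)))"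
    unfolding summand_def qpoch_X by (simp add: fps_divide_unit xpoch_nth_0 xinv_def)
  show ?thesis
    unfolding F.tw_def q i iq_eq_xinv qbin_eq_qbinom fls_times_fps_to_fls fps_to_fls_prod by (simp only: mult_ac)
qed

text \<open>Level i alone contributes at least 3 (2N + 1)/4 > N to the exponent, and the other
  levels are nonnegative.\<close>

lemma summand_fcong_0:
  assumes s: "1 \<le> s" and i: "1 \<le> i" "i \<le> k - 1" and N: "n i > 2 * N \<or> m i > 2 * N"
  shows "fcong N (summand k s n m) 0"
proof -
  define E where "E i = (int (n i))\<^sup>2 - int (n i) * int (m i) + (int (m i))\<^sup>2 + ev s i * (int (n i) + int (m i))" for i
  have "4 * E i \<ge> 3 * int (n i)" "4 * E i \<ge> 3 * int (m i)"
    using quad_ge(1)[of "n i" "m i"] quad_ge(2)[of "m i" "n i"] by (simp_all add: E_def ev_def)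
  then have "N \<le> nat (E i)" using N by linarith
  also have "nat (E i) \<le> qexponent k s n m"
    unfolding qexponent_eq[OF s] E_def using i by (intro member_le_sum) auto
  finally have "fcong N (fps_X ^ qexponent k s n m * f) 0" for f
    by (rule fcong_X_power_mult)
  then show ?thesis
    unfolding summand_def qpoch_X by (simp add: fps_divide_unit xpoch_nth_0 mult.assoc)
qed

section \<open>The truncated multisum and its limit\<close>

definition msum :: "nat \<Rightarrow> nat \<Rightarrow> nat \<Rightarrow> rat fps" where
  "msum k s L = (\<Sum>(n, m)\<in>Pi\<^sub>E {1..k - 1} (\<lambda>_. {..L}) \<times> Pi\<^sub>E {1..k - 1} (\<lambda>i. {..mbound k L i}).
     summand k s n m * (xq (int L - int (n 1)) * xq (int L) * xq (int L - int (n 1) + ev s 1 + int (m 1))))"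

lemma msum_eq_phi:
  assumes "1 \<le> s" "s \<le> k - 1"
  shows "fps_to_fls (msum k s L) = (F.phi 0 ^^ (s - 1)) ((F.phi 1 ^^ (k - s)) F.gam) (int L) (int L)"
proof -
  have "fps_to_fls (msum k s L) = F.gsum k s L 1 (int L) (int L)"
    unfolding msum_def F.gsum_def fps_to_fls_sum sum.cartesian_product F.gq_def
    by (intro sum.cong refl)
      (simp add: case_prod_unfold fls_times_fps_to_fls fps_to_fls_summand[OF assms(1), simplified, symmetric] iq_eq_xinv mult_ac)
  also have "\<dots> = (F.phi 0 ^^ (s - 1)) ((F.phi 1 ^^ (k - max 1 s)) F.gam) (int L) (int L)"
    by (rule F.gsum_eq_phi) (use assms in auto)
  finally show ?thesis using assms by (simp add: max_def)
qed

lemma msum_1: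
  assumes "2 \<le> k"
  shows "msum k 1 L = (\<Sum>(a, b)\<in>lat (int L + 1). wf (3 * k + 1) 1 (a, b) * (xpoch 1 (2 * L + 2) * xbf (int L + 1) a b (- a - b)))"
proof -
  have K: "4 + 3 * int (k - 1) = int (3 * k + 1)" using assms by simp
  have n: "int L + int L + 2 = int (2 * L + 2)" by simp
  have "fps_to_fls (msum k 1 L) = (F.phi 1 ^^ (k - 1)) F.gam (int L) (int L)"
    using msum_eq_phi[of 1 k L] assms by simp
  also have "\<dots> = (\<Sum>(a, b)\<in>lat (int L + 1). F.wt (int (3 * k + 1)) (int 1) a b * (F.qp (int (2 * L + 2)) * F.bf (int L + 1) (int L + 1) a b (- a - b)))"
    using F.phi_1_gam[of "int L" "int L" "int L + 1" "k - 1"] unfolding K n by simp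
  also have "\<dots> = fps_to_fls (\<Sum>(a, b)\<in>lat (int L + 1). wf (3 * k + 1) 1 (a, b) * (xpoch 1 (2 * L + 2) * xbf (int L + 1) a b (- a - b)))"
  proof -
    have w: "F.wt (int (3 * k + 1)) (int 1) a b = fps_to_fls (wf (3 * k + 1) 1 (a, b))" for a b
      by (rule wt_eq_wf) (use assms in simp)
    show ?thesis unfolding w qp_eq_xpoch bf_eq_xbf by (simp only: fps_to_fls_sum fls_times_fps_to_fls case_prod_unfold)
  qed
  finally show ?thesis by (simp only: fps_to_fls_eq_iff)
qed

lemma msum_rec:
  assumes "2 \<le> s" "s \<le> k - 1"
  shows "msum k s L - fps_X * msum k (s - 1) L
    = (\<Sum>(a, b)\<in>lat (int L + 1). wf (3 * k + 1) s (a, b) * (xpoch 1 (2 * L) * xbf (int L) (a - 1) b (- a - b + 1)))"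
proof -
  have n: "int L + int L = int (2 * L)" by simp
  have K: "3 * int k + 1 = int (3 * k + 1)" by simp
  have "fps_to_fls (msum k s L - fps_X * msum k (s - 1) L) = (F.phi 0 ^^ (s - 1)) ((F.phi 1 ^^ (k - s)) F.gam) (int L) (int L)
      - fls_X * (F.phi 0 ^^ (s - 2)) ((F.phi 1 ^^ (k - (s - 1))) F.gam) (int L) (int L)"
    using msum_eq_phi[of s k L] msum_eq_phi[of "s - 1" k L] assms by (simp add: fls_times_fps_to_fls diff_diff_eq numeral_2_eq_2)
  also have "\<dots> = (\<Sum>(a, b)\<in>lat (int L + 1). F.wt (int (3 * k + 1)) (int s) a b * (F.qp (int (2 * L)) * F.bf (int L) (int L) (a - 1) b (- a - b + 1)))"
    using F.phi_chain_diff[of s k "int L" "int L" "int L + 1"] assms unfolding K n by simp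
  also have "\<dots> = fps_to_fls (\<Sum>(a, b)\<in>lat (int L + 1). wf (3 * k + 1) s (a, b) * (xpoch 1 (2 * L) * xbf (int L) (a - 1) b (- a - b + 1)))"
  proof -
    have w: "F.wt (int (3 * k + 1)) (int s) a b = fps_to_fls (wf (3 * k + 1) s (a, b))" for a b
      by (rule wt_eq_wf) (use assms in simp)
    show ?thesis unfolding w qp_eq_xpoch bf_eq_xbf by (simp only: fps_to_fls_sum fls_times_fps_to_fls case_prod_unfold)
  qed
  finally show ?thesis by (simp only: fps_to_fls_eq_iff)
qed

text \<open>Modulo X^N only finitely many lattice points matter; from some level on all of them lie
  in the growing triangle and have their factor congruent to 1.\<close>

lemma lat_limit:
  assumes g: "(g has_sum M) UNIV"
    and G: "\<And>a b N. \<exists>L0. \<forall>L\<ge>L0. fcong N (G L (a, b)) 1"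
  shows "\<exists>L0. \<forall>L\<ge>L0. fcong N (\<Sum>p\<in>lat (int L + 1). g p * G L p) M"
proof -
  define F where "F = (\<Union>i\<le>N. {p. fps_nth (g p) i \<noteq> 0})"
  have fin: "finite F" using has_sum_fpsD(1)[OF g] by (simp add: F_def)
  have "\<exists>L0. \<forall>L\<ge>L0. fcong N (G L p) 1" for p
    using G by (cases p) simp
  then obtain l where l: "\<And>p L. L \<ge> l p \<Longrightarrow> fcong N (G L p) 1"
    by metis
  define L0 where "L0 = Max (insert 0 ((\<lambda>p. max (l p) (nat (\<bar>fst p\<bar> + \<bar>snd p\<bar>))) ` F))"
  have L0: "l p \<le> L0" "\<bar>fst p\<bar> + \<bar>snd p\<bar> \<le> int L0" if "p \<in> F" for p
  proof -
    have "max (l p) (nat (\<bar>fst p\<bar> + \<bar>snd p\<bar>)) \<le> L0"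
      unfolding L0_def using fin that by (intro Max_ge) auto
    then show "l p \<le> L0" "\<bar>fst p\<bar> + \<bar>snd p\<bar> \<le> int L0"
      by (simp_all only: max.bounded_iff nat_le_iff)
  qed
  show ?thesis
  proof (intro exI allI impI)
    fix L assume L: "L0 \<le> L"
    have "fcong N (\<Sum>p\<in>lat (int L + 1). g p * G L p) (\<Sum>p\<in>F. g p * G L p)"
    proof (rule fcong_sum_subset)
      show "F \<subseteq> lat (int L + 1)"
      proof
        fix p assume "p \<in> F"
        from L0(2)[OF this] L show "p \<in> lat (int L + 1)" by (cases p) (auto simp: lat_def)
      qed
      fix p assume "p \<in> lat (int L + 1) - F"
      then have "fcong N (g p) 0" by (auto simp: F_def fcong_def)
      from fcong_mult[OF this fcong_refl] show "fcong N (g p * G L p) 0" by simp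
    qed simp
    also have "fcong N \<dots> (\<Sum>p\<in>F. g p * 1)"
      by (intro fcong_sum fcong_mult fcong_refl l) (use L0(1) L in fastforce)
    also have "fcong N (\<Sum>p\<in>F. g p * 1) M"
      unfolding fcong_def fps_sum_nth
      using has_sum_fps_nth[OF g fin] by (auto simp: F_def)
    finally show "fcong N (\<Sum>p\<in>lat (int L + 1). g p * G L p) M" .
  qed
qed

text \<open>Six denominators against one numerator, each tending to (q)_inf, leave (q)_inf^5 as the
  normalizing power.\<close>

lemma xbf_limit:
  assumes "\<bar>x\<bar> \<le> L - int N" "\<bar>y\<bar> \<le> L - int N" "\<bar>z\<bar> \<le> L - int N" "N \<le> n"
  shows "fcong N (xinf 1 ^ 5 * (xpoch 1 n * xbf L x y z)) 1"
proof -
  have "fcong N (xinf 1 ^ 5 * (xpoch 1 n * xbf L x y z)) (xinf 1 ^ 5 * (xinf 1 * xbf L x y z))"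
    by (intro fcong_mult fcong_refl fcong_sym[OF fcong_mono[OF xinf_approx]]) (use assms in auto)
  also have "xinf 1 ^ 5 * (xinf 1 * xbf L x y z) = (xinf 1 * xq (L - x)) * (xinf 1 * xq (L - y)) * (xinf 1 * xq (L - z)) *
     (xinf 1 * xq (L + x)) * (xinf 1 * xq (L + y)) * (xinf 1 * xq (L + z))"
    unfolding xbf_def by (simp add: eval_nat_numeral mult_ac)
  also have "fcong N \<dots> (1 * 1 * 1 * 1 * 1 * 1)"
    by (intro fcong_mult xinf_xinv) (use assms in auto)
  finally show ?thesis by simp
qed

definition macdonald :: "nat \<Rightarrow> nat \<Rightarrow> rat fps" where
  "macdonald K i = thetas [fps_X ^ i, fps_X ^ i, fps_X ^ (2 * i)] (fps_X ^ K) * xinf K ^ 2"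

text \<open>By \<open>msum_rec\<close> the sum for s minus q times the sum for s - 1 is one lattice
  sum, hence one Macdonald product in the limit; solving this recurrence produces the weights
  q^(s-i). For s = 1 the unshifted lattice sum is used.\<close>

lemma msum_limit:
  assumes "1 \<le> s" "s \<le> k - 1"
  shows "\<exists>L0. \<forall>L\<ge>L0. fcong N (xinf 1 ^ 5 * msum k s L) (\<Sum>i=1..s. fps_X ^ (s - i) * macdonald (3 * k + 1) i)"
  using assms
proof (induction s rule: dec_induct)
  case base
  have k: "2 \<le> k" using base by simp
  have "\<exists>L0. \<forall>L\<ge>L0. fcong N (\<Sum>p\<in>lat (int L + 1). wf (3 * k + 1) 1 p *
      (\<lambda>(a, b). xinf 1 ^ 5 * (xpoch 1 (2 * L + 2) * xbf (int L + 1) a b (- a - b))) p) (macdonald (3 * k + 1) 1)"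
  proof (rule lat_limit)
    show "(wf (3 * k + 1) 1 has_sum macdonald (3 * k + 1) 1) UNIV"
      unfolding macdonald_def by (rule wf_has_sum) (use k in simp_all)
    fix a b :: int and N
    have "fcong N (xinf 1 ^ 5 * (xpoch 1 (2 * L + 2) * xbf (int L + 1) a b (- a - b))) 1" if "L \<ge> N + nat (\<bar>a\<bar> + \<bar>b\<bar>)" for L
      by (rule xbf_limit) (use that in auto)
    then show "\<exists>L0. \<forall>L\<ge>L0. fcong N (case (a, b) of (a, b) \<Rightarrow> xinf 1 ^ 5 * (xpoch 1 (2 * L + 2) * xbf (int L + 1) a b (- a - b))) 1"
      by auto
  qed
  then show ?case
    unfolding msum_1[OF k] by (simp add: sum_distrib_left case_prod_unfold mult_ac)
next
  case (step s)
  have s: "2 \<le> Suc s" "Suc s \<le> k - 1" "2 * Suc s < 3 * k + 1" using step by simp_all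
  have "\<exists>L0. \<forall>L\<ge>L0. fcong N (\<Sum>p\<in>lat (int L + 1). wf (3 * k + 1) (Suc s) p *
      (\<lambda>(a, b). xinf 1 ^ 5 * (xpoch 1 (2 * L) * xbf (int L) (a - 1) b (- a - b + 1))) p) (macdonald (3 * k + 1) (Suc s))"
  proof (rule lat_limit)
    show "(wf (3 * k + 1) (Suc s) has_sum macdonald (3 * k + 1) (Suc s)) UNIV"
      unfolding macdonald_def by (rule wf_has_sum) (use s in simp_all)
    fix a b :: int and N
    have "fcong N (xinf 1 ^ 5 * (xpoch 1 (2 * L) * xbf (int L) (a - 1) b (- a - b + 1))) 1" if "L \<ge> N + nat (\<bar>a\<bar> + \<bar>b\<bar> + 1)" for L
      by (rule xbf_limit) (use that in auto)
    then show "\<exists>L0. \<forall>L\<ge>L0. fcong N (case (a, b) of (a, b) \<Rightarrow> xinf 1 ^ 5 * (xpoch 1 (2 * L) * xbf (int L) (a - 1) b (- a - b + 1))) 1"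
      by auto
  qed
  then obtain L1 where L1: "\<And>L. L \<ge> L1 \<Longrightarrow> fcong N (xinf 1 ^ 5 * (msum k (Suc s) L - fps_X * msum k s L)) (macdonald (3 * k + 1) (Suc s))"
    using msum_rec[OF s(1,2)] by (auto simp: sum_distrib_left case_prod_unfold mult_ac)
  obtain L2 where L2: "\<And>L. L \<ge> L2 \<Longrightarrow> fcong N (xinf 1 ^ 5 * msum k s L) (\<Sum>i=1..s. fps_X ^ (s - i) * macdonald (3 * k + 1) i)"
    using step by auto
  show ?case
  proof (intro exI allI impI)
    fix L assume "max L1 L2 \<le> L"
    then have L: "L1 \<le> L" "L2 \<le> L" by simp_all
    have "xinf 1 ^ 5 * msum k (Suc s) L = xinf 1 ^ 5 * (msum k (Suc s) L - fps_X * msum k s L) + fps_X * (xinf 1 ^ 5 * msum k s L)"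
      by (simp add: algebra_simps)
    also have "fcong N \<dots> (macdonald (3 * k + 1) (Suc s) + fps_X * (\<Sum>i=1..s. fps_X ^ (s - i) * macdonald (3 * k + 1) i))"
      by (intro fcong_add fcong_mult[OF fcong_refl] L1 L2 L)
    also have "macdonald (3 * k + 1) (Suc s) + fps_X * (\<Sum>i=1..s. fps_X ^ (s - i) * macdonald (3 * k + 1) i)
       = (\<Sum>i=1..Suc s. fps_X ^ (Suc s - i) * macdonald (3 * k + 1) i)"
      by (simp add: sum_distrib_left Suc_diff_le mult_ac)
    finally show "fcong N (xinf 1 ^ 5 * msum k (Suc s) L) (\<Sum>i=1..Suc s. fps_X ^ (Suc s - i) * macdonald (3 * k + 1) i)" .
  qed
qed

definition box :: "nat \<Rightarrow> nat \<Rightarrow> (nat \<Rightarrow> nat) set" where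
  "box k N = Pi\<^sub>E {1..k - 1} (\<lambda>_. {..2 * N})"

lemma summand_outside_box:
  assumes "1 \<le> s" "n \<in> tuples k" "m \<in> tuples k" "(n, m) \<notin> box k N \<times> box k N"
  shows "fcong N (summand k s n m) 0"
proof -
  from assms(2-4) obtain i where "i \<in> {1..k - 1}" "n i > 2 * N \<or> m i > 2 * N"
    by (auto simp: box_def tuples_def PiE_iff not_le)
  then show ?thesis by (intro summand_fcong_0 assms(1)) auto
qed

text \<open>Apart from the cutoffs, L enters through three factors, each tending to 1/(q)_inf. With
  n_1 <= 2N and L >= 3N their indices are at least N, which suffices modulo X^N.\<close>

lemma msum_eq_box:
  assumes s: "1 \<le> s" and k: "2 \<le> k" and L: "3 * N \<le> L"
  shows "fcong N (xinf 1 ^ 3 * msum k s L) (\<Sum>(n, m)\<in>box k N \<times> box k N. summand k s n m)"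
proof -
  define c where "c n m = xinf 1 ^ 3 * (xq (int L - int (n 1)) * xq (int L) * xq (int L - int (n 1) + ev s 1 + int (m 1)))" for n m :: "nat \<Rightarrow> nat"
  define B where "B = Pi\<^sub>E {1..k - 1} (\<lambda>_. {..L}) \<times> Pi\<^sub>E {1..k - 1} (\<lambda>i. {..mbound k L i})"
  have "xinf 1 ^ 3 * msum k s L = (\<Sum>(n, m)\<in>B. summand k s n m * c n m)"
    by (simp add: msum_def B_def c_def sum_distrib_left case_prod_unfold mult_ac)
  also have "fcong N \<dots> (\<Sum>(n, m)\<in>box k N \<times> box k N. summand k s n m * c n m)"
  proof (rule fcong_sum_subset)
    show "finite B" by (simp add: B_def finite_PiE)
    show "box k N \<times> box k N \<subseteq> B"
      using L unfolding box_def B_def by (intro Sigma_mono PiE_mono) (auto simp: mbound_def)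
    fix p assume p: "p \<in> B - box k N \<times> box k N"
    then have "fcong N (summand k s (fst p) (snd p)) 0"
      by (intro summand_outside_box s) (auto simp: B_def tuples_def PiE_iff)
    from fcong_mult[OF this fcong_refl]
    show "fcong N (case p of (n, m) \<Rightarrow> summand k s n m * c n m) 0" by (simp add: case_prod_unfold)
  qed
  also have "fcong N \<dots> (\<Sum>(n, m)\<in>box k N \<times> box k N. summand k s n m * 1)"
  proof (rule fcong_sum, clarify)
    fix n m assume n: "n \<in> box k N" and "m \<in> box k N"
    have "1 \<in> {1..k - 1}" using k by simp
    with n have "n 1 \<le> 2 * N" unfolding box_def by (auto simp: PiE_iff)
    then have "fcong N ((xinf 1 * xq (int L - int (n 1))) * (xinf 1 * xq (int L)) * (xinf 1 * xq (int L - int (n 1) + ev s 1 + int (m 1)))) (1 * 1 * 1)"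
      by (intro fcong_mult xinf_xinv) (use L in \<open>auto simp: ev_def\<close>)
    then have "fcong N (c n m) 1" by (simp add: c_def power3_eq_cube mult_ac)
    then show "fcong N (summand k s n m * c n m) (summand k s n m * 1)"
      by (rule fcong_mult[OF fcong_refl])
  qed
  finally show ?thesis by simp
qed

theorem theorem2p10:
  fixes k s :: nat
  assumes "1 \<le> s" and "s \<le> k - 1"
  shows "((\<lambda>(n, m). summand k s n m) has_sum
      (qpoch_inf (fps_X ^ (3 * k + 1)) (fps_X ^ (3 * k + 1)) ^ 2 / qpoch_inf fps_X fps_X ^ 2 *
       (\<Sum>i = 1..s. fps_X ^ (s - i) *
          thetas [fps_X ^ i, fps_X ^ i, fps_X ^ (2 * i)] (fps_X ^ (3 * k + 1)))))
    (tuples k \<times> tuples k)"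
proof -
  define R where "R = (\<Sum>i=1..s. fps_X ^ (s - i) * macdonald (3 * k + 1) i)"
  have k: "2 \<le> k" using assms by simp
  have nth0: "fps_nth (xinf 1) 0 = 1" by (rule qpoch_inf_nth_0) simp_all
  have inv: "inverse (xinf 1) ^ 2 * xinf 1 ^ 2 = 1"
    using nth0 by (simp add: inverse_mult_eq_1 flip: power_mult_distrib)
  have "qpoch_inf (fps_X ^ (3 * k + 1)) (fps_X ^ (3 * k + 1)) ^ 2 / qpoch_inf fps_X fps_X ^ 2 *
       (\<Sum>i = 1..s. fps_X ^ (s - i) * thetas [fps_X ^ i, fps_X ^ i, fps_X ^ (2 * i)] (fps_X ^ (3 * k + 1)))
     = inverse (xinf 1) ^ 2 * R"
    using nth0 by (simp add: R_def macdonald_def fps_divide_unit fps_inverse_power fps_nth_power_0 sum_distrib_left mult_ac)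
  moreover have "((\<lambda>(n, m). summand k s n m) has_sum (inverse (xinf 1) ^ 2 * R)) (tuples k \<times> tuples k)"
  proof (rule has_sum_fps_of_fcong[where B = "\<lambda>N. box k N \<times> box k N"])
    fix N
    show "finite (box k N \<times> box k N)" by (simp add: box_def finite_PiE)
    show "box k N \<times> box k N \<subseteq> tuples k \<times> tuples k"
      unfolding box_def tuples_def by (intro Sigma_mono PiE_mono) auto
    fix p assume "p \<in> tuples k \<times> tuples k - box k N \<times> box k N"
    then show "fcong N (case p of (n, m) \<Rightarrow> summand k s n m) 0"
      by (cases p) (auto intro!: summand_outside_box assms)
  next
    fix N
    obtain L0 where L0: "\<And>L. L \<ge> L0 \<Longrightarrow> fcong N (xinf 1 ^ 5 * msum k s L) R"
      using msum_limit[OF assms, of N] unfolding R_def by auto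
    define L where "L = max L0 (3 * N)"
    define A where "A = (\<Sum>(n, m)\<in>box k N \<times> box k N. summand k s n m)"
    \<comment> \<open>Of the five powers of (q)_inf that normalize the lattice sums, three are
      absorbed by the weight in \<open>msum\<close>; the other two form the denominator of the
      result.\<close>
    have "A = inverse (xinf 1) ^ 2 * (xinf 1 ^ 2 * A)"
      by (simp only: mult.assoc[symmetric] inv mult_1_left)
    also have "fcong N \<dots> (inverse (xinf 1) ^ 2 * (xinf 1 ^ 2 * (xinf 1 ^ 3 * msum k s L)))"
      unfolding A_def by (intro fcong_mult fcong_refl fcong_sym[OF msum_eq_box] assms k) (simp add: L_def)
    also have "xinf 1 ^ 2 * (xinf 1 ^ 3 * msum k s L) = xinf 1 ^ 5 * msum k s L"
      by (simp add: mult.assoc[symmetric] flip: power_add)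
    also have "fcong N (inverse (xinf 1) ^ 2 * (xinf 1 ^ 5 * msum k s L)) (inverse (xinf 1) ^ 2 * R)"
      by (intro fcong_mult fcong_refl L0) (simp add: L_def)
    finally show "fcong N (\<Sum>(n, m)\<in>box k N \<times> box k N. summand k s n m) (inverse (xinf 1) ^ 2 * R)"
      unfolding A_def .
  qed
  ultimately show ?thesis by (simp only:)
qed

end
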